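(* Let $\Omega\subset\mathbb{R}^n$ be open and bounded, and let $\rho:\mathbb{R}^n\to[0,\infty]$ have compact support and satisfy, for some $\varepsilon>0$: (a) $\rho$ is radial with radial representation $\overline\rho$, $\rho(x)<\infty$ for all $x\ne0$, $\rho\in L^1_{\mathrm{loc}}(\mathbb{R}^n)$, $\int_{\mathbb{R}^n}\min\{1,|x|^{-1}\}\rho(x)\,dx<\infty$, and $\inf_{B_\varepsilon}\rho>0$; (b) the function $f_\rho:(0,\infty)\to\mathbb{R}$, $f_\rho(t)=t^{n-2}\overline\rho(t)$, is decreasing, and there is $0<\mu<1$ such that $\mu f_\rho(t/2)\ge f_\rho(t)$ for all $t\in(0,\varepsilon)$. Then the following two statements hold. (i) If $\liminf_{t\downarrow0}t^{n-1}\overline\rho(t)>0$, then there is a constant $C=C(\Omega,n,\rho)>0$ such that $$\|u\|_{L^2(\Omega)}\le C\|D_\rho u\|_{L^2(\mathbb{R}^n,\mathbb{R}^n)}\quad\text{for all }u\in H^\rho_0(\Omega).$$ (ii) If $\lim_{t\downarrow0}t^{n-1}\overline\rho(t)=\infty$, then $H^\rho_0(\Omega)$ is compactly embedded into $L^2(\mathbb{R}^n)$.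
   Context: Here $n\in\mathbb{N}$, $n\ge1$; $B_r$ is the open ball of radius $r$ centred at $0$; radial means $\rho(x)=\overline{\rho}(|x|)$ with $\overline\rho$ defined on $[0,\infty)$ (the radial representation); "decreasing" is meant in the wide (non-strict) sense. For $\Phi\in C_c^\infty(\mathbb{R}^n,\mathbb{R}^n)$ the nonlocal divergence is $$\operatorname{div}_\rho\Phi(x)=\int_{\mathbb{R}^n}\frac{\Phi(x)-\Phi(y)}{|x-y|}\cdot\frac{x-y}{|x-y|}\rho(x-y)\,dy.$$ For $u\in L^1(\mathbb{R}^n)+L^\infty(\mathbb{R}^n)$ the weak nonlocal gradient $D_\rho u$ is the distribution $\langle D_\rho u,\Phi\rangle=-\int_{\mathbb{R}^n}u\,\operatorname{div}_\rho\Phi\,dx$, $\Phi\in C_c^\infty(\mathbb{R}^n,\mathbb{R}^n)$. $H^\rho(\mathbb{R}^n)$ is the set of (real-valued) $u\in L^2(\mathbb{R}^n)$ with $D_\rho u\in L^2(\mathbb{R}^n,\mathbb{R}^n)$, with norm $\left(\|u\|_{L^2}^2+\|D_\rho u\|_{L^2}^2\right)^{1/2}$, and $H^\rho_0(\Omega)=\{u\in H^\rho(\mathbb{R}^n):u=0\text{ a.e. in }\Omega^c\}$ with the same norm. *)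

theory Defs
  imports "HOL-Analysis.Analysis"
begin

section \<open>Smooth compactly supported functions\<close>

text \<open>\<open>C_k k f\<close>: all iterated directional derivatives of \<open>f\<close> of order at most \<open>k\<close> exist on the
  whole space as directional derivatives of Frechet differentiable functions and are continuous.\<close>

primrec C_k :: "nat \<Rightarrow> ('a::real_normed_vector \<Rightarrow> 'b::real_normed_vector) \<Rightarrow> bool" where
  "C_k 0 f \<longleftrightarrow> continuous_on UNIV f"
| "C_k (Suc k) f \<longleftrightarrow>
     (\<forall>x. f differentiable (at x)) \<and> (\<forall>v. C_k k (\<lambda>x. frechet_derivative f (at x) v))"

definition supp :: "('a::topological_space \<Rightarrow> 'b::zero) \<Rightarrow> 'a set" where
  "supp f = closure {x. f x \<noteq> 0}"

definition test_fields :: "(real^'n \<Rightarrow> real^'n) set" where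
  "test_fields = {\<Phi>. (\<forall>k. C_k k \<Phi>) \<and> compact (supp \<Phi>)}"

section \<open>Square-integrable functions\<close>

text \<open>Elements of \<open>L\<^sup>2\<close> are represented by functions rather than by classes modulo almost
  everywhere equality, so \<open>L2_norm M\<close> is a seminorm on \<open>L2 M\<close>.\<close>

definition L2 :: "'a measure \<Rightarrow> ('a \<Rightarrow> 'b::{real_normed_vector}) set" where
  "L2 M = {f. f \<in> borel_measurable M \<and> integrable M (\<lambda>x. (norm (f x))\<^sup>2)}"

definition L2_norm :: "'a measure \<Rightarrow> ('a \<Rightarrow> 'b::real_normed_vector) \<Rightarrow> real" where
  "L2_norm M f = sqrt (\<integral>x. (norm (f x))\<^sup>2 \<partial>M)"

section \<open>Kernels\<close>

text \<open>Kernels take values in \<open>[0,\<infinity>]\<close>. A radial representation is only relevant on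
  \<open>[0,\<infinity>)\<close>; its values at negative arguments are arbitrary.\<close>

definition radial_repr :: "(real^'n \<Rightarrow> ennreal) \<Rightarrow> (real \<Rightarrow> ennreal) \<Rightarrow> bool" where
  "radial_repr \<rho> \<rho>r \<longleftrightarrow> (\<forall>x. \<rho> x = \<rho>r (norm x))"

definition L1_loc :: "(real^'n \<Rightarrow> ennreal) \<Rightarrow> bool" where
  "L1_loc \<rho> \<longleftrightarrow> \<rho> \<in> borel_measurable lebesgue \<and>
     (\<forall>K. compact K \<longrightarrow> (\<integral>\<^sup>+x\<in>K. \<rho> x \<partial>lebesgue) < \<infinity>)"

text \<open>\<open>f_kernel TYPE('n) \<rho>r t = t\<^bsup>n-2\<^esup> \<rho>r t\<close> with \<open>n = CARD('n)\<close>. The exponent is an integer, equal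
  to \<open>-1\<close> when \<open>n = 1\<close>; \<open>enn2real\<close> is harmless as kernels are finite away from the origin.\<close>

definition f_kernel :: "'n itself \<Rightarrow> (real \<Rightarrow> ennreal) \<Rightarrow> real \<Rightarrow> real" where
  "f_kernel _ \<rho>r t = t powi (int CARD('n) - 2) * enn2real (\<rho>r t)"

section \<open>Nonlocal divergence and weak nonlocal gradient\<close>

text \<open>A possibly infinite value of the kernel at the origin only affects the integrand at
  \<open>y = x\<close>, hence not the integral.\<close>

definition nonlocal_div ::
    "(real^'n \<Rightarrow> ennreal) \<Rightarrow> (real^'n \<Rightarrow> real^'n) \<Rightarrow> real^'n \<Rightarrow> real" where
  "nonlocal_div \<rho> \<Phi> x =
     (\<integral>y. (((\<Phi> x - \<Phi> y) /\<^sub>R norm (x - y)) \<bullet> ((x - y) /\<^sub>R norm (x - y)))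
            * enn2real (\<rho> (x - y)) \<partial>lebesgue)"

definition weak_nonlocal_grad ::
    "(real^'n \<Rightarrow> ennreal) \<Rightarrow> (real^'n \<Rightarrow> real) \<Rightarrow> (real^'n \<Rightarrow> real^'n) \<Rightarrow> real" where
  "weak_nonlocal_grad \<rho> u \<Phi> = - (\<integral>x. u x * nonlocal_div \<rho> \<Phi> x \<partial>lebesgue)"

definition represents ::
    "(real^'n \<Rightarrow> real^'n) \<Rightarrow> ((real^'n \<Rightarrow> real^'n) \<Rightarrow> real) \<Rightarrow> bool" where
  "represents g T \<longleftrightarrow> (\<forall>\<Phi>\<in>test_fields. T \<Phi> = (\<integral>x. g x \<bullet> \<Phi> x \<partial>lebesgue))"

text \<open>The \<open>L\<^sup>2\<close> function representing a distribution is unique up to a null set, so the norm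
  below does not depend on the choice made.\<close>

definition distr_L2_norm :: "((real^'n \<Rightarrow> real^'n) \<Rightarrow> real) \<Rightarrow> real" where
  "distr_L2_norm T = L2_norm lebesgue (SOME g. g \<in> L2 lebesgue \<and> represents g T)"

section \<open>The spaces \<open>H\<^sup>\<rho>\<close>\<close>

definition H_rho :: "(real^'n \<Rightarrow> ennreal) \<Rightarrow> (real^'n \<Rightarrow> real) set" where
  "H_rho \<rho> = {u \<in> L2 lebesgue. \<exists>g\<in>L2 lebesgue. represents g (weak_nonlocal_grad \<rho> u)}"

definition H_rho_norm :: "(real^'n \<Rightarrow> ennreal) \<Rightarrow> (real^'n \<Rightarrow> real) \<Rightarrow> real" where
  "H_rho_norm \<rho> u =
     sqrt ((L2_norm lebesgue u)\<^sup>2 + (distr_L2_norm (weak_nonlocal_grad \<rho> u))\<^sup>2)"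

definition H_rho_0 :: "(real^'n \<Rightarrow> ennreal) \<Rightarrow> (real^'n) set \<Rightarrow> (real^'n \<Rightarrow> real) set" where
  "H_rho_0 \<rho> \<Omega> = {u \<in> H_rho \<rho>. AE x in lebesgue. x \<in> - \<Omega> \<longrightarrow> u x = 0}"

text \<open>\<open>X\<close> with (semi)norm \<open>NX\<close> is compactly embedded into \<open>Y\<close> with (semi)norm \<open>NY\<close>: the inclusion
  is continuous and maps bounded sequences to sequences with a subsequence converging in \<open>Y\<close>.\<close>

definition compactly_embedded ::
    "('a \<Rightarrow> real) set \<Rightarrow> (('a \<Rightarrow> real) \<Rightarrow> real) \<Rightarrow> ('a \<Rightarrow> real) set \<Rightarrow> (('a \<Rightarrow> real) \<Rightarrow> real) \<Rightarrow> bool" where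
  "compactly_embedded X NX Y NY \<longleftrightarrow>
     X \<subseteq> Y \<and> (\<exists>C. \<forall>u\<in>X. NY u \<le> C * NX u) \<and>
     (\<forall>u :: nat \<Rightarrow> 'a \<Rightarrow> real. (\<forall>k. u k \<in> X) \<and> (\<exists>B. \<forall>k. NX (u k) \<le> B) \<longrightarrow>
        (\<exists>r v. strict_mono r \<and> v \<in> Y \<and> (\<lambda>k. NY (\<lambda>x. u (r k) x - v x)) \<longlonglongrightarrow> 0))"

end

theory Submission
  imports Defs "HOL-Probability.Characteristic_Functions" "HOL-Complex_Analysis.Great_Picard"
begin

text \<open>The weak nonlocal gradient commutes with translations, so it is a Fourier multiplier. Testing it
  against \<open>v cos (\<xi> \<bullet> x)\<close> and \<open>v sin (\<xi> \<bullet> x)\<close> identifies the multiplier as \<open>-\<i> m(\<xi>)\<close>, where \<open>m(\<xi>)\<close> is the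
  integral of \<open>sin (\<xi> \<bullet> z) \<rho>(z) z / |z|\<^sup>2\<close> (\<open>scalar_div_trig\<close>), and Plancherel's identity gives the basic
  estimate \<open>\<integral> |m(\<xi>)|\<^sup>2 |\<F>u(\<xi>)|\<^sup>2 d\<xi> \<le> (2\<pi>)\<^sup>n \<parallel>D\<^sub>\<rho> u\<parallel>\<^sup>2\<close> (\<open>H_rho_0_fourier_representative\<close>).

  Both statements thus reduce to lower bounds for \<open>|m|\<close>. In terms of \<open>f t = t\<^bsup>n-2\<^esup> \<rho>r t\<close>, \<open>\<xi> \<bullet> m(\<xi>)\<close> is
  the integral of \<open>(\<xi> \<bullet> z) sin (\<xi> \<bullet> z) f(|z|) / |z|\<^sup>n\<close>. Although the sine oscillates, this is nonnegative
  for every decreasing \<open>f\<close>: it is the derivative at \<open>a = 1\<close> of the integral of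
  \<open>(1 - cos (a (\<xi> \<bullet> z))) f(|z|) / |z|\<^sup>n\<close>, which increases with \<open>a\<close> because a dilation replaces \<open>f(|z|)\<close>
  by \<open>f(|z| / a)\<close> (\<open>symbol_nonneg\<close>). Applied to the profile truncated at height \<open>f s\<close>, this leaves only
  the region \<open>|z| < s \<le> 1/|\<xi>|\<close>, where the sine does not change sign relative to its argument. Together
  with the doubling condition the result is \<open>|m(\<xi>)| \<ge> c |\<xi>| s\<^sup>2 f(s/2)\<close>
  (\<open>norm_kernel_symbol_lower_bound\<close>). Hence \<open>|m|\<close> is bounded below away from the origin if
  \<open>t f t = t\<^bsup>n-1\<^esup> \<rho>r t\<close> stays away from \<open>0\<close> as \<open>t\<close> tends to \<open>0\<close>, and tends to infinity with \<open>|\<xi>|\<close> if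
  \<open>t f t\<close> tends to infinity.

  For the Poincare inequality it remains to control low frequencies: since \<open>u\<close> lives on a bounded set,
  \<open>|\<F>u|\<^sup>2\<close> is at most a constant times \<open>\<parallel>u\<parallel>\<^sup>2\<close>, so a small ball of frequencies carries at most half of
  the norm (\<open>fourier_poincare\<close>). For compactness, the Fourier transforms of a bounded sequence are
  uniformly bounded and equi-Lipschitz, hence converge pointwise along a subsequence, and the growth of
  \<open>|m|\<close> makes their tails uniformly small (\<open>fourier_compactness\<close>).\<close>

section \<open>The Fourier transform of a Gaussian\<close>

lemma lborel_affine_integral:
  fixes f :: "'a::euclidean_space \<Rightarrow> 'b::{banach, second_countable_topology}"
  assumes [measurable]: "f \<in> borel_measurable borel" and c: "c \<noteq> 0"
  shows "(LBINT x. f x) = \<bar>c\<bar> ^ DIM('a) *\<^sub>R (LBINT x. f (t + c *\<^sub>R x))"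
    and "integrable lborel (\<lambda>x. f (t + c *\<^sub>R x)) \<longleftrightarrow> integrable lborel f"
proof -
  show "(LBINT x. f x) = \<bar>c\<bar> ^ DIM('a) *\<^sub>R (LBINT x. f (t + c *\<^sub>R x))"
    by (subst lborel_affine[OF c, of t])
      (simp add: integral_density integral_distr)
  have "integrable lborel f \<longleftrightarrow> integrable lborel (\<lambda>x. \<bar>c\<bar> ^ DIM('a) *\<^sub>R f (t + c *\<^sub>R x))"
    by (subst lborel_affine[OF c, of t])
      (simp add: integrable_density integrable_distr_eq)
  also have "\<dots> \<longleftrightarrow> integrable lborel (\<lambda>x. f (t + c *\<^sub>R x))"
  proof
    assume "integrable lborel (\<lambda>x. \<bar>c\<bar> ^ DIM('a) *\<^sub>R f (t + c *\<^sub>R x))"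
    then have "integrable lborel (\<lambda>x. inverse (\<bar>c\<bar> ^ DIM('a)) *\<^sub>R (\<bar>c\<bar> ^ DIM('a) *\<^sub>R f (t + c *\<^sub>R x)))"
      by (rule integrable_scaleR_right)
    then show "integrable lborel (\<lambda>x. f (t + c *\<^sub>R x))"
      using c by simp
  qed (rule integrable_scaleR_right)
  finally show "integrable lborel (\<lambda>x. f (t + c *\<^sub>R x)) \<longleftrightarrow> integrable lborel f" ..
qed

lemma lborel_translate_nn_integral:
  fixes f :: "'a::euclidean_space \<Rightarrow> ennreal"
  assumes [measurable]: "f \<in> borel_measurable borel"
  shows "(\<integral>\<^sup>+x. f (x + t) \<partial>lborel) = (\<integral>\<^sup>+x. f x \<partial>lborel)"
proof -
  have "(\<integral>\<^sup>+x. f x \<partial>lborel) = (\<integral>\<^sup>+x. f x \<partial>distr lborel borel ((+) t))"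
    by (simp add: lborel_distr_plus)
  also have "\<dots> = (\<integral>\<^sup>+x. f (x + t) \<partial>lborel)"
    by (subst nn_integral_distr) (auto simp: add.commute)
  finally show ?thesis ..
qed

lemma norm_sq_eq_sum_Basis: "(norm x)\<^sup>2 = (\<Sum>b\<in>Basis. (x \<bullet> b)\<^sup>2)" for x :: "'a::euclidean_space"
  unfolding norm_conv_dist by (subst euclidean_dist_l2) (simp add: L2_set_def sum_nonneg)

definition gauss :: "real \<Rightarrow> 'a::real_normed_vector \<Rightarrow> real" where
  "gauss s x = exp (- (s * norm x)\<^sup>2 / 2)"

lemma gauss_measurable [measurable]: "gauss s \<in> borel_measurable borel"
  unfolding gauss_def[abs_def] by measurable

lemma gauss_bounds: "0 < gauss s x" "gauss s x \<le> 1"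
  by (auto simp: gauss_def)

text \<open>This is the characteristic function of the standard normal distribution without the normalising
  factor of its density.\<close>

lemma gauss_fourier_real:
  "has_bochner_integral lborel (\<lambda>x::real. exp (- x\<^sup>2 / 2) *\<^sub>R cis (t * x))
     (complex_of_real (sqrt (2 * pi) * exp (- t\<^sup>2 / 2)))"
proof -
  have i0: "integrable lborel (\<lambda>x. exp (- x\<^sup>2 / 2) :: real)"
    using integrable_mult_right[OF integrable_std_normal_moment[of 0], of "sqrt (2 * pi)"]
    by (simp add: std_normal_density_def)
  have i: "integrable lborel (\<lambda>x::real. exp (- x\<^sup>2 / 2) *\<^sub>R cis (t * x))"
    by (rule Bochner_Integration.integrable_bound[OF i0])
       (auto simp: cis_conv_exp)
  have "complex_of_real (exp (- (t^2) / 2)) = (CLINT x|std_normal_distribution. iexp (t * x))"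
    using char_std_normal_distribution by (metis char_def)
  also have "\<dots> = (CLINT x|lborel. std_normal_density x *\<^sub>R cis (t * x))"
    by (subst integral_density) (auto simp: cis_conv_exp normal_density_nonneg mult.commute)
  also have "\<dots> = (CLINT x|lborel. (1 / sqrt (2 * pi)) *\<^sub>R (exp (- x\<^sup>2 / 2) *\<^sub>R cis (t * x)))"
    by (simp add: std_normal_density_def)
  also have "\<dots> = (1 / sqrt (2 * pi)) *\<^sub>R (CLINT x|lborel. exp (- x\<^sup>2 / 2) *\<^sub>R cis (t * x))"
    by (rule integral_scaleR_right)
  finally have "(CLINT x|lborel. exp (- x\<^sup>2 / 2) *\<^sub>R cis (t * x)) =
      complex_of_real (sqrt (2 * pi) * exp (- t\<^sup>2 / 2))"
    by (simp add: field_simps scaleR_conv_of_real)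
  with i show ?thesis by (simp add: has_bochner_integral_iff)
qed

text \<open>The Gaussian and the character both factor over the coordinates, and Lebesgue measure is the
  product of its one-dimensional copies; each factor is the characteristic function of the normal
  distribution.\<close>

lemma gauss_fourier_1:
  fixes w :: "'a::euclidean_space"
  shows "has_bochner_integral lborel (\<lambda>x. gauss 1 x *\<^sub>R cis (w \<bullet> x))
     (complex_of_real (sqrt (2 * pi) ^ DIM('a) * gauss 1 w))"
proof -
  interpret product_sigma_finite "\<lambda>_::'a. lborel :: real measure" ..
  define F where "F b x = exp (- x\<^sup>2 / 2) *\<^sub>R cis ((w \<bullet> b) * x)" for b :: 'a and x :: real
  have F: "integrable lborel (F b)" "integral\<^sup>L lborel (F b)
      = complex_of_real (sqrt (2 * pi) * exp (- (w \<bullet> b)\<^sup>2 / 2))" for b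
    using gauss_fourier_real[of "w \<bullet> b"] by (auto simp: has_bochner_integral_iff F_def[abs_def])
  have cisp: "cis (\<Sum>b\<in>I. g b) = (\<Prod>b\<in>I. cis (g b))" if "finite I" for g :: "'a \<Rightarrow> real" and I
    using that by induct (auto simp flip: cis_mult)
  have gp: "gauss 1 x = (\<Prod>b\<in>Basis. exp (- (x \<bullet> b)\<^sup>2 / 2))" for x :: 'a
    by (simp add: gauss_def norm_sq_eq_sum_Basis exp_sum[symmetric] sum_negf sum_divide_distrib)
  define G where "G x = gauss 1 x *\<^sub>R cis (w \<bullet> x)" for x
  have G: "G x = (\<Prod>b\<in>Basis. F b (x \<bullet> b))" for x
  proof -
    have "w \<bullet> x = (\<Sum>b\<in>Basis. (w \<bullet> b) * (x \<bullet> b))" by (rule euclidean_inner)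
    then show ?thesis
      unfolding G_def F_def gp by (simp add: cisp scaleR_conv_of_real prod.distrib)
  qed
  have Gb: "G (\<Sum>b\<in>Basis. y b *\<^sub>R b) = (\<Prod>b\<in>Basis. F b (y b))" for y
    unfolding G by (intro prod.cong) auto
  have Gm [measurable]: "G \<in> borel_measurable borel"
    unfolding G_def[abs_def] cis_conv_exp by measurable
  have [measurable]: "(\<lambda>y. \<Sum>b\<in>Basis. y b *\<^sub>R b) \<in> borel_measurable (\<Pi>\<^sub>M b\<in>(Basis::'a set). lborel)"
    by measurable
  have "integrable lborel G"
    by (subst lborel_eq) (use F(1) in \<open>auto simp: integrable_distr_eq Gb intro!: product_integrable_prod\<close>)
  moreover have "integral\<^sup>L lborel G = (\<Prod>b\<in>Basis. integral\<^sup>L lborel (F b))"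
    by (subst lborel_eq) (use F(1) in \<open>auto simp: integral_distr Gb intro!: product_integral_prod\<close>)
  ultimately show ?thesis
    unfolding has_bochner_integral_iff G_def F(2) gp
    by (simp add: prod.distrib)
qed

lemma gauss_fourier:
  fixes w :: "'a::euclidean_space"
  assumes s: "s > 0"
  shows "has_bochner_integral lborel (\<lambda>x. gauss s x *\<^sub>R cis (w \<bullet> x))
     (complex_of_real ((sqrt (2 * pi) / s) ^ DIM('a) * gauss (1/s) w))"
proof -
  let ?f = "\<lambda>x. gauss s x *\<^sub>R cis (w \<bullet> x)"
  have g: "gauss s ((1/s) *\<^sub>R x) = gauss 1 x" for x :: 'a
    using s by (simp add: gauss_def)
  have "has_bochner_integral lborel (\<lambda>x. gauss 1 x *\<^sub>R cis (((1/s) *\<^sub>R w) \<bullet> x))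
     (complex_of_real (sqrt (2 * pi) ^ DIM('a) * gauss 1 ((1/s) *\<^sub>R w)))"
    by (rule gauss_fourier_1)
  also have "gauss 1 ((1/s) *\<^sub>R w) = gauss (1/s) w"
    using s by (simp add: gauss_def)
  also have "(\<lambda>x. gauss 1 x *\<^sub>R cis (((1/s) *\<^sub>R w) \<bullet> x)) = (\<lambda>x. ?f (0 + (1/s) *\<^sub>R x))"
    by (simp add: g[simplified])
  finally have *: "has_bochner_integral lborel (\<lambda>x. ?f (0 + (1/s) *\<^sub>R x))
     (complex_of_real (sqrt (2 * pi) ^ DIM('a) * gauss (1/s) w))" .
  have m: "?f \<in> borel_measurable borel"
    unfolding cis_conv_exp by measurable
  have s': "1 / s \<noteq> 0" using s by simp
  show ?thesis
    using * lborel_affine_integral[OF m s', of 0] s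
    by (simp add: has_bochner_integral_iff scaleR_conv_of_real power_divide)
qed

section \<open>Continuity of translation in \<open>L\<^sup>2\<close>\<close>

lemma power2_diff_le: "(a - b)\<^sup>2 \<le> 2 * a\<^sup>2 + 2 * b\<^sup>2" for a b :: real
  using zero_le_power2[of "a + b"] by (simp add: power2_eq_square algebra_simps)

lemma ennreal_le_twice_add:
  assumes "a \<le> 2 * b + 2 * c" "0 \<le> b" "0 \<le> c"
  shows "ennreal a \<le> 2 * ennreal b + 2 * ennreal c"
proof -
  have "ennreal a \<le> ennreal (2 * b + 2 * c)"
    using assms by (intro ennreal_leI)
  also have "\<dots> = 2 * ennreal b + 2 * ennreal c"
    using assms by (simp add: ennreal_mult')
  finally show ?thesis .
qed

text \<open>The squared \<open>L\<^sup>2\<close> distance between \<open>v\<close> and its translate by \<open>-h\<close>. Values in \<open>ennreal\<close> make the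
  approximation steps below free of integrability conditions.\<close>

definition translation_defect :: "('a::euclidean_space \<Rightarrow> real) \<Rightarrow> 'a \<Rightarrow> ennreal" where
  "translation_defect v h = (\<integral>\<^sup>+x. ennreal ((v (x + h) - v x)\<^sup>2) \<partial>lborel)"

lemma translation_defect_le:
  assumes [measurable]: "v \<in> borel_measurable borel"
  shows "translation_defect v h \<le> 4 * (\<integral>\<^sup>+x. ennreal ((v x)\<^sup>2) \<partial>lborel)"
proof -
  have num: "(2::ennreal) + 2 = 4" by simp
  have "translation_defect v h \<le> (\<integral>\<^sup>+x. 2 * ennreal ((v (x + h))\<^sup>2) + 2 * ennreal ((v x)\<^sup>2) \<partial>lborel)"
    unfolding translation_defect_def
  proof (rule nn_integral_mono)
    fix x
    have "(v (x + h) - v x)\<^sup>2 \<le> 2 * (v (x + h))\<^sup>2 + 2 * (v x)\<^sup>2"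
      by (rule power2_diff_le)
    then show "ennreal ((v (x + h) - v x)\<^sup>2) \<le> 2 * ennreal ((v (x + h))\<^sup>2) + 2 * ennreal ((v x)\<^sup>2)"
      by (rule ennreal_le_twice_add) auto
  qed
  also have "\<dots> = 2 * (\<integral>\<^sup>+x. ennreal ((v (x + h))\<^sup>2) \<partial>lborel) + 2 * (\<integral>\<^sup>+x. ennreal ((v x)\<^sup>2) \<partial>lborel)"
    by (subst nn_integral_add) (auto simp: nn_integral_cmult)
  also have "(\<integral>\<^sup>+x. ennreal ((v (x + h))\<^sup>2) \<partial>lborel) = (\<integral>\<^sup>+x. ennreal ((v x)\<^sup>2) \<partial>lborel)"
    by (rule lborel_translate_nn_integral[of "\<lambda>x. ennreal ((v x)\<^sup>2)"]) simp
  also have "2 * (\<integral>\<^sup>+x. ennreal ((v x)\<^sup>2) \<partial>lborel) + 2 * (\<integral>\<^sup>+x. ennreal ((v x)\<^sup>2) \<partial>lborel)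
      = 4 * (\<integral>\<^sup>+x. ennreal ((v x)\<^sup>2) \<partial>lborel)"
    by (simp only: distrib_right[symmetric] num)
  finally show ?thesis .
qed

lemma translation_defect_add:
  assumes [measurable]: "v \<in> borel_measurable borel" "w \<in> borel_measurable borel"
  shows "translation_defect (\<lambda>x. v x + w x) h \<le> 2 * translation_defect v h + 2 * translation_defect w h"
proof -
  have "translation_defect (\<lambda>x. v x + w x) h
      \<le> (\<integral>\<^sup>+x. 2 * ennreal ((v (x + h) - v x)\<^sup>2) + 2 * ennreal ((w (x + h) - w x)\<^sup>2) \<partial>lborel)"
    unfolding translation_defect_def
  proof (rule nn_integral_mono)
    fix x
    have "(v (x + h) + w (x + h) - (v x + w x))\<^sup>2 \<le> 2 * (v (x + h) - v x)\<^sup>2 + 2 * (w (x + h) - w x)\<^sup>2"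
      using sum_squares_ge_zero[of "(v (x+h) - v x) - (w (x + h) - w x)" 0]
          by (simp add: power2_eq_square algebra_simps)
    then show "ennreal ((v (x + h) + w (x + h) - (v x + w x))\<^sup>2)
        \<le> 2 * ennreal ((v (x + h) - v x)\<^sup>2) + 2 * ennreal ((w (x + h) - w x)\<^sup>2)"
      by (rule ennreal_le_twice_add) auto
  qed
  also have "\<dots> = 2 * translation_defect v h + 2 * translation_defect w h"
    unfolding translation_defect_def by (subst nn_integral_add) (auto simp: nn_integral_cmult)
  finally show ?thesis .
qed

lemma ennreal_tendsto_0I:
  fixes f :: "nat \<Rightarrow> ennreal"
  assumes "\<And>e::real. e > 0 \<Longrightarrow> eventually (\<lambda>m. f m < ennreal e) sequentially"
  shows "f \<longlonglongrightarrow> 0"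
proof (rule order_tendstoI)
  fix a :: ennreal assume "0 < a"
  then obtain b where b: "0 < b" "b < a" using dense by blast
  define e where "e = enn2real b"
  have "b = ennreal e" using b unfolding e_def by (cases b rule: ennreal_cases) auto
  with b have e: "e > 0" "ennreal e < a" by auto
  show "eventually (\<lambda>m. f m < a) sequentially"
    using assms[OF e(1)] by eventually_elim (use e(2) in auto)
qed auto

lemma ennreal_squeeze_0:
  fixes f g :: "nat \<Rightarrow> ennreal"
  assumes "\<And>m. f m \<le> g m" "g \<longlonglongrightarrow> 0"
  shows "f \<longlonglongrightarrow> 0"
  by (rule tendsto_sandwich[of "\<lambda>_. 0" f _ g 0]) (use assms in auto)

text \<open>Vanishing of the defect along a sequence tending to \<open>0\<close> is a closed condition in \<open>L\<^sup>2\<close>, because the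
  defect is controlled by the \<open>L\<^sup>2\<close> norm uniformly in the shift.\<close>

lemma translation_defect_approx:
  fixes h :: "nat \<Rightarrow> 'a::euclidean_space"
  assumes [measurable]: "v \<in> borel_measurable borel"
    and "\<And>e::real. e > 0 \<Longrightarrow> \<exists>w\<in>borel_measurable borel. (\<lambda>m. translation_defect w (h m)) \<longlonglongrightarrow> 0 \<and>
           (\<integral>\<^sup>+x. ennreal ((v x - w x)\<^sup>2) \<partial>lborel) \<le> ennreal e"
  shows "(\<lambda>m. translation_defect v (h m)) \<longlonglongrightarrow> 0"
proof (rule ennreal_tendsto_0I)
  fix e :: real assume e: "e > 0"
  then obtain w where w[measurable]: "w \<in> borel_measurable borel"
    and lim: "(\<lambda>m. translation_defect w (h m)) \<longlonglongrightarrow> 0"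
    and vw: "(\<integral>\<^sup>+x. ennreal ((v x - w x)\<^sup>2) \<partial>lborel) \<le> ennreal (e / 16)"
    using assms(2)[of "e / 16"] by auto
  have "eventually (\<lambda>m. translation_defect w (h m) < ennreal (e / 8)) sequentially"
    using lim by (rule order_tendstoD) (use e in simp)
  then show "eventually (\<lambda>m. translation_defect v (h m) < ennreal e) sequentially"
  proof eventually_elim
    case (elim m)
    have "translation_defect (\<lambda>x. v x - w x) (h m) \<le> 4 * (\<integral>\<^sup>+x. ennreal ((v x - w x)\<^sup>2) \<partial>lborel)"
      by (rule translation_defect_le) measurable
    also have "\<dots> \<le> 4 * ennreal (e / 16)"
      by (rule mult_left_mono[OF vw]) simp
    also have "\<dots> = ennreal (e / 4)"
      using e ennreal_mult'[of 4 "e / 16"] by simp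
    finally have 1: "translation_defect (\<lambda>x. v x - w x) (h m) \<le> ennreal (e / 4)" .
    have "translation_defect v (h m) \<le> 2 * translation_defect w (h m) + 2 * translation_defect (\<lambda>x. v x - w x) (h m)"
      using translation_defect_add[of w "\<lambda>x. v x - w x" "h m"] by simp
    also have "\<dots> \<le> 2 * translation_defect w (h m) + 2 * ennreal (e / 4)"
      by (intro add_left_mono mult_left_mono 1) simp
    also have "\<dots> \<le> 2 * ennreal (e / 8) + 2 * ennreal (e / 4)"
      using elim by (intro add_right_mono mult_left_mono) auto
    also have "\<dots> = ennreal (3 * e / 4)"
      using e ennreal_mult'[of 2 "e / 8"] ennreal_mult'[of 2 "e / 4"] ennreal_plus[of "e / 4" "e / 2"]
      by (simp add: field_simps)
    also have "\<dots> < ennreal e"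
      using e by (simp add: ennreal_less_iff)
    finally show ?case .
  qed
qed

text \<open>The symmetric difference of \<open>U\<close> and its translate consists of two parts, and after a translation
  both have the form of points \<open>x\<close> of \<open>U\<close> with \<open>x + k\<close> outside \<open>U\<close>. Since \<open>U\<close> is open, every \<open>x\<close> leaves
  this set eventually, and dominated convergence applies.\<close>

lemma translation_defect_open:
  fixes h :: "nat \<Rightarrow> 'a::euclidean_space"
  assumes U: "open U" and fin: "emeasure lborel U < \<infinity>" and h: "h \<longlonglongrightarrow> 0"
  shows "(\<lambda>m. translation_defect (indicator U) (h m)) \<longlonglongrightarrow> 0"
proof -
  have [measurable]: "U \<in> sets borel" using U by simp
  have lim: "(\<lambda>m. \<integral>\<^sup>+x. indicator U x * indicator (- U) (x + k m) \<partial>lborel) \<longlonglongrightarrow> 0"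
    if k: "k \<longlonglongrightarrow> 0" for k :: "nat \<Rightarrow> 'a"
  proof -
    have "(\<lambda>m. \<integral>\<^sup>+x. indicator U x * indicator (- U) (x + k m) \<partial>lborel) \<longlonglongrightarrow> (\<integral>\<^sup>+x. 0 \<partial>(lborel :: 'a measure))"
    proof (rule nn_integral_dominated_convergence[where w="indicator U"])
      show "AE x in lborel. (\<lambda>m. indicator U x * indicator (- U) (x + k m) :: ennreal) \<longlonglongrightarrow> 0"
      proof (rule AE_I2)
        fix x
        show "(\<lambda>m. indicator U x * indicator (- U) (x + k m) :: ennreal) \<longlonglongrightarrow> 0"
        proof (cases "x \<in> U")
          case True
          have "(\<lambda>m. x + k m) \<longlonglongrightarrow> x + 0" by (intro tendsto_intros k)
          with U True have "eventually (\<lambda>m. x + k m \<in> U) sequentially"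
            using topological_tendstoD by fastforce
          then have "eventually (\<lambda>m. indicator U x * indicator (- U) (x + k m) = (0::ennreal)) sequentially"
            by eventually_elim auto
          then show ?thesis by (rule tendsto_eventually)
        qed simp
      qed
    qed (use fin in \<open>auto split: split_indicator\<close>)
    then show ?thesis by simp
  qed
  have eq: "translation_defect (indicator U) k =
      (\<integral>\<^sup>+x. indicator U x * indicator (- U) (x + k) \<partial>lborel) + (\<integral>\<^sup>+x. indicator U x * indicator (- U) (x
          + (- k)) \<partial>lborel)" for k :: 'a
  proof -
    have "translation_defect (indicator U) k
        = (\<integral>\<^sup>+x. indicator U x * indicator (- U) (x + k) + indicator U (x + k) * indicator (- U) x \<partial>lborel)"
      unfolding translation_defect_def by (intro nn_integral_cong) (auto simp: indicator_def)
    also have "\<dots> = (\<integral>\<^sup>+x. indicator U x * indicator (- U) (x + k) \<partial>lborel) + (\<integral>\<^sup>+x. indicator U (x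
        + k) * indicator (- U) x \<partial>lborel)"
      by (subst nn_integral_add) auto
    also have "(\<integral>\<^sup>+x. indicator U (x + k) * indicator (- U) x \<partial>lborel)
        = (\<integral>\<^sup>+x. indicator U x * indicator (- U) (x + (- k)) \<partial>lborel)"
      using lborel_translate_nn_integral[of "\<lambda>x. indicator U x * indicator (- U) (x + (- k))" k]
      by simp
    finally show ?thesis .
  qed
  have "(\<lambda>m. - h m) \<longlonglongrightarrow> 0" using tendsto_minus[OF h] by simp
  from tendsto_add[OF lim[OF h] lim[OF this]] show ?thesis
    unfolding eq by simp
qed

text \<open>Outer regularity replaces \<open>A\<close> by an open set at a small cost in \<open>L\<^sup>2\<close>.\<close>

lemma translation_defect_indicator:
  fixes h :: "nat \<Rightarrow> 'a::euclidean_space"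
  assumes A[measurable]: "A \<in> sets borel" and fin: "emeasure lborel A < \<infinity>" and h: "h \<longlonglongrightarrow> 0"
  shows "(\<lambda>m. translation_defect (indicator A) (h m)) \<longlonglongrightarrow> 0"
proof (rule translation_defect_approx)
  fix e :: real assume e: "e > 0"
  obtain U where U: "open U" "A \<subseteq> U" "emeasure lborel (U - A) < ennreal e"
    using outer_regular_lborel[OF A e] by blast
  have [measurable]: "U \<in> sets borel" using U by simp
  have "emeasure lborel U = emeasure lborel A + emeasure lborel (U - A)"
    using U(2) by (subst plus_emeasure) (auto simp: Un_absorb1)
  with U(3) fin have "emeasure lborel U < \<infinity>"
    by (auto simp: less_top[symmetric])
  then have "(\<lambda>m. translation_defect (indicator U) (h m)) \<longlonglongrightarrow> 0"
    by (intro translation_defect_open U h)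
  moreover have "(\<integral>\<^sup>+x. ennreal ((indicator A x - indicator U x)\<^sup>2) \<partial>lborel) = emeasure lborel (U - A)"
  proof -
    have "ennreal ((indicator A x - indicator U x)\<^sup>2) = indicator (U - A) x" for x
      using U(2) by (auto split: split_indicator)
    then show ?thesis by simp
  qed
  ultimately show "\<exists>w\<in>borel_measurable borel. (\<lambda>m. translation_defect w (h m)) \<longlonglongrightarrow> 0 \<and>
           (\<integral>\<^sup>+x. ennreal ((indicator A x - w x)\<^sup>2) \<partial>lborel) \<le> ennreal e"
    using U(3) by (intro bexI[of _ "indicator U"]) auto
qed simp

text \<open>Induction over the construction of nonnegative measurable functions from indicators.\<close>

lemma translation_defect_nonneg_tendsto:
  fixes h :: "nat \<Rightarrow> 'a::euclidean_space"
  assumes v: "v \<in> borel_measurable borel" "\<And>x. 0 \<le> v x"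
    and fin: "(\<integral>\<^sup>+x. ennreal ((v x)\<^sup>2) \<partial>lborel) < \<infinity>" and h: "h \<longlonglongrightarrow> 0"
  shows "(\<lambda>m. translation_defect v (h m)) \<longlonglongrightarrow> 0"
  using v fin
proof (induction rule: borel_measurable_induct_real)
  case (set A)
  have "(\<integral>\<^sup>+x. ennreal ((indicator A x)\<^sup>2) \<partial>lborel) = emeasure lborel A"
  proof -
    have "ennreal ((indicator A x)\<^sup>2) = indicator A x" for x :: 'a
      by (auto split: split_indicator)
    then show ?thesis using set by simp
  qed
  with set show ?case by (intro translation_defect_indicator h) auto
next
  case (mult u c)
  show ?case
  proof (cases "c = 0")
    case True
    then show ?thesis by (simp add: translation_defect_def)
  next
    case False
    note [measurable] = mult(2)
    have "(\<integral>\<^sup>+x. ennreal ((c * u x)\<^sup>2) \<partial>lborel) = ennreal (c\<^sup>2) * (\<integral>\<^sup>+x. ennreal ((u x)\<^sup>2) \<partial>lborel)"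
      by (simp add: power_mult_distrib ennreal_mult' nn_integral_cmult)
    with mult.prems False have "(\<integral>\<^sup>+x. ennreal ((u x)\<^sup>2) \<partial>lborel) < \<infinity>"
      by (auto simp: ennreal_mult_less_top)
    then have "(\<lambda>m. translation_defect u (h m)) \<longlonglongrightarrow> 0"
      by (rule mult.IH)
    from ennreal_tendsto_cmult[OF _ this, of "ennreal (c\<^sup>2)"]
    have "(\<lambda>m. ennreal (c\<^sup>2) * translation_defect u (h m)) \<longlonglongrightarrow> 0" by simp
    moreover have "translation_defect (\<lambda>x. c * u x) k = ennreal (c\<^sup>2) * translation_defect u k" for k
      unfolding translation_defect_def
      by (subst nn_integral_cmult[symmetric])
        (auto simp: ennreal_mult'[symmetric] power_mult_distrib[symmetric] right_diff_distrib intro!: nn_integral_cong)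
    ultimately show ?thesis by simp
  qed
next
  case (add u v)
  note [measurable] = add(1,3)
  have "(\<integral>\<^sup>+x. ennreal ((u x)\<^sup>2) \<partial>lborel) \<le> (\<integral>\<^sup>+x. ennreal ((v x + u x)\<^sup>2) \<partial>lborel)"
    "(\<integral>\<^sup>+x. ennreal ((v x)\<^sup>2) \<partial>lborel) \<le> (\<integral>\<^sup>+x. ennreal ((v x + u x)\<^sup>2) \<partial>lborel)"
    using add(2,4) by (auto intro!: nn_integral_mono ennreal_leI power_mono)
  then have "(\<lambda>m. translation_defect u (h m)) \<longlonglongrightarrow> 0" "(\<lambda>m. translation_defect v (h m)) \<longlonglongrightarrow> 0"
    using add.IH add.prems by (auto intro: le_less_trans)
  then have "(\<lambda>m. 2 * translation_defect v (h m) + 2 * translation_defect u (h m)) \<longlonglongrightarrow> 2 * 0 + 2 * 0"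
    by (intro tendsto_add ennreal_tendsto_cmult) auto
  then show ?case
    by (intro ennreal_squeeze_0[OF translation_defect_add]) auto
next
  case (seq U)
  note [measurable] = seq.hyps(1)
  have [measurable]: "v \<in> borel_measurable borel" by fact
  have le: "U i x \<le> v x" for i x
    using seq.hyps(3) seq.hyps(4)[of x] by (intro incseq_le[of "\<lambda>i. U i x"]) (auto simp: incseq_def le_fun_def)
  have "(\<integral>\<^sup>+x. ennreal ((U i x)\<^sup>2) \<partial>lborel) \<le> (\<integral>\<^sup>+x. ennreal ((v x)\<^sup>2) \<partial>lborel)" for i
    using seq.hyps(2) le by (auto intro!: nn_integral_mono ennreal_leI power_mono)
  then have IH: "(\<lambda>m. translation_defect (U i) (h m)) \<longlonglongrightarrow> 0" for i
    using seq.prems by (intro seq.IH) (auto intro: le_less_trans)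
  have "(\<lambda>i. \<integral>\<^sup>+x. ennreal ((v x - U i x)\<^sup>2) \<partial>lborel) \<longlonglongrightarrow> (\<integral>\<^sup>+x. 0 \<partial>(lborel :: 'a measure))"
  proof (rule nn_integral_dominated_convergence[where w="\<lambda>x. ennreal ((v x)\<^sup>2)"])
    show "AE x in lborel. (\<lambda>i. ennreal ((v x - U i x)\<^sup>2)) \<longlonglongrightarrow> 0"
    proof (rule AE_I2)
      fix x :: 'a
      have "(\<lambda>i. ennreal ((v x - U i x)\<^sup>2)) \<longlonglongrightarrow> ennreal ((v x - v x)\<^sup>2)"
        using seq.hyps(4)[of x] by (intro tendsto_intros) auto
      then show "(\<lambda>i. ennreal ((v x - U i x)\<^sup>2)) \<longlonglongrightarrow> 0" by simp
    qed
    show "AE x in lborel. ennreal ((v x - U i x)\<^sup>2) \<le> ennreal ((v x)\<^sup>2)" for i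
      using seq.hyps(2) le by (auto intro!: ennreal_leI power_mono)
  qed (use seq.prems in auto)
  then have conv: "(\<lambda>i. \<integral>\<^sup>+x. ennreal ((v x - U i x)\<^sup>2) \<partial>lborel) \<longlonglongrightarrow> 0" by simp
  show ?case
  proof (rule translation_defect_approx)
    fix e :: real assume "e > 0"
    then have "eventually (\<lambda>i. (\<integral>\<^sup>+x. ennreal ((v x - U i x)\<^sup>2) \<partial>lborel) < ennreal e) sequentially"
      using order_tendstoD(2)[OF conv, of "ennreal e"] by simp
    then obtain i where "(\<integral>\<^sup>+x. ennreal ((v x - U i x)\<^sup>2) \<partial>lborel) < ennreal e"
      by (auto simp: eventually_sequentially)
    then show "\<exists>w\<in>borel_measurable borel. (\<lambda>m. translation_defect w (h m)) \<longlonglongrightarrow> 0 \<and>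
           (\<integral>\<^sup>+x. ennreal ((v x - w x)\<^sup>2) \<partial>lborel) \<le> ennreal e"
      using IH[of i] by (intro bexI[of _ "U i"]) auto
  qed simp
qed

text \<open>Translation is continuous in \<open>L\<^sup>2\<close>. This is what makes Gaussian averages of a square integrable
  function converge back to it.\<close>

proposition translation_defect_tendsto:
  fixes h :: "nat \<Rightarrow> 'a::euclidean_space"
  assumes v[measurable]: "v \<in> borel_measurable borel"
    and fin: "(\<integral>\<^sup>+x. ennreal ((v x)\<^sup>2) \<partial>lborel) < \<infinity>" and h: "h \<longlonglongrightarrow> 0"
  shows "(\<lambda>m. translation_defect v (h m)) \<longlonglongrightarrow> 0"
proof -
  define p where "p x = max 0 (v x)" for x
  define n where "n x = max 0 (- v x)" for x
  have [measurable]: "p \<in> borel_measurable borel" "n \<in> borel_measurable borel"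
    unfolding p_def[abs_def] n_def[abs_def] by measurable
  have "(\<integral>\<^sup>+x. ennreal ((p x)\<^sup>2) \<partial>lborel) \<le> (\<integral>\<^sup>+x. ennreal ((v x)\<^sup>2) \<partial>lborel)"
    "(\<integral>\<^sup>+x. ennreal ((n x)\<^sup>2) \<partial>lborel) \<le> (\<integral>\<^sup>+x. ennreal ((v x)\<^sup>2) \<partial>lborel)"
    by (auto intro!: nn_integral_mono simp: p_def n_def max_def)
  with fin have "(\<lambda>m. translation_defect p (h m)) \<longlonglongrightarrow> 0" "(\<lambda>m. translation_defect n (h m)) \<longlonglongrightarrow> 0"
    by (auto intro!: translation_defect_nonneg_tendsto h intro: le_less_trans simp: p_def n_def)
  moreover have "translation_defect (\<lambda>x. - n x) k = translation_defect n k" for k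
    unfolding translation_defect_def by (simp add: power2_commute)
  ultimately have "(\<lambda>m. 2 * translation_defect p (h m) + 2 * translation_defect (\<lambda>x. - n x) (h m)) \<longlonglongrightarrow> 2 * 0 + 2 * 0"
    by (intro tendsto_add ennreal_tendsto_cmult) auto
  then have "(\<lambda>m. translation_defect (\<lambda>x. p x + - n x) (h m)) \<longlonglongrightarrow> 0"
    by (intro ennreal_squeeze_0[OF translation_defect_add]) auto
  moreover have "v = (\<lambda>x. p x + - n x)" by (auto simp: p_def n_def)
  ultimately show ?thesis by simp
qed

section \<open>Plancherel's identity\<close>

lemma cis_measurable [measurable]: "cis \<in> borel_measurable borel"
  unfolding cis_conv_exp by measurable

text \<open>The Fourier transform without a normalising factor and with the sign \<open>+\<close> in the exponent;
  Plancherel then carries the factor \<open>(2\<pi>)\<^sup>n\<close>.\<close>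

definition ft :: "('a::euclidean_space \<Rightarrow> real) \<Rightarrow> 'a \<Rightarrow> complex" where
  "ft u \<xi> = (LBINT x. u x *\<^sub>R cis (\<xi> \<bullet> x))"

lemma ft_integrand:
  assumes "integrable lborel u"
  shows "integrable lborel (\<lambda>x. u x *\<^sub>R cis (\<xi> \<bullet> x))"
  by (rule Bochner_Integration.integrable_bound[OF assms]) (use assms in auto)

lemma ft_measurable [measurable]:
  assumes [measurable]: "u \<in> borel_measurable borel"
  shows "ft u \<in> borel_measurable borel"
  unfolding ft_def[abs_def] by measurable

lemma norm_ft_le:
  assumes "integrable lborel u"
  shows "norm (ft u \<xi>) \<le> (LBINT x. \<bar>u x\<bar>)"
  using integral_norm_bound[of lborel "\<lambda>x. u x *\<^sub>R cis (\<xi> \<bullet> x)"] by (simp add: ft_def)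

lemma ft_diff:
  assumes "integrable lborel u" "integrable lborel w"
  shows "ft (\<lambda>x. u x - w x) \<xi> = ft u \<xi> - ft w \<xi>"
  unfolding ft_def using assms by (simp add: scaleR_diff_left ft_integrand)

lemma integrable_product_bounded:
  fixes f :: "'a::euclidean_space \<Rightarrow> real" and g :: "'b::euclidean_space \<Rightarrow> real"
    and b :: "'a \<times> 'b \<Rightarrow> complex"
  assumes f: "integrable lborel f" and g: "integrable lborel g"
    and [measurable]: "b \<in> borel_measurable (borel \<Otimes>\<^sub>M borel)" and B: "\<And>p. norm (b p) \<le> B"
  shows "integrable (lborel \<Otimes>\<^sub>M lborel) (\<lambda>(x, y). (f x * g y) *\<^sub>R b (x, y))"
proof (rule Bochner_Integration.integrable_bound)
  have [measurable]: "f \<in> borel_measurable borel" "g \<in> borel_measurable borel"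
    using f g by auto
  have "integrable (lborel \<Otimes>\<^sub>M lborel) (\<lambda>(x, y). f x * g y)"
    by (rule lborel_pair.Fubini_integrable) (use f g in \<open>auto simp: abs_mult\<close>)
  then show "integrable (lborel \<Otimes>\<^sub>M lborel) (\<lambda>p. B * (case p of (x, y) \<Rightarrow> f x * g y))"
    by (rule integrable_mult_right)
  show "(\<lambda>(x, y). (f x * g y) *\<^sub>R b (x, y)) \<in> borel_measurable (lborel \<Otimes>\<^sub>M lborel)"
    by measurable
  show "AE p in lborel \<Otimes>\<^sub>M lborel. norm (case p of (x, y) \<Rightarrow> (f x * g y) *\<^sub>R b (x, y))
      \<le> norm (B * (case p of (x, y) \<Rightarrow> f x * g y))"
    using B order_trans[OF B abs_ge_self]
    by (auto intro!: AE_I2 mult_right_mono simp: abs_mult mult.commute[of "\<bar>B\<bar>"] mult_left_mono)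
qed

lemma fubini_bounded:
  fixes f :: "'a::euclidean_space \<Rightarrow> real" and g :: "'b::euclidean_space \<Rightarrow> real"
    and b :: "'a \<times> 'b \<Rightarrow> complex"
  assumes "integrable lborel f" and "integrable lborel g"
    and "b \<in> borel_measurable (borel \<Otimes>\<^sub>M borel)" and "\<And>p. norm (b p) \<le> B"
  shows "(LBINT x. f x *\<^sub>R (LBINT y. g y *\<^sub>R b (x, y))) = (LBINT y. g y *\<^sub>R (LBINT x. f x *\<^sub>R b (x, y)))"
proof -
  have "(LBINT y. (LBINT x. (f x * g y) *\<^sub>R b (x, y))) = (LBINT x. (LBINT y. (f x * g y) *\<^sub>R b (x, y)))"
    using lborel_pair.Fubini_integral[OF integrable_product_bounded[OF assms]] by simp
  also have "(\<lambda>y. \<integral>x. (f x * g y) *\<^sub>R b (x, y) \<partial>lborel) = (\<lambda>y. g y *\<^sub>R (LBINT x. f x *\<^sub>R b (x, y)))"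
    by (simp flip: scaleR_scaleR integral_scaleR_right add: scaleR_left_commute)
  also have "(\<lambda>x. \<integral>y. (f x * g y) *\<^sub>R b (x, y) \<partial>lborel) = (\<lambda>x. f x *\<^sub>R (LBINT y. g y *\<^sub>R b (x, y)))"
    by (simp flip: scaleR_scaleR integral_scaleR_right)
  finally show ?thesis ..
qed

lemma gauss_integrable:
  assumes "s > 0"
  shows "integrable lborel (gauss s :: 'a::euclidean_space \<Rightarrow> real)"
proof -
  have "integrable lborel (\<lambda>x::'a. Re (gauss s x *\<^sub>R cis (0 \<bullet> x)))"
    using gauss_fourier[OF assms, of "0::'a"] by (intro integrable_Re) (simp add: has_bochner_integral_iff)
  then show ?thesis by simp
qed

lemma gauss_integral: "integral\<^sup>L lborel (gauss 1 :: 'a::euclidean_space \<Rightarrow> real) = sqrt (2 * pi) ^ DIM('a)"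
proof -
  have "(\<integral>x. Re (gauss 1 x *\<^sub>R cis (0 \<bullet> x)) \<partial>(lborel :: 'a measure)) =
      Re (\<integral>x. gauss 1 x *\<^sub>R cis (0 \<bullet> x) \<partial>(lborel :: 'a measure))"
    using gauss_fourier[of 1 "0::'a"] by (intro integral_Re) (simp add: has_bochner_integral_iff)
  also have "\<dots> = sqrt (2 * pi) ^ DIM('a)"
    using gauss_fourier[of 1 "0::'a"] by (simp add: has_bochner_integral_iff gauss_def)
  finally show ?thesis by simp
qed

text \<open>Write \<open>|ft v \<xi>|\<^sup>2\<close> as \<open>ft v \<xi>\<close> times its conjugate and integrate the frequency first; the Gaussian
  factor makes all integrals converge absolutely.\<close>

lemma gaussian_mean_ft_double_integral:
  fixes v :: "'a::euclidean_space \<Rightarrow> real"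
  assumes v: "integrable lborel v" and s: "s > 0"
  shows "(LBINT \<xi>. gauss s \<xi> * (norm (ft v \<xi>))\<^sup>2) =
    (sqrt (2 * pi) / s) ^ DIM('a) * (LBINT x. v x * (LBINT y. v y * gauss (1/s) (x - y)))"
proof -
  note [measurable] = borel_measurable_integrable[OF v, simplified]
  define c where "c = (sqrt (2 * pi) / s) ^ DIM('a)"
  define M where "M = (LBINT x. \<bar>v x\<bar>)"
  have M: "norm (ft v \<xi>) \<le> M" for \<xi> unfolding M_def using v by (rule norm_ft_le)
  have g: "integrable lborel (gauss s :: 'a \<Rightarrow> real)" using s by (rule gauss_integrable)
  have cnj_ft: "cnj (ft v \<xi>) = (LBINT y. v y *\<^sub>R cis (- (\<xi> \<bullet> y)))" for \<xi>
    using integral_bounded_linear[OF bounded_linear_cnj ft_integrand[OF v]]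
    by (simp add: ft_def cis_cnj)
  \<comment> \<open>First Fubini step: for fixed \<open>x\<close> the Gaussian integral over frequencies is explicit.\<close>
  have inner: "(LBINT \<xi>. gauss s \<xi> *\<^sub>R (cis (\<xi> \<bullet> x) * cnj (ft v \<xi>))) =
      complex_of_real (c * (LBINT y. v y * gauss (1/s) (x - y)))" for x
  proof -
    have "(LBINT \<xi>. gauss s \<xi> *\<^sub>R (cis (\<xi> \<bullet> x) * cnj (ft v \<xi>))) =
        (LBINT \<xi>. gauss s \<xi> *\<^sub>R (LBINT y. v y *\<^sub>R cis ((x - y) \<bullet> \<xi>)))"
      unfolding cnj_ft
      by (simp flip: integral_mult_right_zero scaleR_conv_of_real)
         (simp add: cis_mult inner_diff_left inner_commute algebra_simps)
    also have "\<dots> = (LBINT y. v y *\<^sub>R (LBINT \<xi>. gauss s \<xi> *\<^sub>R cis ((x - y) \<bullet> \<xi>)))"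
      using fubini_bounded[OF g v, of "\<lambda>(\<xi>, y). cis ((x - y) \<bullet> \<xi>)" 1] by (simp add: split_beta')
    also have "\<dots> = (LBINT y. complex_of_real (c * (v y * gauss (1/s) (x - y))))"
      unfolding has_bochner_integral_integral_eq[OF gauss_fourier[OF s]] c_def
      by (simp add: scaleR_conv_of_real mult_ac)
    also have "\<dots> = complex_of_real (c * (LBINT y. v y * gauss (1/s) (x - y)))"
      by (simp only: integral_complex_of_real integral_mult_right_zero)
    finally show ?thesis .
  qed
  have "complex_of_real (LBINT \<xi>. gauss s \<xi> * (norm (ft v \<xi>))\<^sup>2) =
      (LBINT \<xi>. complex_of_real (gauss s \<xi> * (norm (ft v \<xi>))\<^sup>2))"
    by (simp only: integral_complex_of_real)
  also have "\<dots> = (LBINT \<xi>. gauss s \<xi> *\<^sub>R (LBINT x. v x *\<^sub>R (cis (\<xi> \<bullet> x) * cnj (ft v \<xi>))))"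
  proof (rule Bochner_Integration.integral_cong[OF refl])
    fix \<xi>
    have "(LBINT x. v x *\<^sub>R (cis (\<xi> \<bullet> x) * cnj (ft v \<xi>))) = ft v \<xi> * cnj (ft v \<xi>)"
      unfolding ft_def[of v \<xi>] by (simp flip: integral_mult_left_zero mult_scaleR_left)
    also have "\<dots> = complex_of_real ((norm (ft v \<xi>))\<^sup>2)"
      using complex_norm_square[of "ft v \<xi>"] by simp
    finally show "complex_of_real (gauss s \<xi> * (norm (ft v \<xi>))\<^sup>2) =
        gauss s \<xi> *\<^sub>R (LBINT x. v x *\<^sub>R (cis (\<xi> \<bullet> x) * cnj (ft v \<xi>)))"
      by (simp add: scaleR_conv_of_real)
  qed
  also have "\<dots> = (LBINT x. v x *\<^sub>R (LBINT \<xi>. gauss s \<xi> *\<^sub>R (cis (\<xi> \<bullet> x) * cnj (ft v \<xi>))))"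
  proof -
    have "(\<lambda>p. cis (fst p \<bullet> snd p) * cnj (ft v (fst p))) \<in> borel_measurable (borel \<Otimes>\<^sub>M borel)"
      unfolding cnj_ft by measurable
    then show ?thesis
      using fubini_bounded[OF g v, of "\<lambda>p. cis (fst p \<bullet> snd p) * cnj (ft v (fst p))" M] M
      by (simp add: norm_mult)
  qed
  also have "\<dots> = (LBINT x. complex_of_real (c * (v x * (LBINT y. v y * gauss (1/s) (x - y)))))"
    unfolding inner by (simp add: scaleR_conv_of_real mult_ac)
  also have "\<dots> = complex_of_real (c * (LBINT x. v x * (LBINT y. v y * gauss (1/s) (x - y))))"
    by (simp only: integral_complex_of_real integral_mult_right_zero)
  finally show ?thesis
    unfolding c_def by (simp only: of_real_eq_iff)
qed

definition autocorr :: "('a::euclidean_space \<Rightarrow> real) \<Rightarrow> 'a \<Rightarrow> real" where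
  "autocorr v h = (LBINT x. v x * v (x + h))"

lemma square_integrable_translate:
  fixes v :: "'a::euclidean_space \<Rightarrow> real"
  assumes [measurable]: "v \<in> borel_measurable borel" and v2: "integrable lborel (\<lambda>x. (v x)\<^sup>2)"
  shows "integrable lborel (\<lambda>x. (v (x + h))\<^sup>2)"
    and "(LBINT x. (v (x + h))\<^sup>2) = (LBINT x. (v x)\<^sup>2)"
  using lborel_affine_integral[of "\<lambda>x. (v x)\<^sup>2" 1 h] v2 by (simp_all add: add.commute)

lemma autocorr_integrable:
  fixes v :: "'a::euclidean_space \<Rightarrow> real"
  assumes [measurable]: "v \<in> borel_measurable borel" and v2: "integrable lborel (\<lambda>x. (v x)\<^sup>2)"
  shows "integrable lborel (\<lambda>x. v x * v (x + h))"
    and "(LBINT x. \<bar>v x * v (x + h)\<bar>) \<le> (LBINT x. (v x)\<^sup>2)"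
proof -
  have le: "\<bar>a * b\<bar> \<le> (a\<^sup>2 + b\<^sup>2) / 2" for a b :: real
    using zero_le_power2[of "\<bar>a\<bar> - \<bar>b\<bar>"] by (simp add: power2_diff abs_mult)
  note i = square_integrable_translate[OF assms]
  have b: "integrable lborel (\<lambda>x. ((v x)\<^sup>2 + (v (x + h))\<^sup>2) / 2)"
    using v2 i by simp
  show int: "integrable lborel (\<lambda>x. v x * v (x + h))"
    by (rule Bochner_Integration.integrable_bound[OF b])
       (use le in \<open>auto intro!: AE_I2 simp: le_divide_eq\<close>)
  have "(LBINT x. \<bar>v x * v (x + h)\<bar>) \<le> (LBINT x. ((v x)\<^sup>2 + (v (x + h))\<^sup>2) / 2)"
    using int b le by (intro integral_mono) auto
  also have "\<dots> = (LBINT x. (v x)\<^sup>2)"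
    using v2 i by simp
  finally show "(LBINT x. \<bar>v x * v (x + h)\<bar>) \<le> (LBINT x. (v x)\<^sup>2)" .
qed

lemma abs_autocorr_le:
  fixes v :: "'a::euclidean_space \<Rightarrow> real"
  assumes "v \<in> borel_measurable borel" "integrable lborel (\<lambda>x. (v x)\<^sup>2)"
  shows "\<bar>autocorr v h\<bar> \<le> (LBINT x. (v x)\<^sup>2)"
  unfolding autocorr_def
  by (rule order_trans[OF integral_abs_bound autocorr_integrable(2)[OF assms]])

text \<open>Expanding the square shows that the autocorrelation at \<open>h\<close> equals \<open>\<parallel>v\<parallel>\<^sup>2\<close> minus half of the
  translation defect.\<close>

lemma autocorr_tendsto:
  fixes v :: "'a::euclidean_space \<Rightarrow> real" and h :: "nat \<Rightarrow> 'a"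
  assumes [measurable]: "v \<in> borel_measurable borel" and v2: "integrable lborel (\<lambda>x. (v x)\<^sup>2)"
    and h: "h \<longlonglongrightarrow> 0"
  shows "(\<lambda>m. autocorr v (h m)) \<longlonglongrightarrow> (LBINT x. (v x)\<^sup>2)"
proof -
  note i = square_integrable_translate[OF assms(1) v2] autocorr_integrable(1)[OF assms(1) v2]
  define N where "N = (LBINT x. (v x)\<^sup>2)"
  have sq: "(v (x + k) - v x)\<^sup>2 = (v (x + k))\<^sup>2 + (v x)\<^sup>2 - 2 * (v x * v (x + k))" for x k
    by (simp add: power2_diff)
  have int: "integrable lborel (\<lambda>x. (v (x + k) - v x)\<^sup>2)" for k
    unfolding sq using v2 i by simp
  have eq: "autocorr v k = N - enn2real (translation_defect v k) / 2" for k
  proof -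
    have "(LBINT x. (v (x + k) - v x)\<^sup>2) = N + N - 2 * autocorr v k"
      unfolding sq N_def autocorr_def using v2 i by simp
    moreover have "translation_defect v k = ennreal (LBINT x. (v (x + k) - v x)\<^sup>2)"
      unfolding translation_defect_def using int by (intro nn_integral_eq_integral) auto
    moreover have "0 \<le> (LBINT x. (v (x + k) - v x)\<^sup>2)" by simp
    ultimately show ?thesis by (simp add: field_simps)
  qed
  have "(\<integral>\<^sup>+x. ennreal ((v x)\<^sup>2) \<partial>lborel) < \<infinity>"
    using v2 by (simp add: nn_integral_eq_integral)
  then have "(\<lambda>m. translation_defect v (h m)) \<longlonglongrightarrow> 0"
    by (intro translation_defect_tendsto h) auto
  then have "(\<lambda>m. enn2real (translation_defect v (h m))) \<longlonglongrightarrow> enn2real 0"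
    by (intro tendsto_enn2real) auto
  then have "(\<lambda>m. N - enn2real (translation_defect v (h m)) / 2) \<longlonglongrightarrow> N - enn2real 0 / 2"
    by (intro tendsto_diff tendsto_const tendsto_divide) auto
  then show ?thesis unfolding eq N_def by simp
qed

text \<open>The change of variables \<open>y = x + s z\<close> and one more application of Fubini exhibit the Gaussian mean
  of \<open>|ft v|\<^sup>2\<close> as a Gaussian mean of the autocorrelation.\<close>

lemma gaussian_mean_ft_autocorr:
  fixes v :: "'a::euclidean_space \<Rightarrow> real"
  assumes v: "integrable lborel v" and v2: "integrable lborel (\<lambda>x. (v x)\<^sup>2)" and s: "s > 0"
  shows "(LBINT \<xi>. gauss s \<xi> * (norm (ft v \<xi>))\<^sup>2) =
    sqrt (2 * pi) ^ DIM('a) * (LBINT z. gauss 1 z * autocorr v (s *\<^sub>R z))"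
proof -
  note vm [measurable] = borel_measurable_integrable[OF v, simplified]
  \<comment> \<open>Rescaling \<open>y = x + s z\<close> turns the Gaussian of width \<open>s\<close> into the standard one.\<close>
  have inner: "(LBINT y. v y * gauss (1/s) (x - y)) = s ^ DIM('a) * (LBINT z. v (x + s *\<^sub>R z) * gauss 1 z)" for x
    using lborel_affine_integral(1)[of "\<lambda>y. v y * gauss (1/s) (x - y)" s x] s
    by (simp add: gauss_def)
  have *: "integrable (lborel \<Otimes>\<^sub>M lborel) (\<lambda>(z, x). gauss 1 z * (v x * v (x + s *\<^sub>R z)))"
  proof (rule lborel_pair.Fubini_integrable)
    show "AE z in lborel. integrable lborel (\<lambda>x. case (z, x) of (z, x) \<Rightarrow> gauss 1 z * (v x * v (x + s *\<^sub>R z)))"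
      using autocorr_integrable(1)[OF vm v2] by simp
    have "integrable lborel (\<lambda>z::'a. gauss 1 z * (LBINT x. (v x)\<^sup>2))"
      using gauss_integrable[of 1, where 'a='a] by simp
    then show "integrable lborel (\<lambda>z. \<integral>x. norm (case (z, x) of (z, x) \<Rightarrow> gauss 1 z * (v x * v (x + s *\<^sub>R z))) \<partial>lborel)"
    proof (rule Bochner_Integration.integrable_bound)
      show "AE z in lborel. norm (LBINT x. norm (case (z, x) of (z, x) \<Rightarrow> gauss 1 z * (v x * v (x + s *\<^sub>R z))))
          \<le> norm (gauss 1 z * (LBINT x. (v x)\<^sup>2))"
        using autocorr_integrable(2)[OF vm v2]
        by (auto intro!: AE_I2 mult_left_mono simp: abs_mult[of "gauss _ _"] gauss_bounds less_imp_le abs_of_nonneg)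
    qed measurable
  qed measurable
  have "(LBINT x. v x * (LBINT y. v y * gauss (1/s) (x - y))) =
      (LBINT x. s ^ DIM('a) * (LBINT z. gauss 1 z * (v x * v (x + s *\<^sub>R z))))"
    unfolding inner by (simp add: mult_ac flip: integral_mult_right_zero)
  also have "\<dots> = s ^ DIM('a) * (LBINT x. (LBINT z. gauss 1 z * (v x * v (x + s *\<^sub>R z))))"
    by simp
  also have "(LBINT x. (LBINT z. gauss 1 z * (v x * v (x + s *\<^sub>R z)))) =
      (LBINT z. (LBINT x. gauss 1 z * (v x * v (x + s *\<^sub>R z))))"
    using lborel_pair.Fubini_integral[OF *] by simp
  also have "\<dots> = (LBINT z. gauss 1 z * autocorr v (s *\<^sub>R z))"
    by (simp add: autocorr_def)
  finally show ?thesis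
    unfolding gaussian_mean_ft_double_integral[OF v s] using s by (simp add: power_divide)
qed

text \<open>As the Gaussian weight increases to \<open>1\<close>, the weighted integral of \<open>|ft v|\<^sup>2\<close> converges to the
  left-hand side by monotone convergence. By the autocorrelation formula it also converges to the
  right-hand side, since the autocorrelation is bounded and continuous at \<open>0\<close>.\<close>

theorem plancherel:
  fixes v :: "'a::euclidean_space \<Rightarrow> real"
  assumes v: "integrable lborel v" and v2: "integrable lborel (\<lambda>x. (v x)\<^sup>2)"
  shows "(\<integral>\<^sup>+\<xi>. ennreal ((norm (ft v \<xi>))\<^sup>2) \<partial>lborel) = ennreal ((2 * pi) ^ DIM('a) * (LBINT x. (v x)\<^sup>2))"
proof -
  note vm [measurable] = borel_measurable_integrable[OF v, simplified]
  have [measurable]: "autocorr v \<in> borel_measurable borel"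
    unfolding autocorr_def[abs_def] by measurable
  define c where "c = sqrt (2 * pi) ^ DIM('a)"
  define N where "N = (LBINT x. (v x)\<^sup>2)"
  define s :: "nat \<Rightarrow> real" where "s m = 1 / Suc m" for m
  have s: "s m > 0" for m by (simp add: s_def)
  have s0: "s \<longlonglongrightarrow> 0" unfolding s_def by (rule LIMSEQ_Suc[OF lim_1_over_n])
  define M where "M = (LBINT x. \<bar>v x\<bar>)"
  have M: "norm (ft v \<xi>) \<le> M" for \<xi> unfolding M_def using v by (rule norm_ft_le)
  have int: "integrable lborel (\<lambda>\<xi>. gauss (s m) \<xi> * (norm (ft v \<xi>))\<^sup>2)" for m
  proof (rule Bochner_Integration.integrable_bound)
    show "integrable lborel (\<lambda>\<xi>::'a. gauss (s m) \<xi> * M\<^sup>2)"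
      using gauss_integrable[OF s, where 'a='a] by simp
    show "AE \<xi> in lborel. norm (gauss (s m) \<xi> * (norm (ft v \<xi>))\<^sup>2) \<le> norm (gauss (s m) \<xi> * M\<^sup>2)"
      using M by (auto intro!: AE_I2 mult_left_mono power_mono simp: abs_mult)
  qed measurable
  have "(\<lambda>m. \<integral>z. gauss 1 z * autocorr v (s m *\<^sub>R z) \<partial>lborel) \<longlonglongrightarrow> (\<integral>z. gauss 1 z * N \<partial>(lborel :: 'a measure))"
  proof (rule integral_dominated_convergence[where w="\<lambda>z. gauss 1 z * N"])
    show "AE z in lborel. (\<lambda>m. gauss 1 z * autocorr v (s m *\<^sub>R z)) \<longlonglongrightarrow> gauss 1 z * N"
    proof (rule AE_I2)
      fix z :: 'a
      have "(\<lambda>m. s m *\<^sub>R z) \<longlonglongrightarrow> 0 *\<^sub>R z" by (intro tendsto_intros s0)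
      then show "(\<lambda>m. gauss 1 z * autocorr v (s m *\<^sub>R z)) \<longlonglongrightarrow> gauss 1 z * N"
        unfolding N_def by (intro tendsto_intros autocorr_tendsto[OF vm v2]) simp
    qed
    show "AE z in lborel. norm (gauss 1 z * autocorr v (s m *\<^sub>R z)) \<le> gauss 1 z * N" for m
      using abs_autocorr_le[OF vm v2] unfolding N_def
      by (auto intro!: AE_I2 mult_left_mono simp: abs_mult gauss_bounds less_imp_le abs_of_pos)
    show "integrable lborel (\<lambda>z::'a. gauss 1 z * N)"
      using gauss_integrable[of 1, where 'a='a] by simp
    show "(\<lambda>z. gauss 1 z * autocorr v (s m *\<^sub>R z)) \<in> borel_measurable lborel" for m
      by measurable
    show "(\<lambda>z::'a. gauss 1 z * N) \<in> borel_measurable lborel"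
      by measurable
  qed
  then have "(\<lambda>m. c * (LBINT z. gauss 1 z * autocorr v (s m *\<^sub>R z))) \<longlonglongrightarrow> c * (c * N)"
    using tendsto_mult_left[of _ "c * N" sequentially c] by (simp add: gauss_integral c_def)
  also have "c * (c * N) = (2 * pi) ^ DIM('a) * N"
  proof -
    have "c * c = (sqrt (2 * pi) * sqrt (2 * pi)) ^ DIM('a)"
      unfolding c_def by (rule power_mult_distrib[symmetric])
    then show ?thesis by simp
  qed
  also have "(\<lambda>m. c * (LBINT z. gauss 1 z * autocorr v (s m *\<^sub>R z)))
      = (\<lambda>m. \<integral>\<xi>. gauss (s m) \<xi> * (norm (ft v \<xi>))\<^sup>2 \<partial>lborel)"
    unfolding c_def gaussian_mean_ft_autocorr[OF v v2 s] ..
  finally have lim1: "(\<lambda>m. \<integral>\<^sup>+\<xi>. ennreal (gauss (s m) \<xi> * (norm (ft v \<xi>))\<^sup>2) \<partial>lborel)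
      \<longlonglongrightarrow> ennreal ((2 * pi) ^ DIM('a) * N)"
    using int by (subst nn_integral_eq_integral) (auto simp: gauss_bounds less_imp_le)
  have lim2: "(\<lambda>m. \<integral>\<^sup>+\<xi>. ennreal (gauss (s m) \<xi> * (norm (ft v \<xi>))\<^sup>2) \<partial>lborel)
      \<longlonglongrightarrow> (\<integral>\<^sup>+\<xi>. ennreal ((norm (ft v \<xi>))\<^sup>2) \<partial>lborel)"
  proof (rule nn_integral_LIMSEQ)
    show "incseq (\<lambda>m \<xi>. ennreal (gauss (s m) \<xi> * (norm (ft v \<xi>))\<^sup>2))"
    proof (intro incseq_SucI le_funI ennreal_leI mult_right_mono)
      fix m and \<xi> :: 'a
      have "(s (Suc m) * norm \<xi>)\<^sup>2 \<le> (s m * norm \<xi>)\<^sup>2"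
        by (intro power_mono mult_right_mono) (auto simp: s_def field_simps)
      then show "gauss (s m) \<xi> \<le> gauss (s (Suc m)) \<xi>" by (simp add: gauss_def)
    qed simp
    show "(\<lambda>m. ennreal (gauss (s m) \<xi> * (norm (ft v \<xi>))\<^sup>2)) \<longlonglongrightarrow> ennreal ((norm (ft v \<xi>))\<^sup>2)" for \<xi>
    proof -
      have "(\<lambda>m. ennreal (exp (- (s m * norm \<xi>)\<^sup>2 / 2) * (norm (ft v \<xi>))\<^sup>2))
          \<longlonglongrightarrow> ennreal (exp (- (0 * norm \<xi>)\<^sup>2 / 2) * (norm (ft v \<xi>))\<^sup>2)"
        by (intro tendsto_intros s0) auto
      then show ?thesis by (simp add: gauss_def)
    qed
  qed measurable
  show ?thesis using LIMSEQ_unique[OF lim2 lim1] unfolding N_def .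
qed

section \<open>The symbol of a radial kernel and its lower bound\<close>

text \<open>With \<open>f t = t\<^bsup>n-2\<^esup> \<rho>r t\<close> this is \<open>\<rho>(z) / |z|\<^sup>2\<close>. In terms of \<open>f\<close> the weight \<open>|z|\<^bsup>-n\<^esup>\<close> appears, and
  \<open>|z|\<^bsup>-n\<^esup> dz\<close> is invariant under dilations.\<close>

definition radial_weight :: "(real \<Rightarrow> real) \<Rightarrow> 'a::euclidean_space \<Rightarrow> real" where
  "radial_weight f z = f (norm z) / norm z ^ DIM('a)"

lemma radial_weight_0 [simp]: "radial_weight f 0 = 0"
  by (simp add: radial_weight_def)

lemma radial_weight_nonneg:
  assumes "\<And>t. 0 < t \<Longrightarrow> 0 \<le> f t"
  shows "0 \<le> radial_weight f z"
proof (cases "z = 0")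
  case False
  then show ?thesis using assms[of "norm z"] by (simp add: radial_weight_def)
qed simp

lemma radial_weight_measurable:
  assumes "antimono_on {0<..} f"
  shows "radial_weight f \<in> borel_measurable borel"
proof -
  have "mono_on {0<..} (\<lambda>t. - f t)"
    using assms by (auto simp: monotone_on_def)
  then have "(\<lambda>t. - f t) \<in> borel_measurable (restrict_space borel {0<..})"
    by (rule borel_measurable_mono_on_fnc)
  then have [measurable]: "(\<lambda>t. indicator {0<..} t *\<^sub>R - f t) \<in> borel_measurable borel"
    by (subst (asm) borel_measurable_restrict_space_iff) auto
  have eq: "radial_weight f = (\<lambda>z::'a. - (indicator {0<..} (norm z) *\<^sub>R - f (norm z)) / norm z ^ DIM('a))"
    by (auto simp: fun_eq_iff radial_weight_def indicator_def)
  show ?thesis unfolding eq by measurable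
qed

text \<open>The integrability condition says that the kernel is integrable, as \<open>|z|\<^sup>2\<close> times the weight is the
  kernel itself. The parameter \<open>T\<close> fixes the space, on whose dimension the weight depends.\<close>

locale radial_profile =
  fixes f :: "real \<Rightarrow> real" and T :: "'a::euclidean_space itself"
  assumes anti: "antimono_on {0<..} f"
    and nonneg: "0 < t \<Longrightarrow> 0 \<le> f t"
    and int: "integrable lborel (\<lambda>z::'a. (norm z)\<^sup>2 * radial_weight f z)"
begin

lemma weight_measurable [measurable]: "radial_weight f \<in> borel_measurable (borel :: 'a measure)"
  using anti by (rule radial_weight_measurable)

lemma weight_nonneg: "0 \<le> radial_weight f z" for z :: 'a
  by (rule radial_weight_nonneg) (rule nonneg)

end

text \<open>Up to factors \<open>\<i>\<close> and \<open>-\<i>\<close> this is both the symbol of the nonlocal gradient as a Fourier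
  multiplier, see \<open>scalar_div_trig\<close>, and the Fourier transform of the odd vector field \<open>\<rho>(z) z / |z|\<^sup>2\<close>.\<close>

definition kernel_symbol :: "(real \<Rightarrow> real) \<Rightarrow> 'a::euclidean_space \<Rightarrow> 'a" where
  "kernel_symbol f \<xi> = (LBINT z. (sin (\<xi> \<bullet> z) * radial_weight f z) *\<^sub>R z)"

lemma one_minus_cos_le: "1 - cos x \<le> x\<^sup>2 / 2" for x :: real
proof -
  have "1 - cos x = 2 * (sin (x / 2))\<^sup>2"
    using cos_double_sin[of "x / 2"] by simp
  also have "\<bar>sin (x / 2)\<bar> \<le> \<bar>x / 2\<bar>" by (rule abs_sin_x_le_abs_x)
  then have "2 * (sin (x / 2))\<^sup>2 \<le> 2 * (x / 2)\<^sup>2"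
    using abs_le_square_iff[of "sin (x / 2)" "x / 2"] by simp
  finally show ?thesis by (simp add: power_divide)
qed

lemma half_le_sin:
  fixes x :: real
  assumes "0 \<le> x" "x \<le> 1"
  shows "x / 2 \<le> sin x"
proof (cases "x = 0")
  case False
  then obtain c where c: "0 < c" "c < x" "sin x - sin 0 = (x - 0) * cos c"
    using MVT2[of 0 x sin cos] assms by (auto intro: DERIV_sin)
  have "c\<^sup>2 \<le> 1" using c assms by (intro power_le_one) auto
  then have "1 / 2 \<le> cos c" using one_minus_cos_le[of c] by linarith
  then have "x * (1 / 2) \<le> x * cos c" using assms by (intro mult_left_mono) auto
  then show ?thesis using c by simp
qed simp

lemma cos_difference_le:
  fixes b h :: real
  assumes "0 < h" "h \<le> 1"
  shows "\<bar>cos b - cos ((1 + h) * b)\<bar> \<le> 2 * h * b\<^sup>2"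
proof -
  have "cos b - cos ((1 + h) * b) = 2 * sin ((b + (1 + h) * b) / 2) * sin (((1 + h) * b - b) / 2)"
    by (rule cos_diff_cos)
  then have "\<bar>cos b - cos ((1 + h) * b)\<bar> = 2 * (\<bar>sin ((b + (1 + h) * b) / 2)\<bar> * \<bar>sin (((1 + h) * b - b) / 2)\<bar>)"
    by (simp add: abs_mult)
  also have "\<dots> \<le> 2 * (\<bar>(b + (1 + h) * b) / 2\<bar> * \<bar>((1 + h) * b - b) / 2\<bar>)"
    by (intro mult_left_mono mult_mono abs_sin_x_le_abs_x) auto
  also have "\<dots> = (2 + h) * h * b\<^sup>2 / 2"
  proof -
    have e: "(b + (1 + h) * b) / 2 = (2 + h) / 2 * b" "((1 + h) * b - b) / 2 = h / 2 * b"
      by (simp_all add: field_simps)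
    show ?thesis
      unfolding e using assms by (simp add: abs_mult power2_eq_square)
  qed
  also have "\<dots> \<le> 2 * h * b\<^sup>2"
  proof -
    have "(2 + h) * (h * b\<^sup>2) \<le> 4 * (h * b\<^sup>2)"
      using assms by (intro mult_right_mono) auto
    then show ?thesis by (simp add: mult.assoc)
  qed
  finally show ?thesis .
qed

lemma (in radial_profile) symbol_integrand_integrable:
  fixes \<xi> :: "'a"
  shows "integrable lborel (\<lambda>z. sin (\<xi> \<bullet> z) * (\<xi> \<bullet> z) * radial_weight f z)"
    and "integrable lborel (\<lambda>z. (sin (\<xi> \<bullet> z) * radial_weight f z) *\<^sub>R z)"
proof -
  have s: "\<bar>sin (\<xi> \<bullet> z)\<bar> \<le> norm \<xi> * norm z" for z
    by (rule order_trans[OF abs_sin_x_le_abs_x Cauchy_Schwarz_ineq2])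
  show "integrable lborel (\<lambda>z. sin (\<xi> \<bullet> z) * (\<xi> \<bullet> z) * radial_weight f z)"
  proof (rule Bochner_Integration.integrable_bound)
    show "integrable lborel (\<lambda>z::'a. (norm \<xi>)\<^sup>2 * ((norm z)\<^sup>2 * radial_weight f z))"
      using int by simp
    have "\<bar>sin (\<xi> \<bullet> z)\<bar> * \<bar>\<xi> \<bullet> z\<bar> \<le> (norm \<xi> * norm z) * (norm \<xi> * norm z)" for z
      by (intro mult_mono s Cauchy_Schwarz_ineq2) auto
    from mult_right_mono[OF this weight_nonneg]
    show "AE z in lborel. norm (sin (\<xi> \<bullet> z) * (\<xi> \<bullet> z) * radial_weight f z)
        \<le> norm ((norm \<xi>)\<^sup>2 * ((norm z)\<^sup>2 * radial_weight f z))"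
      using weight_nonneg by (auto intro!: AE_I2 simp: abs_mult power2_eq_square mult_ac)
  qed measurable
  show "integrable lborel (\<lambda>z. (sin (\<xi> \<bullet> z) * radial_weight f z) *\<^sub>R z)"
  proof (rule Bochner_Integration.integrable_bound)
    show "integrable lborel (\<lambda>z::'a. norm \<xi> * ((norm z)\<^sup>2 * radial_weight f z))"
      using int by simp
    have "\<bar>sin (\<xi> \<bullet> z)\<bar> * (radial_weight f z * norm z) \<le> (norm \<xi> * norm z) * (radial_weight f z * norm z)" for z
      using weight_nonneg by (intro mult_right_mono s) auto
    then show "AE z in lborel. norm ((sin (\<xi> \<bullet> z) * radial_weight f z) *\<^sub>R z)
        \<le> norm (norm \<xi> * ((norm z)\<^sup>2 * radial_weight f z))"
      using weight_nonneg by (auto intro!: AE_I2 simp: abs_mult power2_eq_square mult_ac)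
  qed measurable
qed

text \<open>The integral is the derivative at \<open>a = 1\<close> of \<open>I(a)\<close>, the integral of
  \<open>(1 - cos (a (\<xi> \<bullet> z))) f(|z|) / |z|\<^sup>n\<close>. The dilation \<open>z \<mapsto> z / a\<close> moves \<open>a\<close> into the profile, where it
  yields \<open>f(|z| / a)\<close>; as \<open>f\<close> decreases, \<open>I\<close> is increasing. This replaces the integration by parts in the
  radial variable that would need a derivative of \<open>f\<close>.\<close>

lemma (in radial_profile) symbol_nonneg:
  fixes \<xi> :: "'a"
  shows "0 \<le> (LBINT z. sin (\<xi> \<bullet> z) * (\<xi> \<bullet> z) * radial_weight f z)"
proof -
  define h :: "nat \<Rightarrow> real" where "h m = 1 / Suc m" for m
  have h: "0 < h m" "h m \<le> 1" for m by (simp_all add: h_def)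
  have h0: "h \<longlonglongrightarrow> 0" unfolding h_def by (rule LIMSEQ_Suc[OF lim_1_over_n])
  have ineq: "(\<xi> \<bullet> z)\<^sup>2 \<le> (norm \<xi>)\<^sup>2 * (norm z)\<^sup>2" for z
    using Cauchy_Schwarz_ineq2[of \<xi> z] by (metis abs_le_square_iff abs_mult abs_norm_cancel power_mult_distrib)
  have intc: "integrable lborel (\<lambda>z. (1 - cos (a * (\<xi> \<bullet> z))) * radial_weight f z)" for a
  proof (rule Bochner_Integration.integrable_bound)
    show "integrable lborel (\<lambda>z::'a. a\<^sup>2 * (norm \<xi>)\<^sup>2 * ((norm z)\<^sup>2 * radial_weight f z))"
      using int by simp
    have "1 - cos (a * (\<xi> \<bullet> z)) \<le> a\<^sup>2 * (norm \<xi>)\<^sup>2 * (norm z)\<^sup>2" for z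
    proof -
      have "1 - cos (a * (\<xi> \<bullet> z)) \<le> (a * (\<xi> \<bullet> z))\<^sup>2"
        using one_minus_cos_le[of "a * (\<xi> \<bullet> z)"] zero_le_power2[of "a * (\<xi> \<bullet> z)"] by linarith
      also have "\<dots> \<le> a\<^sup>2 * ((norm \<xi>)\<^sup>2 * (norm z)\<^sup>2)"
        unfolding power_mult_distrib by (intro mult_left_mono ineq) auto
      finally show ?thesis by (simp add: mult.assoc)
    qed
    from mult_right_mono[OF this weight_nonneg]
    show "AE z in lborel. norm ((1 - cos (a * (\<xi> \<bullet> z))) * radial_weight f z)
        \<le> norm (a\<^sup>2 * (norm \<xi>)\<^sup>2 * ((norm z)\<^sup>2 * radial_weight f z))"
      using weight_nonneg by (auto intro!: AE_I2 simp: abs_mult mult_ac)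
  qed measurable
  have mono: "(LBINT z. (1 - cos (\<xi> \<bullet> z)) * radial_weight f z)
      \<le> (LBINT z. (1 - cos ((1 + h m) * (\<xi> \<bullet> z))) * radial_weight f z)" for m
  proof -
    define a where "a = 1 + h m"
    have a: "a > 1" using h[of m] by (simp add: a_def)
    \<comment> \<open>The substitution \<open>z \<mapsto> z / a\<close> moves \<open>a\<close> into the weight, which becomes \<open>f(|z| / a) / |z|\<^sup>n\<close> and
      grows because \<open>f\<close> decreases.\<close>
    define g where "g z = (1 - cos (\<xi> \<bullet> z)) * (radial_weight f ((1 / a) *\<^sub>R z) / a ^ DIM('a))" for z
    have [measurable]: "g \<in> borel_measurable borel" unfolding g_def[abs_def] by measurable
    have g: "(\<lambda>z. g (0 + a *\<^sub>R z)) = (\<lambda>z. (1 - cos (a * (\<xi> \<bullet> z))) * radial_weight f z / a ^ DIM('a))"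
      using a by (simp add: g_def)
    have a0: "a \<noteq> 0" using a by simp
    have gi: "integrable lborel g"
      using intc[of a] unfolding lborel_affine_integral(2)[OF \<open>g \<in> _\<close> a0, of 0, symmetric] g by simp
    have "(LBINT z. g z) = (LBINT z. (1 - cos (a * (\<xi> \<bullet> z))) * radial_weight f z)"
      unfolding lborel_affine_integral(1)[OF \<open>g \<in> _\<close> a0, of 0] g using a by simp
    moreover have "(LBINT z. (1 - cos (\<xi> \<bullet> z)) * radial_weight f z) \<le> (LBINT z. g z)"
    proof (rule integral_mono)
      show "integrable lborel (\<lambda>z. (1 - cos (\<xi> \<bullet> z)) * radial_weight f z)"
        using intc[of 1] by simp
      fix z
      show "(1 - cos (\<xi> \<bullet> z)) * radial_weight f z \<le> g z"
      proof (cases "z = 0")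
        case False
        then have "f (norm z) \<le> f (norm z / a)"
          using a by (intro monotone_onD[OF anti]) (auto simp: divide_le_eq)
        then have "radial_weight f z \<le> radial_weight f ((1 / a) *\<^sub>R z) / a ^ DIM('a)"
          using a by (simp add: radial_weight_def power_divide divide_right_mono)
        then show ?thesis unfolding g_def by (intro mult_left_mono) auto
      qed (simp add: g_def)
    qed (rule gi)
    ultimately show ?thesis by (simp add: a_def)
  qed
  \<comment> \<open>\<open>D m\<close> is the integrand of the difference quotient at \<open>a = 1\<close> with step \<open>h m\<close>.\<close>
  define D where "D m z = (cos (\<xi> \<bullet> z) - cos ((1 + h m) * (\<xi> \<bullet> z))) / h m * radial_weight f z" for m z
  have "0 \<le> (LBINT z. D m z)" for m
  proof -
    have "D m z = ((1 - cos ((1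
        + h m) * (\<xi> \<bullet> z))) * radial_weight f z - (1 - cos (\<xi> \<bullet> z)) * radial_weight f z) / h m" for z
      using h[of m] by (simp add: D_def field_simps)
    then have "(LBINT z. D m z)
        = ((LBINT z. (1 - cos ((1
            + h m) * (\<xi> \<bullet> z))) * radial_weight f z) - (LBINT z. (1 - cos (\<xi> \<bullet> z)) * radial_weight f z)) / h m"
      using intc[of "1 + h m"] intc[of 1] by simp
    then show ?thesis using mono[of m] h[of m] by simp
  qed
  moreover have "(\<lambda>m. \<integral>z. D m z \<partial>lborel) \<longlonglongrightarrow> (LBINT z. sin (\<xi> \<bullet> z) * (\<xi> \<bullet> z) * radial_weight f z)"
  proof (rule integral_dominated_convergence[where w="\<lambda>z. 2 * (norm \<xi>)\<^sup>2 * ((norm z)\<^sup>2 * radial_weight f z)"])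
    show "AE z in lborel. (\<lambda>m. D m z) \<longlonglongrightarrow> sin (\<xi> \<bullet> z) * (\<xi> \<bullet> z) * radial_weight f z"
    proof (rule AE_I2)
      fix z
      have "((\<lambda>a. cos (a * (\<xi> \<bullet> z))) has_field_derivative (- sin (1 * (\<xi> \<bullet> z)) * (\<xi> \<bullet> z))) (at 1)"
        by (auto intro!: derivative_eq_intros)
      then have "(\<lambda>k. (cos ((1 + k) * (\<xi> \<bullet> z)) - cos (1 * (\<xi> \<bullet> z))) / k) \<midarrow>0\<rightarrow> - sin (1 * (\<xi> \<bullet> z)) * (\<xi> \<bullet> z)"
        by (rule DERIV_D)
      moreover have "filterlim h (at 0) sequentially"
        using h h0 by (auto simp: filterlim_at less_imp_neq[symmetric] order.strict_implies_not_eq)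
      ultimately have "(\<lambda>m. (cos ((1 + h m) * (\<xi> \<bullet> z)) - cos (1 * (\<xi> \<bullet> z))) / h m) \<longlonglongrightarrow> - sin (1 * (\<xi> \<bullet> z)) * (\<xi> \<bullet> z)"
        by (rule filterlim_compose)
      then have "(\<lambda>m. - ((cos ((1 + h m) * (\<xi> \<bullet> z)) - cos (1 * (\<xi> \<bullet> z))) / h m) * radial_weight f z)
          \<longlonglongrightarrow> - (- sin (1 * (\<xi> \<bullet> z)) * (\<xi> \<bullet> z)) * radial_weight f z"
        by (intro tendsto_mult tendsto_minus tendsto_const)
      then show "(\<lambda>m. D m z) \<longlonglongrightarrow> sin (\<xi> \<bullet> z) * (\<xi> \<bullet> z) * radial_weight f z"
        by (simp add: D_def minus_divide_left)
    qed
    have "\<bar>cos (\<xi> \<bullet> z) - cos ((1 + h m) * (\<xi> \<bullet> z))\<bar> / h m \<le> 2 * (norm \<xi>)\<^sup>2 * (norm z)\<^sup>2" for m z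
    proof -
      have "\<bar>cos (\<xi> \<bullet> z) - cos ((1 + h m) * (\<xi> \<bullet> z))\<bar> / h m \<le> 2 * (\<xi> \<bullet> z)\<^sup>2"
        using cos_difference_le[OF h, of "\<xi> \<bullet> z" m] h[of m] by (simp add: divide_le_eq mult_ac)
      then show ?thesis using ineq[of z] by linarith
    qed
    from mult_right_mono[OF this weight_nonneg]
    show "AE z in lborel. norm (D m z) \<le> 2 * (norm \<xi>)\<^sup>2 * ((norm z)\<^sup>2 * radial_weight f z)" for m
      using weight_nonneg h[of m] by (auto intro!: AE_I2 simp: D_def abs_mult mult.assoc)
    show "D m \<in> borel_measurable lborel" for m
      unfolding D_def by measurable
    show "integrable lborel (\<lambda>z::'a. 2 * (norm \<xi>)\<^sup>2 * ((norm z)\<^sup>2 * radial_weight f z))"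
      using int by simp
  qed measurable
  ultimately show ?thesis by (intro LIMSEQ_le_const) auto
qed

text \<open>A convenient dimensional constant, namely \<open>25/512\<close> times the volume of a ball of radius \<open>1/8\<close>.\<close>

definition symbol_const :: "'a::euclidean_space itself \<Rightarrow> real" where
  "symbol_const _ = 25 / 512 * unit_ball_vol (DIM('a)) / 8 ^ DIM('a)"

lemma symbol_const_pos: "symbol_const TYPE('a::euclidean_space) > 0"
  by (simp add: symbol_const_def)

text \<open>Truncate the profile at height \<open>f s\<close>. The truncated profile is still decreasing and contributes a
  nonnegative amount by \<open>symbol_nonneg\<close>. What is cut off lives on \<open>|z| < s\<close>, where \<open>|\<xi> \<bullet> z| \<le> 1\<close> makes
  the integrand nonnegative, and the part of the profile that is cut off is at least \<open>f (s/2) - f s\<close> on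
  \<open>|z| \<le> s/2\<close>; integrating over one small ball is enough.\<close>

lemma (in radial_profile) symbol_lower_bound:
  fixes \<xi> :: "'a"
  assumes s: "0 < s" and \<xi>s: "norm \<xi> * s \<le> 1" and \<xi>: "\<xi> \<noteq> 0"
  shows "symbol_const TYPE('a) * (norm \<xi> * s)\<^sup>2 * (f (s / 2) - f s)
    \<le> (LBINT z. sin (\<xi> \<bullet> z) * (\<xi> \<bullet> z) * radial_weight f z)"
proof -
  define d where "d = f (s / 2) - f s"
  have d0: "0 \<le> d" using monotone_onD[OF anti, of "s / 2" s] s by (simp add: d_def)
  \<comment> \<open>\<open>f1\<close> vanishes from \<open>s\<close> on, so the sine has the sign of its argument wherever \<open>f1\<close> contributes; \<open>f2\<close>
    is again a decreasing profile.\<close>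
  define f2 where "f2 t = min (f t) (f s)" for t
  define f1 where "f1 t = max 0 (f t - f s)" for t
  have rw: "radial_weight f z = radial_weight f1 z + radial_weight f2 z" for z :: 'a
    unfolding radial_weight_def f1_def f2_def by (simp add: add_divide_distrib[symmetric] max_def min_def)
  have anti1: "antimono_on {0<..} f1" and anti2: "antimono_on {0<..} f2"
    using anti unfolding monotone_on_def f1_def f2_def by (fastforce simp: max_def min_def)+
  have nonneg1: "0 \<le> f1 t" for t by (simp add: f1_def)
  have nonneg2: "0 \<le> f2 t" if "0 < t" for t using nonneg[OF that] nonneg[OF s] by (simp add: f2_def)
  note [measurable] = radial_weight_measurable[OF anti1] radial_weight_measurable[OF anti2]
  have w: "0 \<le> radial_weight f1 z" "0 \<le> radial_weight f2 z" for z :: 'a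
    by (rule radial_weight_nonneg[OF nonneg1], rule radial_weight_nonneg[OF nonneg2])
  have int1: "integrable lborel (\<lambda>z::'a. (norm z)\<^sup>2 * radial_weight f1 z)"
    by (rule Bochner_Integration.integrable_bound[OF int])
       (use w in \<open>auto intro!: AE_I2 mult_left_mono simp: rw abs_mult\<close>)
  have int2: "integrable lborel (\<lambda>z::'a. (norm z)\<^sup>2 * radial_weight f2 z)"
    by (rule Bochner_Integration.integrable_bound[OF int])
       (use w in \<open>auto intro!: AE_I2 mult_left_mono simp: rw abs_mult\<close>)
  interpret P1: radial_profile f1 "TYPE('a)"
    using anti1 nonneg1 int1 by unfold_locales
  interpret P2: radial_profile f2 "TYPE('a)"
    using anti2 nonneg2 int2 by unfold_locales
  note i1 = P1.symbol_integrand_integrable(1) and i2 = P2.symbol_integrand_integrable(1)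
  have split: "(LBINT z. sin (\<xi> \<bullet> z) * (\<xi> \<bullet> z) * radial_weight f z) =
      (LBINT z. sin (\<xi> \<bullet> z) * (\<xi> \<bullet> z) * radial_weight f1 z) +
      (LBINT z. sin (\<xi> \<bullet> z) * (\<xi> \<bullet> z) * radial_weight f2 z)"
    using i1[of \<xi>] i2[of \<xi>] by (simp add: rw distrib_left)
  have pos2: "0 \<le> (LBINT z. sin (\<xi> \<bullet> z) * (\<xi> \<bullet> z) * radial_weight f2 z)"
    by (rule P2.symbol_nonneg)
  \<comment> \<open>A ball of radius \<open>s/16\<close> about the point at distance \<open>3s/8\<close> in direction \<open>\<xi>\<close>: it lies in
    \<open>5s/16 < |z| < 7s/16\<close>, and \<open>\<xi> \<bullet> z\<close> is at least \<open>5 |\<xi>| s / 16\<close> on it.\<close>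
  define c where "c = (3 * s / (8 * norm \<xi>)) *\<^sub>R \<xi>"
  define B where "B = ball c (s / 16)"
  define K where "K = 25 / 512 * (norm \<xi> * s)\<^sup>2 * d * (2 / s) ^ DIM('a)"
  have nc: "norm c = 3 * s / 8" using \<xi> s by (simp add: c_def)
  have \<xi>c: "\<xi> \<bullet> c = norm \<xi> * (3 * s / 8)"
    using \<xi> by (simp add: c_def dot_square_norm power2_eq_square)
  have pw: "K * indicator B z \<le> sin (\<xi> \<bullet> z) * (\<xi> \<bullet> z) * radial_weight f1 z" for z
  proof (cases "norm z < s")
    case False
    have "z \<notin> B"
    proof
      assume "z \<in> B"
      then have "norm (z - c) < s / 16" by (simp add: B_def dist_norm norm_minus_commute)
      then show False using norm_triangle_sub[of z c] nc False s by linarith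
    qed
    moreover have "f1 (norm z) = 0"
    proof -
      have "f (norm z) \<le> f s" using False s by (intro monotone_onD[OF anti]) auto
      then show ?thesis by (simp add: f1_def)
    qed
    ultimately show ?thesis by (simp add: radial_weight_def)
  next
    case True
    have b: "\<bar>\<xi> \<bullet> z\<bar> \<le> 1"
    proof -
      have "\<bar>\<xi> \<bullet> z\<bar> \<le> norm \<xi> * norm z" by (rule Cauchy_Schwarz_ineq2)
      also have "\<dots> \<le> norm \<xi> * s" using True by (intro mult_left_mono) auto
      finally show ?thesis using \<xi>s by simp
    qed
    have sb: "sin (\<xi> \<bullet> z) * (\<xi> \<bullet> z) = sin \<bar>\<xi> \<bullet> z\<bar> * \<bar>\<xi> \<bullet> z\<bar>"
      by (auto simp: abs_if)
    have sq: "(\<xi> \<bullet> z)\<^sup>2 / 2 \<le> sin (\<xi> \<bullet> z) * (\<xi> \<bullet> z)"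
    proof -
      have "\<bar>\<xi> \<bullet> z\<bar> / 2 * \<bar>\<xi> \<bullet> z\<bar> \<le> sin \<bar>\<xi> \<bullet> z\<bar> * \<bar>\<xi> \<bullet> z\<bar>"
        using b by (intro mult_right_mono half_le_sin) auto
      then show ?thesis unfolding sb by (simp add: power2_eq_square)
    qed
    show ?thesis
    proof (cases "z \<in> B")
      case False
      have "0 \<le> sin (\<xi> \<bullet> z) * (\<xi> \<bullet> z)"
        by (rule order_trans[OF _ sq]) simp
      then show ?thesis using False w by simp
    next
      case zB: True
      then have zc: "norm (z - c) < s / 16" by (simp add: B_def dist_norm norm_minus_commute)
      have "norm z \<le> norm c + norm (z - c)" using norm_triangle_sub[of z c] by simp
      then have zs: "norm z \<le> s / 2" using zc nc s by linarith
      have z0: "norm z > 0"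
      proof -
        have "norm c \<le> norm z + norm (z - c)" using norm_triangle_sub[of c z] by (simp add: norm_minus_commute)
        then show ?thesis using zc nc s by linarith
      qed
      have "norm \<xi> * (5 * s / 16) \<le> \<xi> \<bullet> z"
      proof -
        have "\<bar>\<xi> \<bullet> (z - c)\<bar> \<le> norm \<xi> * norm (z - c)" by (rule Cauchy_Schwarz_ineq2)
        also have "\<dots> \<le> norm \<xi> * (s / 16)" using zc by (intro mult_left_mono) auto
        finally have "\<bar>\<xi> \<bullet> z - \<xi> \<bullet> c\<bar> \<le> norm \<xi> * (s / 16)" by (simp add: inner_diff_right)
        then have "\<xi> \<bullet> c - norm \<xi> * (s / 16) \<le> \<xi> \<bullet> z" by linarith
        then show ?thesis using \<xi>c by (simp add: algebra_simps)
      qed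
      then have "(norm \<xi> * (5 * s / 16))\<^sup>2 \<le> (\<xi> \<bullet> z)\<^sup>2"
        using s by (intro power_mono) auto
      then have A: "25 / 512 * (norm \<xi> * s)\<^sup>2 \<le> sin (\<xi> \<bullet> z) * (\<xi> \<bullet> z)"
        using sq by (simp add: power_mult_distrib power_divide)
      have "f (s / 2) \<le> f (norm z)"
        using zs z0 s by (intro monotone_onD[OF anti]) auto
      then have "d \<le> f1 (norm z)" by (simp add: d_def f1_def)
      moreover have "(2 / s) ^ DIM('a) \<le> 1 / norm z ^ DIM('a)"
      proof -
        have "2 / s \<le> 1 / norm z" using zs z0 s by (simp add: field_simps)
        then have "(2 / s) ^ DIM('a) \<le> (1 / norm z) ^ DIM('a)" using s by (intro power_mono) auto
        then show ?thesis by (simp add: power_divide)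
      qed
      ultimately have "d * (2 / s) ^ DIM('a) \<le> f1 (norm z) * (1 / norm z ^ DIM('a))"
        using d0 s nonneg1 by (intro mult_mono) auto
      then have W: "d * (2 / s) ^ DIM('a) \<le> radial_weight f1 z" by (simp add: radial_weight_def)
      have "25 / 512 * (norm \<xi> * s)\<^sup>2 * (d * (2 / s) ^ DIM('a)) \<le> sin (\<xi> \<bullet> z) * (\<xi> \<bullet> z) * radial_weight f1 z"
        by (rule mult_mono[OF A W]) (use d0 s order_trans[OF _ A] in auto)
      then show ?thesis using zB by (simp add: K_def mult.assoc)
    qed
  qed
  have "measure lborel B = unit_ball_vol (DIM('a)) * (s / 16) ^ DIM('a)"
    unfolding B_def using s by (intro content_ball) auto
  then have "(LBINT z. K * indicator B z) = K * (unit_ball_vol (DIM('a)) * (s / 16) ^ DIM('a))"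
    by simp
  also have "\<dots> = symbol_const TYPE('a) * (norm \<xi> * s)\<^sup>2 * d"
  proof -
    have "(2 / s) ^ DIM('a) * (s / 16) ^ DIM('a) = (1 / 8) ^ DIM('a)"
      using s by (simp flip: power_mult_distrib)
    then have "K * (unit_ball_vol (DIM('a)) * (s / 16) ^ DIM('a)) =
        25 / 512 * (norm \<xi> * s)\<^sup>2 * d * unit_ball_vol (DIM('a)) * (1 / 8) ^ DIM('a)"
      by (simp add: K_def mult_ac)
    then show ?thesis by (simp add: symbol_const_def power_divide)
  qed
  finally have "symbol_const TYPE('a) * (norm \<xi> * s)\<^sup>2 * d = (LBINT z. K * indicator B z)" ..
  also have "\<dots> \<le> (LBINT z. sin (\<xi> \<bullet> z) * (\<xi> \<bullet> z) * radial_weight f1 z)"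
  proof (rule integral_mono[OF _ i1 pw])
    show "integrable lborel (\<lambda>z. K * indicator B z)"
      unfolding B_def using emeasure_bounded_finite[of "ball c (s / 16)"]
      by (intro integrable_mult_right integrable_real_indicator) auto
  qed
  also have "\<dots> \<le> (LBINT z. sin (\<xi> \<bullet> z) * (\<xi> \<bullet> z) * radial_weight f z)"
    unfolding split using pos2 by simp
  finally show ?thesis unfolding d_def .
qed

text \<open>The integral of \<open>symbol_lower_bound\<close> is the inner product of the symbol with \<open>\<xi>\<close>, and the doubling
  condition turns the increment of \<open>f\<close> into a multiple of \<open>f (s/2)\<close>.\<close>

theorem (in radial_profile) norm_kernel_symbol_lower_bound:
  fixes \<xi> :: "'a"
  assumes s: "0 < s" and \<xi>s: "norm \<xi> * s \<le> 1" and \<xi>: "\<xi> \<noteq> 0"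
    and doubling: "f s \<le> \<mu> * f (s / 2)"
  shows "symbol_const TYPE('a) * (1 - \<mu>) * (norm \<xi> * s\<^sup>2 * f (s / 2)) \<le> norm (kernel_symbol f \<xi>)"
proof -
  have "norm \<xi> * (symbol_const TYPE('a) * (1 - \<mu>) * (norm \<xi> * s\<^sup>2 * f (s / 2))) =
      symbol_const TYPE('a) * (norm \<xi> * s)\<^sup>2 * (f (s / 2) - \<mu> * f (s / 2))"
    by (simp add: algebra_simps power2_eq_square)
  also have "\<dots> \<le> symbol_const TYPE('a) * (norm \<xi> * s)\<^sup>2 * (f (s / 2) - f s)"
    using doubling symbol_const_pos[where 'a='a] by (intro mult_left_mono) auto
  also have "\<dots> \<le> (LBINT z. sin (\<xi> \<bullet> z) * (\<xi> \<bullet> z) * radial_weight f z)"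
    by (rule symbol_lower_bound[OF s \<xi>s \<xi>])
  also have "\<dots> = (LBINT z. ((sin (\<xi> \<bullet> z) * radial_weight f z) *\<^sub>R z) \<bullet> \<xi>)"
    by (simp add: inner_commute mult_ac)
  also have "\<dots> = kernel_symbol f \<xi> \<bullet> \<xi>"
    unfolding kernel_symbol_def by (intro integral_inner_left symbol_integrand_integrable(2))
  also have "\<dots> \<le> norm \<xi> * norm (kernel_symbol f \<xi>)"
    using norm_cauchy_schwarz[of "kernel_symbol f \<xi>" \<xi>] by (simp add: mult.commute)
  finally show ?thesis using \<xi> by simp
qed

section \<open>Smooth cutoff functions\<close>

text \<open>The family \<open>exp (-1/t) t\<^bsup>-j\<^esup>\<close>, extended by \<open>0\<close>, is closed under differentiation up to linear
  combinations; this gives smoothness of \<open>exp (-1/t)\<close> without an induction on formulas for higher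
  derivatives.\<close>

definition flat_fun :: "nat \<Rightarrow> real \<Rightarrow> real" where
  "flat_fun j t = (if t > 0 then exp (- 1 / t) / t ^ j else 0)"

lemma flat_fun_nonpos [simp]: "t \<le> 0 \<Longrightarrow> flat_fun j t = 0"
  by (simp add: flat_fun_def)

lemma flat_fun_le: "\<exists>C\<ge>0. \<forall>t>0. flat_fun j t \<le> C * t\<^sup>2"
proof (intro exI conjI allI impI)
  fix t :: real assume t: "t > 0"
  define n where "n = j + 2"
  \<comment> \<open>\<open>exp (1/t) = exp (1/(n t)) ^ n\<close> dominates \<open>(1/(n t)) ^ n\<close>.\<close>
  have n: "n > 0" by (simp add: n_def)
  have "1 / t / real n \<le> exp (1 / t / real n)"
    using exp_ge_add_one_self[of "1 / t / real n"] by linarith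
  then have "(1 / t / real n) ^ n \<le> exp (1 / t / real n) ^ n"
    using t by (intro power_mono) auto
  also have "\<dots> = exp (1 / t)"
    using n by (rule exp_divide_power_eq)
  finally have "exp (- 1 / t) \<le> real n ^ n * t ^ n"
    using t n by (simp add: exp_minus field_simps power_divide power_mult_distrib)
  then show "flat_fun j t \<le> real (j + 2) ^ (j + 2) * t\<^sup>2"
    using t by (simp add: flat_fun_def divide_le_eq n_def power_add mult_ac power2_eq_square)
qed simp

lemma flat_fun_has_derivative:
  "(flat_fun j has_real_derivative (flat_fun (j + 2) t - real j * flat_fun (j + 1) t)) (at t)"
proof -
  consider "t > 0" | "t < 0" | "t = 0" by linarith
  then show ?thesis
  proof cases
    case 1
    have "((\<lambda>t. exp (- 1 / t) / t ^ j) has_real_derivative (flat_fun (j + 2) t - real j * flat_fun (j + 1) t)) (at t)"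
    proof -
      have "((\<lambda>t. exp (- 1 / t)) has_real_derivative exp (- 1 / t) / t\<^sup>2) (at t)"
        using 1 by (auto intro!: derivative_eq_intros simp: power2_eq_square)
      from DERIV_divide[OF this DERIV_pow[of j t]]
      have "((\<lambda>t. exp (- 1 / t) / t ^ j) has_real_derivative
          (exp (- 1 / t) / t\<^sup>2 * t ^ j - exp (- 1 / t) * (real j * t ^ (j - Suc 0))) / (t ^ j * t ^ j)) (at t)"
        using 1 by simp
      also have "(exp (- 1 / t) / t\<^sup>2 * t ^ j - exp (- 1 / t) * (real j * t ^ (j - Suc 0))) / (t ^ j * t ^ j) =
          flat_fun (j + 2) t - real j * flat_fun (j + 1) t"
        using 1 by (cases j) (simp_all add: flat_fun_def field_simps power2_eq_square)
      finally show ?thesis .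
    qed
    moreover have "eventually (\<lambda>x. x > 0) (nhds t)"
      using 1 eventually_nhds_in_open[of "{0<..}" t] by simp
    then have "eventually (\<lambda>x. exp (- 1 / x) / x ^ j = flat_fun j x) (nhds t)"
      by eventually_elim (simp add: flat_fun_def)
    ultimately show ?thesis
      by (subst (asm) DERIV_cong_ev[OF refl _ refl]) auto
  next
    case 2
    have "((\<lambda>t. 0) has_real_derivative (flat_fun (j + 2) t - real j * flat_fun (j + 1) t)) (at t)"
      using 2 by simp
    moreover have "eventually (\<lambda>x. x < 0) (nhds t)"
      using 2 eventually_nhds_in_open[of "{..<0}" t] by simp
    then have "eventually (\<lambda>x. 0 = flat_fun j x) (nhds t)"
      by eventually_elim simp
    ultimately show ?thesis
      by (subst (asm) DERIV_cong_ev[OF refl _ refl]) auto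
  next
    case 3
    obtain C where C: "0 \<le> C" "\<And>t. t > 0 \<Longrightarrow> flat_fun j t \<le> C * t\<^sup>2"
      using flat_fun_le[of j] by auto
    have "((\<lambda>h. flat_fun j h / h) \<longlongrightarrow> 0) (at 0)"
    proof (rule Lim_null_comparison)
      have "\<bar>flat_fun j h / h\<bar> \<le> C * \<bar>h\<bar>" for h
      proof (cases "h > 0")
        case True
        moreover have "0 \<le> flat_fun j h" by (simp add: flat_fun_def)
        ultimately show ?thesis using C(2)[OF True]
          by (simp add: divide_le_eq power2_eq_square mult.assoc)
      next
        case False
        have "0 \<le> C * \<bar>h\<bar>" using C(1) by simp
        then show ?thesis using False by (simp only: flat_fun_nonpos not_less)
      qed
      then show "\<forall>\<^sub>F h in at 0. norm (flat_fun j h / h) \<le> C * \<bar>h\<bar>"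
        by simp
      show "((\<lambda>h. C * \<bar>h\<bar>) \<longlongrightarrow> (0::real)) (at 0)"
        by (auto intro!: tendsto_eq_intros)
    qed
    then show ?thesis using 3 by (simp add: DERIV_def)
  qed
qed

text \<open>An algebra of functions containing the modulated cutoffs needed below and closed under directional
  derivatives. Closure gives derivatives of every order at once.\<close>

inductive test_fun :: "('a::euclidean_space \<Rightarrow> real) \<Rightarrow> bool" where
  const: "test_fun (\<lambda>x. c)"
| inner: "test_fun (\<lambda>x. v \<bullet> x)"
| cos: "test_fun (\<lambda>x. cos (v \<bullet> x))"
| sin: "test_fun (\<lambda>x. sin (v \<bullet> x))"
| flat: "test_fun (\<lambda>x. flat_fun j (1 - (x \<bullet> x) / R\<^sup>2))"
| add: "test_fun f \<Longrightarrow> test_fun g \<Longrightarrow> test_fun (\<lambda>x. f x + g x)"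
| mult: "test_fun f \<Longrightarrow> test_fun g \<Longrightarrow> test_fun (\<lambda>x. f x * g x)"

lemma test_fun_derivative:
  assumes "test_fun f"
  shows "\<exists>f'. (\<forall>x. (f has_derivative (\<lambda>v. f' v x)) (at x)) \<and> (\<forall>v. test_fun (f' v))"
  using assms
proof induction
  case (const c)
  show ?case by (rule exI[of _ "\<lambda>v x. 0"]) (auto intro: test_fun.const)
next
  case (inner v)
  show ?case
    by (rule exI[of _ "\<lambda>w x. v \<bullet> w"]) (auto intro!: test_fun.const derivative_eq_intros)
next
  case (cos v)
  show ?case
    by (rule exI[of _ "\<lambda>w x. - (v \<bullet> w) * sin (v \<bullet> x)"], intro conjI allI
        test_fun.mult test_fun.const test_fun.sin) (auto intro!: derivative_eq_intros)
next
  case (sin v)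
  show ?case
    by (rule exI[of _ "\<lambda>w x. (v \<bullet> w) * cos (v \<bullet> x)"])
       (auto intro!: test_fun.const test_fun.mult test_fun.cos derivative_eq_intros)
next
  case (flat j R)
  let ?g = "\<lambda>x::'a. 1 - (x \<bullet> x) / R\<^sup>2"
  let ?F = "\<lambda>w x. (flat_fun (j + 2) (?g x) + - real j * flat_fun (j + 1) (?g x)) * ((- 2 / R\<^sup>2) * (w \<bullet> x))"
  have "((\<lambda>x. flat_fun j (?g x)) has_derivative (\<lambda>w. ?F w x)) (at x)" for x
  proof -
    have "(?g has_derivative (\<lambda>w. (- 2 / R\<^sup>2) * (w \<bullet> x))) (at x)"
      by (cases "R = 0") (auto intro!: derivative_eq_intros simp: fun_eq_iff inner_commute field_simps)
    from has_derivative_compose[OF this flat_fun_has_derivative[of j "?g x", unfolded has_field_derivative_def]]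
    show ?thesis by (simp add: mult_ac)
  qed
  moreover have "test_fun (?F w)" for w
    by (intro test_fun.mult test_fun.add test_fun.flat test_fun.const test_fun.inner)
  ultimately show ?case by (intro exI[of _ ?F]) auto
next
  case (add f g)
  then obtain f' g' where "\<And>x. (f has_derivative (\<lambda>v. f' v x)) (at x)" "\<And>v. test_fun (f' v)"
    "\<And>x. (g has_derivative (\<lambda>v. g' v x)) (at x)" "\<And>v. test_fun (g' v)" by auto
  then show ?case
    by (intro exI[of _ "\<lambda>v x. f' v x + g' v x"]) (auto intro!: test_fun.add derivative_intros)
next
  case (mult f g)
  then obtain f' g' where "\<And>x. (f has_derivative (\<lambda>v. f' v x)) (at x)" "\<And>v. test_fun (f' v)"
    "\<And>x. (g has_derivative (\<lambda>v. g' v x)) (at x)" "\<And>v. test_fun (g' v)" by auto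
  with mult show ?case
    by (intro exI[of _ "\<lambda>v x. f x * g' v x + f' v x * g x"])
       (auto intro!: test_fun.add test_fun.mult derivative_eq_intros)
qed

lemma test_fun_continuous:
  assumes "test_fun f"
  shows "continuous_on UNIV f"
proof -
  obtain f' where "\<And>x. (f has_derivative (\<lambda>v. f' v x)) (at x)"
    using test_fun_derivative[OF assms] by blast
  then show ?thesis
    by (intro has_derivative_continuous_on) (auto intro: has_derivative_at_withinI)
qed

lemma test_fun_measurable: "test_fun f \<Longrightarrow> f \<in> borel_measurable borel"
  by (intro borel_measurable_continuous_onI test_fun_continuous)

lemma test_fun_C_k:
  fixes w :: "'b::real_normed_vector"
  shows "test_fun f \<Longrightarrow> C_k k (\<lambda>x. f x *\<^sub>R w)"
proof (induction k arbitrary: f)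
  case 0
  then show ?case by (auto intro!: continuous_intros test_fun_continuous)
next
  case (Suc k)
  from test_fun_derivative[OF Suc.prems] obtain f' where f': "\<And>x. (f has_derivative (\<lambda>v. f' v x)) (at x)"
    and t: "\<And>v. test_fun (f' v)" by auto
  have D: "((\<lambda>x. f x *\<^sub>R w) has_derivative (\<lambda>v. f' v x *\<^sub>R w)) (at x)" for x
    using f' by (auto intro!: derivative_eq_intros)
  then have "frechet_derivative (\<lambda>x. f x *\<^sub>R w) (at x) = (\<lambda>v. f' v x *\<^sub>R w)" for x
    using frechet_derivative_at by metis
  with D Suc.IH[OF t] show ?case by (auto simp: differentiable_def)
qed

text \<open>The factor \<open>exp 1\<close> normalises the value at the origin to \<open>1\<close>. The cutoffs are not constant near the
  origin, but as \<open>R\<close> grows they tend to \<open>1\<close> pointwise, which together with a uniform Lipschitz bound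
  suffices for the limits below.\<close>

definition cutoff :: "real \<Rightarrow> 'a::euclidean_space \<Rightarrow> real" where
  "cutoff R x = exp 1 * flat_fun 0 (1 - (x \<bullet> x) / R\<^sup>2)"

lemma cutoff_test_fun: "test_fun (cutoff R)"
  unfolding cutoff_def[abs_def] by (intro test_fun.mult test_fun.const test_fun.flat)

lemma flat_fun_0_bounds: "0 \<le> flat_fun 0 t" "t \<le> 1 \<Longrightarrow> flat_fun 0 t \<le> exp (- 1)"
  by (auto simp: flat_fun_def field_simps)

lemma cutoff_bounds: "0 \<le> cutoff R x" "cutoff R x \<le> 1"
proof -
  have "1 - (x \<bullet> x) / R\<^sup>2 \<le> 1" by simp
  then have "exp 1 * flat_fun 0 (1 - (x \<bullet> x) / R\<^sup>2) \<le> exp 1 * exp (- 1)"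
    by (intro mult_left_mono flat_fun_0_bounds) auto
  then show "cutoff R x \<le> 1" by (simp add: cutoff_def exp_minus)
  show "0 \<le> cutoff R x" by (simp add: cutoff_def flat_fun_0_bounds)
qed

lemma cutoff_outside:
  assumes "R > 0" "norm x \<ge> R"
  shows "cutoff R x = 0"
proof -
  have "R\<^sup>2 \<le> (norm x)\<^sup>2" using assms by (intro power_mono) auto
  then have "1 - (x \<bullet> x) / R\<^sup>2 \<le> 0" using assms by (simp add: power2_norm_eq_inner)
  then show ?thesis by (simp add: cutoff_def)
qed

lemma cutoff_tendsto: "(\<lambda>m. cutoff (real (Suc m)) x) \<longlonglongrightarrow> 1"
proof -
  have c: "isCont (flat_fun 0) 1"
    by (rule DERIV_isCont[OF flat_fun_has_derivative])
  have "(\<lambda>m. 1 / real (Suc m)) \<longlonglongrightarrow> 0" by (rule LIMSEQ_Suc[OF lim_1_over_n])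
  then have "(\<lambda>m. 1 - (x \<bullet> x) * (1 / real (Suc m))\<^sup>2) \<longlonglongrightarrow> 1 - (x \<bullet> x) * 0\<^sup>2"
    by (intro tendsto_intros)
  then have "(\<lambda>m. flat_fun 0 (1 - (x \<bullet> x) * (1 / real (Suc m))\<^sup>2)) \<longlonglongrightarrow> flat_fun 0 1"
    by (intro isCont_tendsto_compose[OF c]) simp
  then have "(\<lambda>m. exp 1 * flat_fun 0 (1 - (x \<bullet> x) * (1 / real (Suc m))\<^sup>2)) \<longlonglongrightarrow> exp 1 * flat_fun 0 1"
    by (intro tendsto_intros)
  then show ?thesis by (simp add: cutoff_def flat_fun_def exp_minus power_divide)
qed

text \<open>The Lipschitz constant is uniform in \<open>R \<ge> 1\<close>, which provides the dominating functions for the limit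
  \<open>R \<rightarrow> \<infinity>\<close> in the nonlocal divergence.\<close>

lemma cutoff_lipschitz:
  "\<exists>L\<ge>0. \<forall>R\<ge>1. \<forall>x y :: 'a::euclidean_space. \<bar>cutoff R x - cutoff R y\<bar> \<le> L * norm (x - y)"
proof -
  have "bounded (flat_fun 2 ` {0..1})"
  proof -
    have "continuous_on {0..1} (flat_fun 2)"
      using flat_fun_has_derivative by (intro continuous_at_imp_continuous_on ballI DERIV_isCont) blast
    then have "compact (flat_fun 2 ` {0..1})" by (intro compact_continuous_image) auto
    then show ?thesis by (rule compact_imp_bounded)
  qed
  then obtain M where M: "\<And>t. t \<in> {0..1} \<Longrightarrow> \<bar>flat_fun 2 t\<bar> \<le> M"
    by (fastforce simp: bounded_iff)
  have M0: "0 \<le> M" using M[of 0] by (simp add: order_trans[OF abs_ge_zero])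
  have lip: "norm (cutoff R x - cutoff R y) \<le> exp 1 * M * 2 * norm (x - y)" if R: "R \<ge> 1" for R and x y :: 'a
  proof -
    let ?g = "\<lambda>x::'a. 1 - (x \<bullet> x) / R\<^sup>2"
    have D: "(cutoff R has_derivative (\<lambda>w. exp 1 * (flat_fun 2 (?g x) * ((- 2 / R\<^sup>2) * (w \<bullet> x))))) (at x within UNIV)" for x :: 'a
    proof -
      have "(?g has_derivative (\<lambda>w. (- 2 / R\<^sup>2) * (w \<bullet> x))) (at x)"
        using R by (auto intro!: derivative_eq_intros simp: fun_eq_iff inner_commute field_simps)
      from has_derivative_compose[OF this flat_fun_has_derivative[of 0 "?g x", unfolded has_field_derivative_def]]
      have "((\<lambda>x. flat_fun 0 (?g x)) has_derivative (\<lambda>w. flat_fun 2 (?g x) * ((- 2 / R\<^sup>2) * (w \<bullet> x)))) (at x)"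
        by (simp add: mult_ac numeral_2_eq_2)
      then show ?thesis
        unfolding cutoff_def[abs_def] by (intro has_derivative_mult_right) simp
    qed
    have bd: "onorm (\<lambda>w. exp 1 * (flat_fun 2 (?g z) * ((- 2 / R\<^sup>2) * (w \<bullet> z)))) \<le> exp 1 * M * 2" for z
    proof (rule onorm_le)
      fix w :: 'a
      have "\<bar>flat_fun 2 (?g z)\<bar> * (norm z / R\<^sup>2) \<le> M"
      proof (cases "norm z \<le> R")
        case True
        then have "z \<bullet> z \<le> R\<^sup>2" using R by (simp add: power2_norm_eq_inner[symmetric] power_mono)
        then have "\<bar>flat_fun 2 (?g z)\<bar> \<le> M" using R by (intro M) (auto simp: divide_le_eq)
        moreover have "norm z / R\<^sup>2 \<le> 1"
        proof -
          have "R \<le> R * R" using R mult_left_mono[of 1 R R] by simp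
          with True have "norm z \<le> R * R" by linarith
          then show ?thesis using R by (simp add: divide_le_eq power2_eq_square)
        qed
        ultimately show ?thesis using M0 mult_mono[of "\<bar>flat_fun 2 (?g z)\<bar>" M "norm z / R\<^sup>2" 1] by simp
      next
        case False
        then have "R\<^sup>2 \<le> (norm z)\<^sup>2" using R by (intro power_mono) auto
        then have "?g z \<le> 0" using R by (simp add: power2_norm_eq_inner)
        then show ?thesis using M0 by simp
      qed
      then have "(exp 1 * 2) * ((\<bar>flat_fun 2 (?g z)\<bar> * (norm z / R\<^sup>2)) * norm w) \<le> (exp 1 * 2) * (M * norm w)"
        by (intro mult_left_mono mult_right_mono) auto
      moreover have "\<bar>w \<bullet> z\<bar> \<le> norm w * norm z" by (rule Cauchy_Schwarz_ineq2)
      then have "(exp 1 * 2 * \<bar>flat_fun 2 (?g z)\<bar> / R\<^sup>2) * \<bar>w \<bullet> z\<bar>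
          \<le> (exp 1 * 2 * \<bar>flat_fun 2 (?g z)\<bar> / R\<^sup>2) * (norm w * norm z)"
        by (intro mult_left_mono) auto
      ultimately show "norm (exp 1 * (flat_fun 2 (?g z) * ((- 2 / R\<^sup>2) * (w \<bullet> z)))) \<le> exp 1 * M * 2 * norm w"
        by (simp add: abs_mult mult_ac)
    qed
    have "norm (cutoff R x - cutoff R y) \<le> (exp 1 * M * 2) * norm (x - y)"
      by (rule differentiable_bound[OF convex_UNIV D bd]) auto
    then show ?thesis by simp
  qed
  show ?thesis
    by (rule exI[of _ "exp 1 * M * 2"]) (use lip M0 in auto)
qed

section \<open>The nonlocal gradient as a Fourier multiplier\<close>

text \<open>The nonlocal divergence of the field \<open>\<phi> v\<close> with constant direction \<open>v\<close>, after the substitution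
  \<open>y = x - z\<close>.\<close>

definition scalar_div :: "(real \<Rightarrow> real) \<Rightarrow> ('a \<Rightarrow> real) \<Rightarrow> 'a \<Rightarrow> 'a::euclidean_space \<Rightarrow> real" where
  "scalar_div f \<phi> v x = (LBINT z. (\<phi> x - \<phi> (x - z)) * (v \<bullet> z) * radial_weight f z)"

lemma cutoff_measurable [measurable]: "cutoff R \<in> borel_measurable borel"
  by (rule test_fun_measurable[OF cutoff_test_fun])

lemma (in radial_profile) scalar_div_integrable:
  fixes v :: "'a"
  assumes [measurable]: "\<phi> \<in> borel_measurable borel"
    and lip: "\<And>x y. \<bar>\<phi> x - \<phi> y\<bar> \<le> K * norm (x - y)"
  shows "\<bar>(\<phi> x - \<phi> (x - z)) * (v \<bullet> z) * radial_weight f z\<bar> \<le> K * norm v * ((norm z)\<^sup>2 * radial_weight f z)"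
    and "integrable lborel (\<lambda>z. (\<phi> x - \<phi> (x - z)) * (v \<bullet> z) * radial_weight f z)"
    and "\<bar>scalar_div f \<phi> v x\<bar> \<le> K * norm v * (\<integral>z. (norm z)\<^sup>2 * radial_weight f z \<partial>(lborel :: 'a measure))"
proof -
  show bd: "\<bar>(\<phi> x - \<phi> (x - z)) * (v \<bullet> z) * radial_weight f z\<bar> \<le> K * norm v * ((norm z)\<^sup>2 * radial_weight f z)" for z
  proof -
    have "\<bar>\<phi> x - \<phi> (x - z)\<bar> * \<bar>v \<bullet> z\<bar> \<le> (K * norm z) * (norm v * norm z)"
      using lip[of x "x - z"] order_trans[OF abs_ge_zero lip[of x "x - z"]]
      by (intro mult_mono Cauchy_Schwarz_ineq2) auto
    from mult_right_mono[OF this weight_nonneg[of z]] show ?thesis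
      using weight_nonneg[of z] by (simp add: abs_mult power2_eq_square mult_ac)
  qed
  have i: "integrable lborel (\<lambda>z::'a. K * norm v * ((norm z)\<^sup>2 * radial_weight f z))"
    using int by simp
  show ii: "integrable lborel (\<lambda>z. (\<phi> x - \<phi> (x - z)) * (v \<bullet> z) * radial_weight f z)"
    by (rule Bochner_Integration.integrable_bound[OF i]) (auto intro!: AE_I2 order_trans[OF bd])
  have "\<bar>scalar_div f \<phi> v x\<bar> \<le> (LBINT z. \<bar>(\<phi> x - \<phi> (x - z)) * (v \<bullet> z) * radial_weight f z\<bar>)"
    unfolding scalar_div_def by (rule integral_abs_bound)
  also have "\<dots> \<le> (\<integral>z. K * norm v * ((norm z)\<^sup>2 * radial_weight f z) \<partial>(lborel :: 'a measure))"
    using ii i bd by (intro integral_mono) auto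
  finally show "\<bar>scalar_div f \<phi> v x\<bar> \<le> K * norm v * (\<integral>z. (norm z)\<^sup>2 * radial_weight f z \<partial>(lborel :: 'a measure))"
    by simp
qed

lemma lborel_reflect_integral:
  fixes g :: "'a::euclidean_space \<Rightarrow> real"
  assumes "g \<in> borel_measurable borel"
  shows "(LBINT x. g (a - x)) = (LBINT x. g x)"
  using lborel_affine_integral(1)[OF assms, of "-1" a] by simp

text \<open>The integrand is odd.\<close>

lemma (in radial_profile) cos_minus_one_moment_eq_0:
  fixes v :: "'a"
  shows "(LBINT z. (1 - cos (\<xi> \<bullet> z)) * (v \<bullet> z) * radial_weight f z) = 0"
proof -
  have "(LBINT z. (1 - cos (\<xi> \<bullet> z)) * (v \<bullet> z) * radial_weight f z) =
      (LBINT z. (1 - cos (\<xi> \<bullet> (0 - z))) * (v \<bullet> (0 - z)) * radial_weight f (0 - z))"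
    by (rule lborel_reflect_integral[symmetric]) measurable
  also have "\<dots> = - (LBINT z. (1 - cos (\<xi> \<bullet> z)) * (v \<bullet> z) * radial_weight f z)"
    by (simp add: radial_weight_def flip: integral_minus)
  finally show ?thesis by simp
qed

lemma trig_lipschitz:
  fixes \<xi> :: "'a::euclidean_space"
  shows "\<bar>cos (\<xi> \<bullet> x) - cos (\<xi> \<bullet> y)\<bar> \<le> norm \<xi> * norm (x - y)"
    and "\<bar>sin (\<xi> \<bullet> x) - sin (\<xi> \<bullet> y)\<bar> \<le> norm \<xi> * norm (x - y)"
proof -
  have le: "2 * (a * \<bar>sin ((\<xi> \<bullet> x - \<xi> \<bullet> y) / 2)\<bar>) \<le> norm \<xi> * norm (x - y)" if "0 \<le> a" "a \<le> 1" for a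
  proof -
    have "2 * (a * \<bar>sin ((\<xi> \<bullet> x - \<xi> \<bullet> y) / 2)\<bar>) \<le> 2 * (1 * \<bar>(\<xi> \<bullet> x - \<xi> \<bullet> y) / 2\<bar>)"
      using that by (intro mult_left_mono mult_mono abs_sin_x_le_abs_x) auto
    also have "\<dots> = \<bar>\<xi> \<bullet> (x - y)\<bar>" by (simp add: inner_diff_right)
    also have "\<dots> \<le> norm \<xi> * norm (x - y)" by (rule Cauchy_Schwarz_ineq2)
    finally show ?thesis .
  qed
  have "\<bar>cos (\<xi> \<bullet> x) - cos (\<xi> \<bullet> y)\<bar> = 2 * (\<bar>sin ((\<xi> \<bullet> x + \<xi> \<bullet> y) / 2)\<bar> * \<bar>sin ((\<xi> \<bullet> y - \<xi> \<bullet> x) / 2)\<bar>)"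
    by (simp add: cos_diff_cos abs_mult)
  also have "\<bar>sin ((\<xi> \<bullet> y - \<xi> \<bullet> x) / 2)\<bar> = \<bar>sin ((\<xi> \<bullet> x - \<xi> \<bullet> y) / 2)\<bar>"
  proof -
    have "(\<xi> \<bullet> y - \<xi> \<bullet> x) / 2 = - ((\<xi> \<bullet> x - \<xi> \<bullet> y) / 2)" by (simp add: field_simps)
    then show ?thesis by (simp only: sin_minus abs_minus_cancel)
  qed
  finally show "\<bar>cos (\<xi> \<bullet> x) - cos (\<xi> \<bullet> y)\<bar> \<le> norm \<xi> * norm (x - y)"
    using le[of "\<bar>sin ((\<xi> \<bullet> x + \<xi> \<bullet> y) / 2)\<bar>"] by simp
  have "\<bar>sin (\<xi> \<bullet> x) - sin (\<xi> \<bullet> y)\<bar> = 2 * (\<bar>cos ((\<xi> \<bullet> x + \<xi> \<bullet> y) / 2)\<bar> * \<bar>sin ((\<xi> \<bullet> x - \<xi> \<bullet> y) / 2)\<bar>)"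
    by (simp add: sin_diff_sin abs_mult mult_ac)
  then show "\<bar>sin (\<xi> \<bullet> x) - sin (\<xi> \<bullet> y)\<bar> \<le> norm \<xi> * norm (x - y)"
    using le[of "\<bar>cos ((\<xi> \<bullet> x + \<xi> \<bullet> y) / 2)\<bar>"] by simp
qed

text \<open>By the addition theorems the difference \<open>cos (\<xi> \<bullet> x) - cos (\<xi> \<bullet> (x - z))\<close> splits into a part even
  in \<open>z\<close>, which is annihilated by the odd factor \<open>v \<bullet> z\<close>, and a part odd in \<open>z\<close>, which gives the symbol;
  likewise for the sine.\<close>

lemma (in radial_profile) scalar_div_trig:
  fixes v \<xi> :: "'a"
  shows "scalar_div f (\<lambda>x. cos (\<xi> \<bullet> x)) v x = - sin (\<xi> \<bullet> x) * (kernel_symbol f \<xi> \<bullet> v)"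
    and "scalar_div f (\<lambda>x. sin (\<xi> \<bullet> x)) v x = cos (\<xi> \<bullet> x) * (kernel_symbol f \<xi> \<bullet> v)"
proof -
  have si: "integrable lborel (\<lambda>z. (sin (\<xi> \<bullet> z) * radial_weight f z) *\<^sub>R z)"
    by (rule symbol_integrand_integrable(2))
  have i2: "integrable lborel (\<lambda>z. sin (\<xi> \<bullet> z) * (v \<bullet> z) * radial_weight f z)"
    using integrable_inner_left[OF si, of v] by (simp add: inner_commute mult_ac)
  have e2: "(LBINT z. sin (\<xi> \<bullet> z) * (v \<bullet> z) * radial_weight f z) = kernel_symbol f \<xi> \<bullet> v"
    using integral_inner_left[OF si, of v] by (simp add: kernel_symbol_def inner_commute mult_ac)
  note lipc = trig_lipschitz(1)[of \<xi>]
  have i1: "integrable lborel (\<lambda>z. (1 - cos (\<xi> \<bullet> z)) * (v \<bullet> z) * radial_weight f z)"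
  proof -
    have "integrable lborel (\<lambda>z. (cos (\<xi> \<bullet> 0) - cos (\<xi> \<bullet> (0 - z))) * (v \<bullet> z) * radial_weight f z)"
      by (rule scalar_div_integrable(2)[OF _ lipc]) auto
    then show ?thesis by simp
  qed
  have "scalar_div f (\<lambda>x. cos (\<xi> \<bullet> x)) v x =
     (LBINT z. cos (\<xi> \<bullet> x) * ((1 - cos (\<xi> \<bullet> z)) * (v \<bullet> z) * radial_weight f z) - sin (\<xi> \<bullet> x) * (sin (\<xi> \<bullet> z) * (v \<bullet> z) * radial_weight f z))"
    unfolding scalar_div_def by (intro Bochner_Integration.integral_cong) (simp_all add: inner_diff_right cos_diff algebra_simps)
  also have "\<dots> = - sin (\<xi> \<bullet> x) * (kernel_symbol f \<xi> \<bullet> v)"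
    using i1 i2 e2 cos_minus_one_moment_eq_0[of \<xi> v] by simp
  finally show "scalar_div f (\<lambda>x. cos (\<xi> \<bullet> x)) v x = - sin (\<xi> \<bullet> x) * (kernel_symbol f \<xi> \<bullet> v)" .
  have "scalar_div f (\<lambda>x. sin (\<xi> \<bullet> x)) v x =
     (LBINT z. sin (\<xi> \<bullet> x) * ((1 - cos (\<xi> \<bullet> z)) * (v \<bullet> z) * radial_weight f z)
         + cos (\<xi> \<bullet> x) * (sin (\<xi> \<bullet> z) * (v \<bullet> z) * radial_weight f z))"
    unfolding scalar_div_def by (intro Bochner_Integration.integral_cong) (simp_all add: inner_diff_right sin_diff algebra_simps)
  also have "\<dots> = cos (\<xi> \<bullet> x) * (kernel_symbol f \<xi> \<bullet> v)"
    using i1 i2 e2 cos_minus_one_moment_eq_0[of \<xi> v] by simp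
  finally show "scalar_div f (\<lambda>x. sin (\<xi> \<bullet> x)) v x = cos (\<xi> \<bullet> x) * (kernel_symbol f \<xi> \<bullet> v)" .
qed

lemma (in radial_profile) scalar_div_measurable:
  fixes v :: "'a"
  assumes [measurable]: "\<phi> \<in> borel_measurable borel"
  shows "scalar_div f \<phi> v \<in> borel_measurable borel"
proof -
  show ?thesis unfolding scalar_div_def[abs_def] by measurable
qed

lemma (in radial_profile) scalar_div_cutoff_tendsto:
  fixes v :: "'a"
  assumes p[measurable]: "p \<in> borel_measurable borel" and p1: "\<And>x. \<bar>p x\<bar> \<le> 1"
    and plip: "\<And>x y. \<bar>p x - p y\<bar> \<le> K * norm (x - y)"
    and u: "integrable lborel u"
  shows "(\<lambda>m. \<integral>x. u x * scalar_div f (\<lambda>x. cutoff (real (Suc m)) x * p x) v x \<partial>lborel)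
           \<longlonglongrightarrow> (LBINT x. u x * scalar_div f p v x)"
proof -
  obtain L where L: "0 \<le> L" "\<And>R x y :: 'a. R \<ge> 1 \<Longrightarrow> \<bar>cutoff R x - cutoff R y\<bar> \<le> L * norm (x - y)"
    using cutoff_lipschitz[where 'a='a] by blast
  define q where "q m x = cutoff (real (Suc m)) x * p x" for m and x :: 'a
  have qm [measurable]: "q m \<in> borel_measurable borel" for m
    unfolding q_def[abs_def] by measurable
  have qlip: "\<bar>q m x - q m y\<bar> \<le> (L + K) * norm (x - y)" for m x y
  proof -
    let ?R = "real (Suc m)"
    have "q m x - q m y = (cutoff ?R x - cutoff ?R y) * p x + cutoff ?R y * (p x - p y)"
      by (simp add: q_def algebra_simps)
    then have "\<bar>q m x - q m y\<bar> \<le> \<bar>cutoff ?R x - cutoff ?R y\<bar> * \<bar>p x\<bar> + \<bar>cutoff ?R y\<bar> * \<bar>p x - p y\<bar>"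
      by (metis abs_mult abs_triangle_ineq)
    also have "\<dots> \<le> (L * norm (x - y)) * 1 + 1 * (K * norm (x - y))"
      using L(1) L(2)[of ?R x y] p1[of x] plip[of x y] cutoff_bounds[of ?R y]
      by (intro add_mono mult_mono) auto
    finally show ?thesis by (simp add: algebra_simps)
  qed
  note sd = scalar_div_integrable[OF qm qlip]
  have lim: "(\<lambda>m. scalar_div f (q m) v x) \<longlonglongrightarrow> scalar_div f p v x" for x
    unfolding scalar_div_def
  proof (rule integral_dominated_convergence[where w="\<lambda>z. (L + K) * norm v * ((norm z)\<^sup>2 * radial_weight f z)"])
    have ql: "(\<lambda>m. q m y) \<longlonglongrightarrow> p y" for y
      using tendsto_mult_right[OF cutoff_tendsto[of y], of "p y"] by (simp add: q_def)
    show "AE z in lborel. (\<lambda>m. (q m x - q m (x - z)) * (v \<bullet> z) * radial_weight f z)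
        \<longlonglongrightarrow> (p x - p (x - z)) * (v \<bullet> z) * radial_weight f z"
      by (intro AE_I2 tendsto_intros ql)
    show "AE z in lborel. norm ((q m x - q m (x - z)) * (v \<bullet> z) * radial_weight f z)
        \<le> (L + K) * norm v * ((norm z)\<^sup>2 * radial_weight f z)" for m
      using sd(1)[where v=v] by simp
    show "integrable lborel (\<lambda>z::'a. (L + K) * norm v * ((norm z)\<^sup>2 * radial_weight f z))"
      using int by simp
    show "(\<lambda>z. (q m x - q m (x - z)) * (v \<bullet> z) * radial_weight f z) \<in> borel_measurable lborel" for m
      by measurable
    show "(\<lambda>z. (p x - p (x - z)) * (v \<bullet> z) * radial_weight f z) \<in> borel_measurable lborel"
      by measurable
  qed
  define C where "C = (L + K) * norm v * (\<integral>z. (norm z)\<^sup>2 * radial_weight f z \<partial>(lborel :: 'a measure))"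
  have "(\<lambda>m. \<integral>x. u x * scalar_div f (q m) v x \<partial>lborel) \<longlonglongrightarrow> (LBINT x. u x * scalar_div f p v x)"
  proof (rule integral_dominated_convergence[where w="\<lambda>x. \<bar>u x\<bar> * C"])
    note [measurable] = scalar_div_measurable borel_measurable_integrable[OF u]
    show "AE x in lborel. (\<lambda>m. u x * scalar_div f (q m) v x) \<longlonglongrightarrow> u x * scalar_div f p v x"
      by (intro AE_I2 tendsto_intros lim)
    show "AE x in lborel. norm (u x * scalar_div f (q m) v x) \<le> \<bar>u x\<bar> * C" for m
      using sd(3)[of m v] by (auto intro!: AE_I2 mult_left_mono simp: abs_mult C_def)
    show "integrable lborel (\<lambda>x. \<bar>u x\<bar> * C)" using u by simp
    show "(\<lambda>x. u x * scalar_div f (q m) v x) \<in> borel_measurable lborel" for m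
      by measurable
    show "(\<lambda>x. u x * scalar_div f p v x) \<in> borel_measurable lborel"
      by measurable
  qed
  then show ?thesis by (simp add: q_def[abs_def])
qed

lemma abs_le_power2_plus_1: "\<bar>a\<bar> \<le> a\<^sup>2 + 1" for a :: real
  using zero_le_power2[of "\<bar>a\<bar> - 1"] zero_le_power2[of a] by (simp add: power2_diff)

lemma ft_Re_Im:
  assumes "integrable lborel u"
  shows "Re (ft u \<xi>) = (LBINT x. u x * cos (\<xi> \<bullet> x))" "Im (ft u \<xi>) = (LBINT x. u x * sin (\<xi> \<bullet> x))"
  unfolding ft_def using integral_Re[OF ft_integrand[OF assms, of \<xi>]] integral_Im[OF ft_integrand[OF assms, of \<xi>]]
  by simp_all

lemma cutoff_mult_integrable:
  fixes g :: "'a::euclidean_space \<Rightarrow> real"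
  assumes [measurable]: "g \<in> borel_measurable borel" and g2: "integrable lborel (\<lambda>x. (g x)\<^sup>2)" and R: "R > 0"
  shows "integrable lborel (\<lambda>x. g x * cutoff R x)" "integrable lborel (\<lambda>x. (g x * cutoff R x)\<^sup>2)"
    "(LBINT x. (g x * cutoff R x)\<^sup>2) \<le> (LBINT x. (g x)\<^sup>2)"
proof -
  have le2: "(g x * cutoff R x)\<^sup>2 \<le> (g x)\<^sup>2" for x
  proof -
    have "(cutoff R x)\<^sup>2 \<le> 1" using cutoff_bounds[of R x] by (intro power_le_one)
    then show ?thesis unfolding power_mult_distrib by (intro mult_left_le) auto
  qed
  show i2: "integrable lborel (\<lambda>x. (g x * cutoff R x)\<^sup>2)"
    by (rule Bochner_Integration.integrable_bound[OF g2]) (use le2 in auto)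
  show "(LBINT x. (g x * cutoff R x)\<^sup>2) \<le> (LBINT x. (g x)\<^sup>2)"
    by (rule integral_mono[OF i2 g2 le2])
  show "integrable lborel (\<lambda>x. g x * cutoff R x)"
  proof (rule Bochner_Integration.integrable_bound)
    show "integrable lborel (\<lambda>x. (g x * cutoff R x)\<^sup>2 + indicator (ball 0 R) x)"
      using i2 emeasure_bounded_finite[of "ball (0::'a) R"]
      by (intro Bochner_Integration.integrable_add integrable_real_indicator) auto
    have "\<bar>g x * cutoff R x\<bar> \<le> (g x * cutoff R x)\<^sup>2 + indicator (ball 0 R) x" for x
    proof (cases "norm x < R")
      case True
      then show ?thesis using abs_le_power2_plus_1[of "g x * cutoff R x"] by simp
    qed (simp add: cutoff_outside R)
    then show "AE x in lborel. norm (g x * cutoff R x) \<le> norm ((g x * cutoff R x)\<^sup>2 + indicator (ball 0 R) x)"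
      by (intro AE_I2) (simp add: order_trans[OF _ abs_ge_self])
  qed measurable
qed

lemma (in radial_profile) kernel_symbol_measurable [measurable]:
  "(kernel_symbol f :: 'a \<Rightarrow> 'a) \<in> borel_measurable borel"
  unfolding kernel_symbol_def[abs_def] by measurable

text \<open>Testing the weak gradient against \<open>v\<close> times a cutoff of \<open>cos (\<xi> \<bullet> x)\<close> or \<open>sin (\<xi> \<bullet> x)\<close> and letting
  the cutoff radius grow shows that \<open>ft (\<chi>\<^sub>R g) \<xi>\<close> tends to \<open>-\<i> (kernel_symbol f \<xi> \<bullet> v) ft u \<xi>\<close>. By
  Plancherel the \<open>L\<^sup>2\<close> norms of the former are at most that of \<open>g\<close>, and the inequality survives the limit
  by Fatou. Working with \<open>\<chi>\<^sub>R g\<close> avoids any statement about the support or the integrability of \<open>g\<close>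
  itself.\<close>

lemma (in radial_profile) symbol_ft_bound_direction:
  fixes v :: "'a" and u g :: "'a \<Rightarrow> real"
  assumes u: "integrable lborel u"
    and [measurable]: "g \<in> borel_measurable borel" and g2: "integrable lborel (\<lambda>x. (g x)\<^sup>2)"
    and weak: "\<And>\<phi> R. test_fun \<phi> \<Longrightarrow> (\<And>x. norm x \<ge> R \<Longrightarrow> \<phi> x = 0) \<Longrightarrow>
        - (LBINT x. u x * scalar_div f \<phi> v x) = (LBINT x. g x * \<phi> x)"
  shows "(\<integral>\<^sup>+\<xi>. ennreal ((kernel_symbol f \<xi> \<bullet> v)\<^sup>2 * (norm (ft u \<xi>))\<^sup>2) \<partial>lborel)
    \<le> ennreal ((2 * pi) ^ DIM('a) * (LBINT x. (g x)\<^sup>2))"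
proof -
  define G where "G m x = g x * cutoff (real (Suc m)) x" for m x
  have Gi: "integrable lborel (G m)" for m unfolding G_def by (rule cutoff_mult_integrable[OF _ g2]) auto
  have G2: "integrable lborel (\<lambda>x. (G m x)\<^sup>2)" for m unfolding G_def by (rule cutoff_mult_integrable[OF _ g2]) auto
  have Gle: "(LBINT x. (G m x)\<^sup>2) \<le> (LBINT x. (g x)\<^sup>2)" for m
    unfolding G_def by (rule cutoff_mult_integrable[OF _ g2]) auto
  have trig: "(LBINT x. G m x * p x) = - (LBINT x. u x * scalar_div f (\<lambda>x. cutoff (real (Suc m)) x * p x) v x)"
    if "test_fun p" for m p
  proof -
    have "- (LBINT x. u x * scalar_div f (\<lambda>x. cutoff (real (Suc m)) x * p x) v x)
        = (LBINT x. g x * (cutoff (real (Suc m)) x * p x))"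
      using cutoff_outside[of "real (Suc m)"]
      by (intro weak[of _ "real (Suc m)"] test_fun.mult cutoff_test_fun that) auto
    then show ?thesis by (simp add: G_def mult.assoc)
  qed
  have lim: "(\<lambda>m. (norm (ft (G m) \<xi>))\<^sup>2) \<longlonglongrightarrow> (kernel_symbol f \<xi> \<bullet> v)\<^sup>2 * (norm (ft u \<xi>))\<^sup>2" for \<xi>
  proof -
    let ?L = "kernel_symbol f \<xi> \<bullet> v"
    have div: "scalar_div f (\<lambda>x. cos (\<xi> \<bullet> x)) v x = - sin (\<xi> \<bullet> x) * ?L"
      "scalar_div f (\<lambda>x. sin (\<xi> \<bullet> x)) v x = cos (\<xi> \<bullet> x) * ?L" for x
      by (rule scalar_div_trig; assumption)+
    have "(\<lambda>m. \<integral>x. G m x * cos (\<xi> \<bullet> x) \<partial>lborel) \<longlonglongrightarrow> - (LBINT x. u x * scalar_div f (\<lambda>x. cos (\<xi> \<bullet> x)) v x)"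
      unfolding trig[OF test_fun.cos]
      by (intro tendsto_minus scalar_div_cutoff_tendsto[OF _ _ trig_lipschitz(1) u]) auto
    then have re: "(\<lambda>m. Re (ft (G m) \<xi>)) \<longlonglongrightarrow> ?L * Im (ft u \<xi>)"
      unfolding ft_Re_Im(1)[OF Gi] ft_Re_Im(2)[OF u] div(1)
      by (simp add: mult_ac flip: integral_minus integral_mult_right_zero)
    have "(\<lambda>m. \<integral>x. G m x * sin (\<xi> \<bullet> x) \<partial>lborel) \<longlonglongrightarrow> - (LBINT x. u x * scalar_div f (\<lambda>x. sin (\<xi> \<bullet> x)) v x)"
      unfolding trig[OF test_fun.sin]
      by (intro tendsto_minus scalar_div_cutoff_tendsto[OF _ _ trig_lipschitz(2) u]) auto
    then have im: "(\<lambda>m. Im (ft (G m) \<xi>)) \<longlonglongrightarrow> - (?L * Re (ft u \<xi>))"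
      unfolding ft_Re_Im(2)[OF Gi] ft_Re_Im(1)[OF u] div(2)
      by (simp add: mult_ac flip: integral_mult_right_zero)
    have "(\<lambda>m. (Re (ft (G m) \<xi>))\<^sup>2 + (Im (ft (G m) \<xi>))\<^sup>2) \<longlonglongrightarrow> (?L * Im (ft u \<xi>))\<^sup>2 + (- (?L * Re (ft u \<xi>)))\<^sup>2"
      by (intro tendsto_add tendsto_power re im)
    then show ?thesis
      unfolding cmod_power2 by (simp add: power_mult_distrib distrib_left add.commute)
  qed
  have [measurable]: "G m \<in> borel_measurable borel" for m using Gi[of m] by auto
  have "(\<integral>\<^sup>+\<xi>. ennreal ((kernel_symbol f \<xi> \<bullet> v)\<^sup>2 * (norm (ft u \<xi>))\<^sup>2) \<partial>lborel) =
      (\<integral>\<^sup>+\<xi>. liminf (\<lambda>m. ennreal ((norm (ft (G m) \<xi>))\<^sup>2)) \<partial>lborel)"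
    by (intro nn_integral_cong lim_imp_Liminf[symmetric] tendsto_ennrealI lim) auto
  also have "\<dots> \<le> liminf (\<lambda>m. \<integral>\<^sup>+\<xi>. ennreal ((norm (ft (G m) \<xi>))\<^sup>2) \<partial>lborel)"
    by (rule nn_integral_liminf) measurable
  also have "\<dots> \<le> ennreal ((2 * pi) ^ DIM('a) * (LBINT x. (g x)\<^sup>2))"
  proof (rule Liminf_le)
    show "\<forall>\<^sub>F m in sequentially. (\<integral>\<^sup>+\<xi>. ennreal ((norm (ft (G m) \<xi>))\<^sup>2) \<partial>lborel)
        \<le> ennreal ((2 * pi) ^ DIM('a) * (LBINT x. (g x)\<^sup>2))"
      using Gle by (intro always_eventually allI) (simp add: plancherel[OF Gi G2] ennreal_leI)
  qed simp
  finally show ?thesis .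
qed

section \<open>Poincare inequality and compactness on the Fourier side\<close>

lemma square_integrable_diff:
  fixes v w :: "'a \<Rightarrow> real"
  assumes [measurable]: "v \<in> borel_measurable N" "w \<in> borel_measurable N"
    and "integrable N (\<lambda>x. (v x)\<^sup>2)" "integrable N (\<lambda>x. (w x)\<^sup>2)"
  shows "integrable N (\<lambda>x. (v x - w x)\<^sup>2)"
proof (rule Bochner_Integration.integrable_bound)
  show "integrable N (\<lambda>x. 2 * (v x)\<^sup>2 + 2 * (w x)\<^sup>2)" using assms by simp
  show "AE x in N. norm ((v x - w x)\<^sup>2) \<le> norm (2 * (v x)\<^sup>2 + 2 * (w x)\<^sup>2)"
    using power2_diff_le by (intro AE_I2) (simp add: order_trans[OF _ abs_ge_self])
qed measurable

lemma square_integrable_bounded_support_integrable: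
  fixes w :: "'a::euclidean_space \<Rightarrow> real"
  assumes [measurable]: "w \<in> borel_measurable borel" and w2: "integrable lborel (\<lambda>x. (w x)\<^sup>2)"
    and supp: "\<And>x. x \<notin> ball 0 R \<Longrightarrow> w x = 0"
  shows "integrable lborel w"
proof (rule Bochner_Integration.integrable_bound)
  show "integrable lborel (\<lambda>x. (w x)\<^sup>2 + indicator (ball 0 R) x)"
    using w2 emeasure_bounded_finite[of "ball (0::'a) R"]
    by (intro Bochner_Integration.integrable_add integrable_real_indicator) auto
  have "\<bar>w x\<bar> \<le> (w x)\<^sup>2 + indicator (ball 0 R) x" for x
  proof (cases "x \<in> ball 0 R")
    case True
    then show ?thesis using abs_le_power2_plus_1[of "w x"] by simp
  qed (simp add: supp)
  then show "AE x in lborel. norm (w x) \<le> norm ((w x)\<^sup>2 + indicator (ball 0 R) x)"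
    by (intro AE_I2) (simp add: order_trans[OF _ abs_ge_self])
qed measurable

text \<open>Cauchy-Schwarz against the indicator of the ball.\<close>

lemma L1_le_L2_bounded_support:
  fixes w :: "'a::euclidean_space \<Rightarrow> real"
  assumes wm: "w \<in> borel_measurable borel" and w2: "integrable lborel (\<lambda>x. (w x)\<^sup>2)"
    and supp: "\<And>x. x \<notin> ball 0 R \<Longrightarrow> w x = 0" and R: "R > 0"
  shows "(LBINT x. \<bar>w x\<bar>)\<^sup>2 \<le> measure lborel (ball (0::'a) R) * (LBINT x. (w x)\<^sup>2)"
proof -
  define V where "V = measure lborel (ball (0::'a) R)"
  have V: "V > 0" unfolding V_def using content_ball_gt_0_iff[of "0::'a" R] R by simp
  define t where "t = (LBINT x. \<bar>w x\<bar>)"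
  note w1 = square_integrable_bounded_support_integrable[OF wm w2 supp]
  have ind: "integrable lborel (indicator (ball (0::'a) R) :: 'a \<Rightarrow> real)"
    using emeasure_bounded_finite[of "ball (0::'a) R"] by (intro integrable_real_indicator) auto
  \<comment> \<open>Projecting \<open>|w|\<close> onto the constants on the ball, with \<open>t / V\<close> as its mean value there.\<close>
  have eq: "(\<bar>w x\<bar> - t / V * indicator (ball 0 R) x)\<^sup>2
      = (w x)\<^sup>2 - 2 * t / V * \<bar>w x\<bar> + (t / V)\<^sup>2 * indicator (ball 0 R) x" for x
    using supp[of x] by (auto simp: power2_diff indicator_def)
  have "0 \<le> (LBINT x. (\<bar>w x\<bar> - t / V * indicator (ball 0 R) x)\<^sup>2)" by simp
  also have "\<dots> = (LBINT x. (w x)\<^sup>2) - 2 * t / V * t + (t / V)\<^sup>2 * V"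
    unfolding eq using w1 w2 ind by (simp add: t_def V_def)
  also have "\<dots> = (LBINT x. (w x)\<^sup>2) - t\<^sup>2 / V"
    using V by (simp add: power2_eq_square field_simps)
  finally show ?thesis using V unfolding t_def[symmetric] V_def[symmetric] by (simp add: field_simps)
qed

lemma norm_cis_diff_le: "norm (cis a - cis b) \<le> \<bar>a - b\<bar>"
proof -
  have "(norm (cis a - cis b))\<^sup>2 = 2 * (1 - cos (a - b))"
    by (simp add: cmod_power2 power2_diff cos_diff algebra_simps)
  also have "\<dots> \<le> \<bar>a - b\<bar>\<^sup>2" using one_minus_cos_le[of "a - b"] by simp
  finally show ?thesis by (rule power2_le_imp_le) simp
qed

text \<open>For \<open>|x| < R\<close> the characters \<open>cis (\<xi> \<bullet> x)\<close> are \<open>R\<close>-Lipschitz in \<open>\<xi>\<close>.\<close>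

lemma ft_lipschitz:
  fixes w :: "'a::euclidean_space \<Rightarrow> real"
  assumes w: "integrable lborel w" and supp: "\<And>x. x \<notin> ball 0 R \<Longrightarrow> w x = 0" and R: "R > 0"
  shows "norm (ft w \<xi> - ft w \<eta>) \<le> (LBINT x. \<bar>w x\<bar>) * R * norm (\<xi> - \<eta>)"
proof -
  have "ft w \<xi> - ft w \<eta> = (LBINT x. w x *\<^sub>R cis (\<xi> \<bullet> x) - w x *\<^sub>R cis (\<eta> \<bullet> x))"
    unfolding ft_def by (intro Bochner_Integration.integral_diff[symmetric] ft_integrand w)
  also have "norm \<dots> \<le> (LBINT x. \<bar>w x\<bar> * (R * norm (\<xi> - \<eta>)))"
  proof (rule order_trans[OF integral_norm_bound integral_mono])
    show "integrable lborel (\<lambda>x. norm (w x *\<^sub>R cis (\<xi> \<bullet> x) - w x *\<^sub>R cis (\<eta> \<bullet> x)))"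
      by (intro integrable_norm Bochner_Integration.integrable_diff ft_integrand w)
    show "integrable lborel (\<lambda>x. \<bar>w x\<bar> * (R * norm (\<xi> - \<eta>)))" using w by simp
    fix x :: 'a
    show "norm (w x *\<^sub>R cis (\<xi> \<bullet> x) - w x *\<^sub>R cis (\<eta> \<bullet> x)) \<le> \<bar>w x\<bar> * (R * norm (\<xi> - \<eta>))"
    proof (cases "x \<in> ball 0 R")
      case True
      have "norm (cis (\<xi> \<bullet> x) - cis (\<eta> \<bullet> x)) \<le> \<bar>(\<xi> - \<eta>) \<bullet> x\<bar>"
        using norm_cis_diff_le[of "\<xi> \<bullet> x" "\<eta> \<bullet> x"] by (simp add: inner_diff_left)
      also have "\<dots> \<le> norm (\<xi> - \<eta>) * norm x" by (rule Cauchy_Schwarz_ineq2)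
      also have "\<dots> \<le> norm (\<xi> - \<eta>) * R" using True by (intro mult_left_mono) auto
      finally have "\<bar>w x\<bar> * norm (cis (\<xi> \<bullet> x) - cis (\<eta> \<bullet> x)) \<le> \<bar>w x\<bar> * (R * norm (\<xi> - \<eta>))"
        by (intro mult_left_mono) (auto simp: mult.commute)
      then show ?thesis by (simp flip: scaleR_diff_right)
    qed (simp add: supp)
  qed
  finally show ?thesis by (simp add: mult.assoc)
qed

lemma ft_tail_le:
  fixes L :: "'a::euclidean_space \<Rightarrow> 'a"
  assumes [measurable]: "L \<in> borel_measurable borel" "w \<in> borel_measurable borel" "A \<in> sets borel"
    and \<kappa>: "0 < \<kappa>" "\<And>\<xi>. \<xi> \<in> A \<Longrightarrow> \<kappa> \<le> norm (L \<xi>)"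
    and D: "(\<integral>\<^sup>+\<xi>. ennreal ((norm (L \<xi>))\<^sup>2 * (norm (ft w \<xi>))\<^sup>2) \<partial>lborel) \<le> ennreal c" and c: "0 \<le> c"
  shows "(\<integral>\<^sup>+\<xi>. ennreal ((norm (ft w \<xi>))\<^sup>2) * indicator A \<xi> \<partial>lborel) \<le> ennreal (c / \<kappa>\<^sup>2)"
proof -
  have "(\<integral>\<^sup>+\<xi>. ennreal ((norm (ft w \<xi>))\<^sup>2) * indicator A \<xi> \<partial>lborel) \<le>
      (\<integral>\<^sup>+\<xi>. ennreal (1 / \<kappa>\<^sup>2) * ennreal ((norm (L \<xi>))\<^sup>2 * (norm (ft w \<xi>))\<^sup>2) \<partial>lborel)"
  proof (rule nn_integral_mono)
    fix \<xi>
    show "ennreal ((norm (ft w \<xi>))\<^sup>2) * indicator A \<xi>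
        \<le> ennreal (1 / \<kappa>\<^sup>2) * ennreal ((norm (L \<xi>))\<^sup>2 * (norm (ft w \<xi>))\<^sup>2)"
    proof (cases "\<xi> \<in> A")
      case True
      have "1 \<le> (norm (L \<xi>))\<^sup>2 / \<kappa>\<^sup>2"
        using \<kappa>(1) \<kappa>(2)[OF True] by (simp add: power_mono)
      then have "1 * (norm (ft w \<xi>))\<^sup>2 \<le> (norm (L \<xi>))\<^sup>2 / \<kappa>\<^sup>2 * (norm (ft w \<xi>))\<^sup>2"
        by (rule mult_right_mono) simp
      then show ?thesis using True by (simp add: ennreal_leI flip: ennreal_mult')
    qed simp
  qed
  also have "\<dots> \<le> ennreal (1 / \<kappa>\<^sup>2) * ennreal c"
    by (subst nn_integral_cmult) (auto intro!: mult_left_mono D)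
  also have "\<dots> = ennreal (c / \<kappa>\<^sup>2)" by (simp flip: ennreal_mult')
  finally show ?thesis .
qed

text \<open>Let \<open>N\<close> be the squared norm of \<open>w\<close>. Bounded support gives \<open>|ft w|\<^sup>2 \<le> V N\<close>, where \<open>V\<close> is the volume
  of the ball, so a small ball of frequencies contributes at most half of \<open>(2\<pi>)\<^sup>n N\<close>. The other half is
  at higher frequencies, where \<open>L\<close> is bounded below and the assumed bound controls it.\<close>

proposition fourier_poincare:
  fixes L :: "'a::euclidean_space \<Rightarrow> 'a"
  assumes Lm: "L \<in> borel_measurable borel" and R: "R > 0"
    and below: "\<And>\<delta>. 0 < \<delta> \<Longrightarrow> \<exists>\<kappa>>0. \<forall>\<xi>. \<delta> \<le> norm \<xi> \<longrightarrow> \<kappa> \<le> norm (L \<xi>)"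
  shows "\<exists>C>0. \<forall>w D. w \<in> borel_measurable borel \<longrightarrow> integrable lborel (\<lambda>x. (w x)\<^sup>2) \<longrightarrow>
    (\<forall>x. x \<notin> ball 0 R \<longrightarrow> w x = 0) \<longrightarrow> 0 \<le> D \<longrightarrow>
    (\<integral>\<^sup>+\<xi>. ennreal ((norm (L \<xi>))\<^sup>2 * (norm (ft w \<xi>))\<^sup>2) \<partial>lborel) \<le> ennreal ((2 * pi) ^ DIM('a) * D) \<longrightarrow>
    (LBINT x. (w x)\<^sup>2) \<le> C * D"
proof -
  define V where "V = measure lborel (ball (0::'a) R)"
  have V: "V > 0" unfolding V_def using content_ball_gt_0_iff[of "0::'a" R] R by simp
  define P where "P = (2 * pi) ^ DIM('a)"
  have P: "P > 0" by (simp add: P_def)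
  define b where "b = unit_ball_vol (real DIM('a))"
  have b: "b > 0" by (simp add: b_def)
  \<comment> \<open>Chosen so that frequencies below \<open>\<delta>\<close> carry at most half of the \<open>L\<^sup>2\<close> norm; \<open>\<delta> \<le> 1\<close> allows
    \<open>\<delta> ^ n \<le> \<delta>\<close>.\<close>
  define \<delta> where "\<delta> = min 1 (P / (2 * b * V))"
  have \<delta>: "0 < \<delta>" "\<delta> \<le> 1" "\<delta> \<le> P / (2 * b * V)" using P b V by (auto simp: \<delta>_def)
  obtain \<kappa> where \<kappa>: "\<kappa> > 0" "\<And>\<xi>. \<delta> \<le> norm \<xi> \<Longrightarrow> \<kappa> \<le> norm (L \<xi>)"
    using below[OF \<delta>(1)] by auto
  have vol: "measure lborel (ball (0::'a) \<delta>) * V \<le> P / 2"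
  proof -
    have "\<delta> ^ DIM('a) \<le> \<delta> ^ 1" using \<delta> by (intro power_decreasing) auto
    then have "b * \<delta> ^ DIM('a) * V \<le> b * (P / (2 * b * V)) * V"
      using \<delta> b V by (intro mult_right_mono mult_left_mono) auto
    also have "\<dots> = P / 2" using b V by simp
    finally show ?thesis using \<delta> by (simp add: content_ball b_def)
  qed
  have [measurable]: "ball (0::'a) \<delta> \<in> sets borel" by simp
  have main: "(LBINT x. (w x)\<^sup>2) \<le> 2 / \<kappa>\<^sup>2 * D"
    if wm [measurable]: "w \<in> borel_measurable borel" and w2: "integrable lborel (\<lambda>x. (w x)\<^sup>2)"
    and supp: "\<forall>x. x \<notin> ball 0 R \<longrightarrow> w x = 0" and D0: "0 \<le> D"
    and D: "(\<integral>\<^sup>+\<xi>. ennreal ((norm (L \<xi>))\<^sup>2 * (norm (ft w \<xi>))\<^sup>2) \<partial>lborel) \<le> ennreal (P * D)" for w :: "'a \<Rightarrow> real" and D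
  proof -
    have w1: "integrable lborel w"
      by (rule square_integrable_bounded_support_integrable[OF wm w2]) (use supp in blast)
    define N where "N = (LBINT x. (w x)\<^sup>2)"
    have N: "0 \<le> N" by (simp add: N_def)
    have bd: "(norm (ft w \<xi>))\<^sup>2 \<le> V * N" for \<xi>
    proof -
      have "(norm (ft w \<xi>))\<^sup>2 \<le> (LBINT x. \<bar>w x\<bar>)\<^sup>2"
        by (intro power_mono norm_ft_le w1) auto
      also have "\<dots> \<le> V * N"
        unfolding V_def N_def by (rule L1_le_L2_bounded_support[OF wm w2 _ R]) (use supp in blast)
      finally show ?thesis .
    qed
    have "ennreal (P * N) = (\<integral>\<^sup>+\<xi>. ennreal ((norm (ft w \<xi>))\<^sup>2) \<partial>lborel)"
      unfolding P_def N_def by (rule plancherel[OF w1 w2, symmetric])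
    also have "\<dots> = (\<integral>\<^sup>+\<xi>. ennreal ((norm (ft w \<xi>))\<^sup>2) * indicator (ball 0 \<delta>) \<xi>
        + ennreal ((norm (ft w \<xi>))\<^sup>2) * indicator (- ball 0 \<delta>) \<xi> \<partial>lborel)"
      by (intro nn_integral_cong) (auto split: split_indicator)
    also have "\<dots> = (\<integral>\<^sup>+\<xi>. ennreal ((norm (ft w \<xi>))\<^sup>2) * indicator (ball 0 \<delta>) \<xi> \<partial>lborel)
        + (\<integral>\<^sup>+\<xi>. ennreal ((norm (ft w \<xi>))\<^sup>2) * indicator (- ball 0 \<delta>) \<xi> \<partial>lborel)"
      by (rule nn_integral_add) measurable
    also have "\<dots> \<le> ennreal (P / 2 * N) + ennreal (P * D / \<kappa>\<^sup>2)"
    proof (rule add_mono)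
      have "(\<integral>\<^sup>+\<xi>. ennreal ((norm (ft w \<xi>))\<^sup>2) * indicator (ball 0 \<delta>) \<xi> \<partial>lborel)
          \<le> (\<integral>\<^sup>+\<xi>. ennreal (V * N) * indicator (ball (0::'a) \<delta>) \<xi> \<partial>lborel)"
        by (intro nn_integral_mono mult_right_mono ennreal_leI bd) auto
      also have "\<dots> = ennreal (V * N) * emeasure lborel (ball (0::'a) \<delta>)"
        by (rule nn_integral_cmult_indicator) simp
      also have "emeasure lborel (ball (0::'a) \<delta>) = ennreal (measure lborel (ball (0::'a) \<delta>))"
        using emeasure_bounded_finite[of "ball (0::'a) \<delta>"] by (intro emeasure_eq_ennreal_measure) auto
      also have "ennreal (V * N) * \<dots> = ennreal (measure lborel (ball (0::'a) \<delta>) * V * N)"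
        using V N by (simp add: mult_ac flip: ennreal_mult')
      also have "\<dots> \<le> ennreal (P / 2 * N)"
        by (intro ennreal_leI mult_right_mono vol N)
      finally show "(\<integral>\<^sup>+\<xi>. ennreal ((norm (ft w \<xi>))\<^sup>2) * indicator (ball 0 \<delta>) \<xi> \<partial>lborel) \<le> ennreal (P / 2 * N)" .
      show "(\<integral>\<^sup>+\<xi>. ennreal ((norm (ft w \<xi>))\<^sup>2) * indicator (- ball 0 \<delta>) \<xi> \<partial>lborel) \<le> ennreal (P * D / \<kappa>\<^sup>2)"
        by (rule ft_tail_le[OF Lm wm _ \<kappa>(1) _ D]) (use P D0 \<kappa>(2) in auto)
    qed
    also have "\<dots> = ennreal (P / 2 * N + P * D / \<kappa>\<^sup>2)"
      using P N D0 by (intro ennreal_plus[symmetric]) auto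
    finally have "P * N \<le> P / 2 * N + P * D / \<kappa>\<^sup>2"
      using P N D0 by (subst (asm) ennreal_le_iff) (auto intro!: add_nonneg_nonneg)
    then have "P * N \<le> 2 * (P * D / \<kappa>\<^sup>2)" by simp
    also have "\<dots> = P * (2 / \<kappa>\<^sup>2 * D)" by simp
    finally show ?thesis unfolding N_def by (rule mult_left_le_imp_le) (rule P)
  qed
  show ?thesis
    by (rule exI[of _ "2 / \<kappa>\<^sup>2"]) (use main \<kappa>(1) in \<open>auto simp: P_def\<close>)
qed

text \<open>On a ball the \<open>L\<^sup>1\<close> norm is controlled by the \<open>L\<^sup>2\<close> norm, so the increments are summable in \<open>L\<^sup>1\<close>
  and therefore absolutely summable at almost every point.\<close>

lemma L2_Cauchy_bounded_support_AE_convergent: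
  fixes w :: "nat \<Rightarrow> 'a::euclidean_space \<Rightarrow> real"
  assumes wm [measurable]: "\<And>k. w k \<in> borel_measurable borel" and w2: "\<And>k. integrable lborel (\<lambda>x. (w k x)\<^sup>2)"
    and supp: "\<And>k x. x \<notin> ball 0 R \<Longrightarrow> w k x = 0" and R: "R > 0"
    and fast: "\<And>k. (LBINT x. (w (Suc k) x - w k x)\<^sup>2) \<le> (1 / 4) ^ k"
  shows "AE x in lborel. convergent (\<lambda>k. w k x)"
proof -
  define V where "V = measure lborel (ball (0::'a) R)"
  have V: "V \<ge> 0" by (simp add: V_def)
  have w1: "integrable lborel (w k)" for k
    by (rule square_integrable_bounded_support_integrable[OF wm w2 supp])
  have d2: "integrable lborel (\<lambda>x. (w (Suc k) x - w k x)\<^sup>2)" for k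
    by (rule square_integrable_diff) (auto simp: w2)
  have d1: "(LBINT x. \<bar>w (Suc k) x - w k x\<bar>) \<le> sqrt V * (1 / 2) ^ k" for k
  proof (rule power2_le_imp_le)
    have "(LBINT x. \<bar>w (Suc k) x - w k x\<bar>)\<^sup>2 \<le> V * (LBINT x. (w (Suc k) x - w k x)\<^sup>2)"
      unfolding V_def by (rule L1_le_L2_bounded_support[OF _ d2 _ R]) (auto simp: supp)
    also have "\<dots> \<le> V * (1 / 4) ^ k" by (intro mult_left_mono fast V)
    also have "\<dots> = (sqrt V * (1 / 2) ^ k)\<^sup>2"
    proof -
      have "((1 / 2) ^ k)\<^sup>2 = ((1 / 2)\<^sup>2 :: real) ^ k" by (simp only: power_mult[symmetric] mult.commute)
      also have "(1 / 2)\<^sup>2 = (1 / 4 :: real)" by (simp add: power2_eq_square)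
      finally show ?thesis using V by (simp only: power_mult_distrib real_sqrt_pow2)
    qed
    finally show "(LBINT x. \<bar>w (Suc k) x - w k x\<bar>)\<^sup>2 \<le> (sqrt V * (1 / 2) ^ k)\<^sup>2" .
  qed (use V in simp)
  have "(\<integral>\<^sup>+x. (\<Sum>k. ennreal \<bar>w (Suc k) x - w k x\<bar>) \<partial>lborel) = (\<Sum>k. \<integral>\<^sup>+x. ennreal \<bar>w (Suc k) x - w k x\<bar> \<partial>lborel)"
    by (rule nn_integral_suminf) measurable
  also have "\<dots> \<le> (\<Sum>k. ennreal (sqrt V * (1 / 2) ^ k))"
  proof (rule suminf_le)
    show "(\<integral>\<^sup>+x. ennreal \<bar>w (Suc k) x - w k x\<bar> \<partial>lborel) \<le> ennreal (sqrt V * (1 / 2) ^ k)" for k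
      using d1[of k] w1 by (subst nn_integral_eq_integral) (auto intro!: ennreal_leI)
  qed auto
  also have "\<dots> = ennreal (\<Sum>k. sqrt V * (1 / 2) ^ k)"
    using V by (intro suminf_ennreal2) (auto intro!: summable_mult summable_geometric)
  also have "\<dots> < \<infinity>" by simp
  finally have "(\<integral>\<^sup>+x. (\<Sum>k. ennreal \<bar>w (Suc k) x - w k x\<bar>) \<partial>lborel) \<noteq> \<infinity>" by simp
  then have "AE x in lborel. (\<Sum>k. ennreal \<bar>w (Suc k) x - w k x\<bar>) \<noteq> \<infinity>"
    by (intro nn_integral_PInf_AE) auto
  then show ?thesis
  proof eventually_elim
    case (elim x)
    then have "summable (\<lambda>k. \<bar>w (Suc k) x - w k x\<bar>)"
      by (intro summable_suminf_not_top) auto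
    then have "summable (\<lambda>k. w (Suc k) x - w k x)"
      by (rule summable_rabs_cancel)
    then have "convergent (\<lambda>n. \<Sum>k<n. w (Suc k) x - w k x)"
      by (rule summable_iff_convergent[THEN iffD1])
    then have "convergent (\<lambda>n. w n x - w 0 x)"
      using sum_lessThan_telescope[of "\<lambda>k. w k x"] by simp
    then have "convergent (\<lambda>n. (w n x - w 0 x) + w 0 x)"
      by (intro convergent_add convergent_const)
    then show ?case by simp
  qed
qed

lemma fast_Cauchy_subsequence:
  fixes d :: "nat \<Rightarrow> nat \<Rightarrow> real"
  assumes "\<And>e. e > 0 \<Longrightarrow> \<exists>K. \<forall>k\<ge>K. \<forall>l\<ge>K. d k l \<le> e"
  shows "\<exists>s. strict_mono s \<and> (\<forall>k. d (s (Suc k)) (s k) \<le> (1 / 4) ^ k)"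
proof -
  have "\<forall>k::nat. \<exists>K. \<forall>i\<ge>K. \<forall>j\<ge>K. d i j \<le> (1 / 4) ^ k"
    using assms by simp
  then obtain K where K: "\<And>k i j :: nat. i \<ge> K k \<Longrightarrow> j \<ge> K k \<Longrightarrow> d i j \<le> (1 / 4) ^ k"
    by metis
  define s where "s = rec_nat (K 0) (\<lambda>k sk. max (Suc sk) (K (Suc k)))"
  have s: "s (Suc k) = max (Suc (s k)) (K (Suc k))" "s 0 = K 0" for k by (simp_all add: s_def)
  have mono: "strict_mono s" by (rule strict_monoI_Suc) (simp add: s)
  have "K k \<le> s k" for k by (cases k) (simp_all add: s)
  moreover have "s k \<le> s (Suc k)" for k using s(1)[of k] by simp
  ultimately have "d (s (Suc k)) (s k) \<le> (1 / 4) ^ k" for k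
    by (intro K) (auto intro: order_trans)
  with mono show ?thesis by blast
qed

text \<open>Riesz-Fischer for functions with a common bounded support: a fast subsequence converges almost
  everywhere, and Fatou identifies its limit as the \<open>L\<^sup>2\<close> limit of the whole sequence.\<close>

proposition L2_complete_bounded_support:
  fixes w :: "nat \<Rightarrow> 'a::euclidean_space \<Rightarrow> real"
  assumes wm [measurable]: "\<And>k. w k \<in> borel_measurable borel" and w2: "\<And>k. integrable lborel (\<lambda>x. (w k x)\<^sup>2)"
    and supp: "\<And>k x. x \<notin> ball 0 R \<Longrightarrow> w k x = 0" and R: "R > 0"
    and Cauchy: "\<And>e. e > 0 \<Longrightarrow> \<exists>K. \<forall>k\<ge>K. \<forall>l\<ge>K. (LBINT x. (w k x - w l x)\<^sup>2) \<le> e"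
  shows "\<exists>v. v \<in> borel_measurable borel \<and> integrable lborel (\<lambda>x. (v x)\<^sup>2) \<and>
    (\<lambda>k. \<integral>x. (w k x - v x)\<^sup>2 \<partial>lborel) \<longlonglongrightarrow> 0"
proof -
  obtain s where s: "strict_mono s" "\<And>k. (LBINT x. (w (s (Suc k)) x - w (s k) x)\<^sup>2) \<le> (1 / 4) ^ k"
    using fast_Cauchy_subsequence[of "\<lambda>k l. (LBINT x. (w k x - w l x)\<^sup>2)", OF Cauchy] by blast
  have conv: "AE x in lborel. convergent (\<lambda>k. w (s k) x)"
    by (rule L2_Cauchy_bounded_support_AE_convergent[of "\<lambda>k. w (s k)" R]) (use w2 supp R s(2) in auto)
  \<comment> \<open>Where the limit does not exist, \<open>lim\<close> is an arbitrary value; this happens on a null set only.\<close>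
  define v where "v x = lim (\<lambda>k. w (s k) x)" for x
  have vm [measurable]: "v \<in> borel_measurable borel"
    unfolding v_def[abs_def] by (rule borel_measurable_lim_metric) measurable
  have d2: "integrable lborel (\<lambda>x. (w k x - w l x)\<^sup>2)" for k l
    by (rule square_integrable_diff) (auto simp: w2)
  have limit: "(\<integral>\<^sup>+x. ennreal ((w k x - v x)\<^sup>2) \<partial>lborel) \<le> ennreal e"
    if K: "\<And>k l. k \<ge> K \<Longrightarrow> l \<ge> K \<Longrightarrow> (LBINT x. (w k x - w l x)\<^sup>2) \<le> e" and k: "k \<ge> K" for K k e
  proof -
    have "(\<integral>\<^sup>+x. ennreal ((w k x - v x)\<^sup>2) \<partial>lborel) = (\<integral>\<^sup>+x. liminf (\<lambda>l. ennreal ((w k x - w (s l) x)\<^sup>2)) \<partial>lborel)"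
    proof (rule nn_integral_cong_AE)
      show "AE x in lborel. ennreal ((w k x - v x)\<^sup>2) = liminf (\<lambda>l. ennreal ((w k x - w (s l) x)\<^sup>2))"
        using conv
      proof eventually_elim
        case (elim x)
        then have "(\<lambda>l. w (s l) x) \<longlonglongrightarrow> v x" by (simp add: v_def convergent_LIMSEQ_iff)
        then have "(\<lambda>l. ennreal ((w k x - w (s l) x)\<^sup>2)) \<longlonglongrightarrow> ennreal ((w k x - v x)\<^sup>2)"
          by (intro tendsto_ennrealI tendsto_intros)
        then show ?case by (intro lim_imp_Liminf[symmetric]) auto
      qed
    qed
    also have "\<dots> \<le> liminf (\<lambda>l. \<integral>\<^sup>+x. ennreal ((w k x - w (s l) x)\<^sup>2) \<partial>lborel)"
      by (rule nn_integral_liminf) measurable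
    also have "\<dots> \<le> ennreal e"
    proof (rule Liminf_le)
      have "eventually (\<lambda>l. l \<ge> K) sequentially" by (rule eventually_ge_at_top)
      then show "\<forall>\<^sub>F l in sequentially. (\<integral>\<^sup>+x. ennreal ((w k x - w (s l) x)\<^sup>2) \<partial>lborel) \<le> ennreal e"
      proof eventually_elim
        case (elim l)
        then have "K \<le> s l" using seq_suble[OF s(1), of l] by linarith
        then show ?case using K[OF k] d2 by (subst nn_integral_eq_integral) (auto intro!: ennreal_leI)
      qed
    qed simp
    finally show ?thesis .
  qed
  have fin: "integrable lborel (\<lambda>x. (w k x - v x)\<^sup>2)" and small: "(LBINT x. (w k x - v x)\<^sup>2) \<le> e"
    if K: "\<And>k l. k \<ge> K \<Longrightarrow> l \<ge> K \<Longrightarrow> (LBINT x. (w k x - w l x)\<^sup>2) \<le> e" and k: "k \<ge> K" and e: "e > 0" for K k e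
  proof -
    note l = limit[OF K k]
    show i: "integrable lborel (\<lambda>x. (w k x - v x)\<^sup>2)"
      using le_less_trans[OF l ennreal_less_top] by (intro integrableI_bounded) auto
    show "(LBINT x. (w k x - v x)\<^sup>2) \<le> e"
      using l e by (simp add: nn_integral_eq_integral[OF i])
  qed
  have "integrable lborel (\<lambda>x. (v x)\<^sup>2)"
  proof -
    obtain K where K: "\<And>k l. k \<ge> K \<Longrightarrow> l \<ge> K \<Longrightarrow> (LBINT x. (w k x - w l x)\<^sup>2) \<le> 1"
      using Cauchy[of 1] by auto
    have i: "integrable lborel (\<lambda>x. (w K x - v x)\<^sup>2)" by (rule fin[OF K]) auto
    have "integrable lborel (\<lambda>x. (w K x - (w K x - v x))\<^sup>2)"
      by (rule square_integrable_diff) (auto simp: w2 i)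
    then show ?thesis by simp
  qed
  moreover have "(\<lambda>k. \<integral>x. (w k x - v x)\<^sup>2 \<partial>lborel) \<longlonglongrightarrow> 0"
  proof (rule LIMSEQ_I)
    fix e :: real assume e: "e > 0"
    then obtain K where K: "\<And>k l. k \<ge> K \<Longrightarrow> l \<ge> K \<Longrightarrow> (LBINT x. (w k x - w l x)\<^sup>2) \<le> e / 2"
      using Cauchy[of "e / 2"] by auto
    have "(LBINT x. (w k x - v x)\<^sup>2) \<le> e / 2" if "k \<ge> K" for k
      using e by (intro small[OF K that]) auto
    then show "\<exists>K. \<forall>k\<ge>K. norm ((LBINT x. (w k x - v x)\<^sup>2) - 0) < e"
      using e by (intro exI[of _ K]) fastforce
  qed
  ultimately show ?thesis using vm by blast
qed

text \<open>The transforms are uniformly bounded and equi-Lipschitz, so a diagonal subsequence that converges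
  on a countable dense set converges everywhere.\<close>

lemma ft_convergent_subsequence:
  fixes w :: "nat \<Rightarrow> 'a::euclidean_space \<Rightarrow> real"
  assumes w: "\<And>k. integrable lborel (w k)" and supp: "\<And>k x. x \<notin> ball 0 R \<Longrightarrow> w k x = 0" and R: "R > 0"
    and M: "\<And>k. (LBINT x. \<bar>w k x\<bar>) \<le> M"
  shows "\<exists>r. strict_mono r \<and> (\<forall>\<xi>. convergent (\<lambda>k. ft (w (r k)) \<xi>))"
proof -
  obtain S :: "'a set" where S: "countable S" "\<And>U. open U \<Longrightarrow> U \<noteq> {} \<Longrightarrow> \<exists>d\<in>S. d \<in> U"
    by (rule countable_dense_setE) blast
  have bd: "norm (ft (w k) \<xi>) \<le> M" for k \<xi> by (rule order_trans[OF norm_ft_le[OF w] M])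
  have M0: "0 \<le> M" by (rule order_trans[OF norm_ge_zero bd])
  obtain r :: "nat \<Rightarrow> nat" where r: "strict_mono r" "\<And>\<xi>. \<xi> \<in> S \<Longrightarrow> \<exists>l. (\<lambda>n. ft (w (r n)) \<xi>) \<longlonglongrightarrow> l"
    by (rule function_convergent_subsequence[of S "\<lambda>k. ft (w k)" M, OF S(1) bd]) auto
  have lip: "norm (ft (w k) \<xi> - ft (w k) \<eta>) \<le> (M * R) * norm (\<xi> - \<eta>)" for k \<xi> \<eta>
    by (rule order_trans[OF ft_lipschitz[OF w supp R]]) (auto intro!: mult_right_mono M simp: R less_imp_le)
  have "Cauchy (\<lambda>k. ft (w (r k)) \<xi>)" for \<xi>
  proof (rule metric_CauchyI)
    fix e :: real assume e: "e > 0"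
    define d where "d = e / (4 * (M * R + 1))"
    have MR: "0 \<le> M * R" using M0 R by simp
    have d: "d > 0" using e MR by (simp add: d_def add_nonneg_pos)
    obtain \<eta> where \<eta>: "\<eta> \<in> S" "\<eta> \<in> ball \<xi> d" using S(2)[of "ball \<xi> d"] d by auto
    have close: "norm (ft (w k) \<xi> - ft (w k) \<eta>) \<le> e / 4" for k
    proof -
      have "norm (ft (w k) \<xi> - ft (w k) \<eta>) \<le> (M * R) * norm (\<xi> - \<eta>)" by (rule lip)
      also have "\<dots> \<le> (M * R + 1) * d"
        using \<eta>(2) MR by (intro mult_mono) (auto simp: dist_norm)
      also have "\<dots> = e / 4" using MR by (simp add: d_def field_simps)
      finally show ?thesis .
    qed
    have "Cauchy (\<lambda>k. ft (w (r k)) \<eta>)" using r(2)[OF \<eta>(1)] LIMSEQ_imp_Cauchy by blast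
    then obtain K where K: "\<And>k l. k \<ge> K \<Longrightarrow> l \<ge> K \<Longrightarrow> dist (ft (w (r k)) \<eta>) (ft (w (r l)) \<eta>) < e / 4"
      using e metric_CauchyD[of _ "e / 4"] by fastforce
    have "dist (ft (w (r k)) \<xi>) (ft (w (r l)) \<xi>) < e" if "k \<ge> K" "l \<ge> K" for k l
    proof -
      have "dist (ft (w (r k)) \<xi>) (ft (w (r l)) \<xi>) \<le> dist (ft (w (r k)) \<xi>) (ft (w (r k)) \<eta>) +
          dist (ft (w (r k)) \<eta>) (ft (w (r l)) \<eta>) + dist (ft (w (r l)) \<eta>) (ft (w (r l)) \<xi>)"
        using dist_triangle[of "ft (w (r k)) \<xi>" "ft (w (r l)) \<xi>" "ft (w (r k)) \<eta>"]
          dist_triangle[of "ft (w (r k)) \<eta>" "ft (w (r l)) \<xi>" "ft (w (r l)) \<eta>"] by linarith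
      also have "\<dots> < e" using close[of "r k"] close[of "r l"] K[OF that] e by (simp add: dist_norm norm_minus_commute)
      finally show ?thesis .
    qed
    then show "\<exists>K. \<forall>k\<ge>K. \<forall>l\<ge>K. dist (ft (w (r k)) \<xi>) (ft (w (r l)) \<xi>) < e" by blast
  qed
  then show ?thesis using r(1) by (auto simp: Cauchy_convergent_iff)
qed

text \<open>Choose a subsequence along which the transforms converge pointwise. On a ball of frequencies they
  then converge in \<open>L\<^sup>2\<close> by dominated convergence, while outside it the growth of \<open>L\<close> makes the tails
  uniformly small. Hence the transforms form a Cauchy sequence in \<open>L\<^sup>2\<close>, and so do the functions by
  Plancherel.\<close>

proposition fourier_compactness:
  fixes L :: "'a::euclidean_space \<Rightarrow> 'a" and w :: "nat \<Rightarrow> 'a \<Rightarrow> real"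
  assumes Lm: "L \<in> borel_measurable borel" and R: "R > 0"
    and blowup: "\<And>c. 0 < c \<Longrightarrow> \<exists>\<delta>>0. \<forall>\<xi>. \<delta> \<le> norm \<xi> \<longrightarrow> c \<le> norm (L \<xi>)"
    and wm [measurable]: "\<And>k. w k \<in> borel_measurable borel" and w2: "\<And>k. integrable lborel (\<lambda>x. (w k x)\<^sup>2)"
    and supp: "\<And>k x. x \<notin> ball 0 R \<Longrightarrow> w k x = 0"
    and N: "\<And>k. (LBINT x. (w k x)\<^sup>2) \<le> B"
    and D: "\<And>k. (\<integral>\<^sup>+\<xi>. ennreal ((norm (L \<xi>))\<^sup>2 * (norm (ft (w k) \<xi>))\<^sup>2) \<partial>lborel) \<le> ennreal ((2 * pi) ^ DIM('a) * B)"
  shows "\<exists>r v. strict_mono r \<and> v \<in> borel_measurable borel \<and> integrable lborel (\<lambda>x. (v x)\<^sup>2) \<and>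
    (\<lambda>k. \<integral>x. (w (r k) x - v x)\<^sup>2 \<partial>lborel) \<longlonglongrightarrow> 0"
proof -
  define P where "P = (2 * pi) ^ DIM('a)"
  have P: "P > 0" by (simp add: P_def)
  have "0 \<le> (LBINT x. (w 0 x)\<^sup>2)" by simp
  then have B: "0 \<le> B" using N[of 0] by linarith
  have w1: "integrable lborel (w k)" for k
    by (rule square_integrable_bounded_support_integrable[OF wm w2 supp])
  define M where "M = sqrt (measure lborel (ball (0::'a) R) * B)"
  have M: "(LBINT x. \<bar>w k x\<bar>) \<le> M" for k
  proof -
    have "(LBINT x. \<bar>w k x\<bar>)\<^sup>2 \<le> measure lborel (ball (0::'a) R) * (LBINT x. (w k x)\<^sup>2)"
      by (rule L1_le_L2_bounded_support[OF wm w2 supp R])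
    also have "\<dots> \<le> measure lborel (ball (0::'a) R) * B" by (intro mult_left_mono N) simp
    finally show ?thesis unfolding M_def by (rule real_le_rsqrt)
  qed
  have bd: "norm (ft (w k) \<xi>) \<le> M" for k \<xi> by (rule order_trans[OF norm_ft_le[OF w1] M])
  have "\<exists>r. strict_mono r \<and> (\<forall>\<xi>. convergent (\<lambda>k. ft (w (r k)) \<xi>))"
    by (rule ft_convergent_subsequence[OF w1 supp R M])
  then obtain r where r: "strict_mono r" "\<And>\<xi>. convergent (\<lambda>k. ft (w (r k)) \<xi>)"
    by blast
  define U where "U \<xi> = lim (\<lambda>k. ft (w (r k)) \<xi>)" for \<xi>
  have U: "(\<lambda>k. ft (w (r k)) \<xi>) \<longlonglongrightarrow> U \<xi>" for \<xi>
    using r(2)[of \<xi>] unfolding U_def by (simp add: convergent_LIMSEQ_iff)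
  have Um [measurable]: "U \<in> borel_measurable borel"
    unfolding U_def[abs_def] by (rule borel_measurable_lim_metric) measurable
  have UM: "norm (U \<xi>) \<le> M" for \<xi>
    using tendsto_norm[OF U] by (rule LIMSEQ_le_const2) (use bd in auto)
  have near: "(\<lambda>k. \<integral>\<^sup>+\<xi>. ennreal ((norm (ft (w (r k)) \<xi> - U \<xi>))\<^sup>2) * indicator (ball 0 \<delta>) \<xi> \<partial>lborel) \<longlonglongrightarrow> 0" for \<delta>
  proof -
    have [measurable]: "ball (0::'a) \<delta> \<in> sets borel" by simp
    have "(\<lambda>k. \<integral>\<^sup>+\<xi>. ennreal ((norm (ft (w (r k)) \<xi> - U \<xi>))\<^sup>2) * indicator (ball 0 \<delta>) \<xi> \<partial>lborel)
        \<longlonglongrightarrow> (\<integral>\<^sup>+\<xi>. 0 \<partial>(lborel :: 'a measure))"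
    proof (rule nn_integral_dominated_convergence[where w="\<lambda>\<xi>. ennreal ((2 * M)\<^sup>2) * indicator (ball 0 \<delta>) \<xi>"])
      show "(\<integral>\<^sup>+\<xi>. ennreal ((2 * M)\<^sup>2) * indicator (ball (0::'a) \<delta>) \<xi> \<partial>lborel) < \<infinity>"
        using emeasure_bounded_finite[of "ball (0::'a) \<delta>"]
        by (subst nn_integral_cmult_indicator) (auto simp: ennreal_mult_less_top)
      show "AE \<xi> in lborel. ennreal ((norm (ft (w (r k)) \<xi> - U \<xi>))\<^sup>2) * indicator (ball 0 \<delta>) \<xi>
          \<le> ennreal ((2 * M)\<^sup>2) * indicator (ball 0 \<delta>) \<xi>" for k
      proof (intro AE_I2 mult_right_mono ennreal_leI power_mono)
        fix \<xi>
        show "norm (ft (w (r k)) \<xi> - U \<xi>) \<le> 2 * M"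
          using norm_triangle_ineq4[of "ft (w (r k)) \<xi>" "U \<xi>"] bd[of "r k" \<xi>] UM[of \<xi>] by linarith
      qed auto
      show "AE \<xi> in lborel. (\<lambda>k. ennreal ((norm (ft (w (r k)) \<xi> - U \<xi>))\<^sup>2) * indicator (ball 0 \<delta>) \<xi>) \<longlonglongrightarrow> 0"
      proof (rule AE_I2)
        fix \<xi> :: 'a
        have "(\<lambda>k. ennreal ((norm (ft (w (r k)) \<xi> - U \<xi>))\<^sup>2)) \<longlonglongrightarrow> ennreal ((norm (U \<xi> - U \<xi>))\<^sup>2)"
          by (intro tendsto_ennrealI tendsto_intros U)
        then show "(\<lambda>k. ennreal ((norm (ft (w (r k)) \<xi> - U \<xi>))\<^sup>2) * indicator (ball 0 \<delta>) \<xi>) \<longlonglongrightarrow> 0"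
          by (cases "\<xi> \<in> ball 0 \<delta>") auto
      qed
    qed measurable
    then show ?thesis by simp
  qed
  have Cauchy: "\<exists>K. \<forall>k\<ge>K. \<forall>l\<ge>K. (LBINT x. (w (r k) x - w (r l) x)\<^sup>2) \<le> e" if e: "e > 0" for e
  proof -
    \<comment> \<open>Makes each tail at most \<open>P e / 8\<close>; \<open>B + 1\<close> in place of \<open>B\<close> keeps \<open>c\<close> positive.\<close>
    define c where "c = sqrt (8 * (B + 1) / e)"
    have c: "c > 0" "c\<^sup>2 = 8 * (B + 1) / e" using e B by (simp_all add: c_def)
    obtain \<delta> where \<delta>: "\<And>\<xi>. \<delta> \<le> norm \<xi> \<Longrightarrow> c \<le> norm (L \<xi>)" using blowup[OF c(1)] by blast
    have [measurable]: "ball (0::'a) \<delta> \<in> sets borel" by simp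
    define I where "I k = (\<integral>\<^sup>+\<xi>. ennreal ((norm (ft (w (r k)) \<xi> - U \<xi>))\<^sup>2) * indicator (ball 0 \<delta>) \<xi> \<partial>lborel)" for k
    define J where "J k = (\<integral>\<^sup>+\<xi>. ennreal ((norm (ft (w (r k)) \<xi>))\<^sup>2) * indicator (- ball 0 \<delta>) \<xi> \<partial>lborel)" for k
    have J: "J k \<le> ennreal (P * e / 8)" for k
    proof -
      have "J k \<le> ennreal (P * B / c\<^sup>2)"
        unfolding J_def by (rule ft_tail_le[OF Lm wm _ c(1) _ D[folded P_def]]) (use \<delta> P B in auto)
      also have "\<dots> \<le> ennreal (P * e / 8)"
      proof (rule ennreal_leI)
        have "P * B / c\<^sup>2 = (P * e / 8) * (B / (B + 1))" using e B by (simp add: c(2) field_simps)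
        also have "\<dots> \<le> (P * e / 8) * 1" using B P e by (intro mult_left_mono) auto
        finally show "P * B / c\<^sup>2 \<le> P * e / 8" by simp
      qed
      finally show ?thesis .
    qed
    have "eventually (\<lambda>k. I k < ennreal (P * e / 8)) sequentially"
      using near[of \<delta>] P e unfolding I_def by (intro order_tendstoD(2)) auto
    then obtain K where K: "\<And>k. k \<ge> K \<Longrightarrow> I k \<le> ennreal (P * e / 8)"
      unfolding eventually_sequentially using less_imp_le by blast
    have "(LBINT x. (w (r k) x - w (r l) x)\<^sup>2) \<le> e" if kl: "k \<ge> K" "l \<ge> K" for k l
    proof -
      let ?d = "\<lambda>x. w (r k) x - w (r l) x"
      have d1: "integrable lborel ?d" using w1 by simp
      have d2: "integrable lborel (\<lambda>x. (?d x)\<^sup>2)"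
        by (rule square_integrable_diff) (auto simp: w2)
      \<comment> \<open>Used with \<open>y = U \<xi>\<close> inside the ball and with \<open>y = 0\<close> outside it.\<close>
      have sq: "ennreal ((norm (a - b))\<^sup>2)
          \<le> 2 * ennreal ((norm (a - y))\<^sup>2) + 2 * ennreal ((norm (b - y))\<^sup>2)" for a b y :: complex
      proof (rule ennreal_le_twice_add)
        have "(norm (a - b))\<^sup>2 \<le> (norm (a - y) + norm (b - y))\<^sup>2"
          by (intro power_mono) (use norm_triangle_ineq4[of "a - y" "b - y"] in auto)
        also have "\<dots> \<le> 2 * (norm (a - y))\<^sup>2 + 2 * (norm (b - y))\<^sup>2"
          using zero_le_power2[of "norm (a - y) - norm (b - y)"] by (simp add: power2_eq_square algebra_simps)
        finally show "(norm (a - b))\<^sup>2 \<le> 2 * (norm (a - y))\<^sup>2 + 2 * (norm (b - y))\<^sup>2" .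
      qed auto
      have "ennreal (P * (LBINT x. (?d x)\<^sup>2)) = (\<integral>\<^sup>+\<xi>. ennreal ((norm (ft (w (r k)) \<xi> - ft (w (r l)) \<xi>))\<^sup>2) \<partial>lborel)"
        unfolding P_def by (subst plancherel[OF d1 d2, symmetric]) (simp add: ft_diff[OF w1 w1])
      also have "\<dots> \<le> (\<integral>\<^sup>+\<xi>. (2 * (ennreal ((norm (ft (w (r k)) \<xi> - U \<xi>))\<^sup>2) * indicator (ball 0 \<delta>) \<xi>)
            + 2 * (ennreal ((norm (ft (w (r l)) \<xi> - U \<xi>))\<^sup>2) * indicator (ball 0 \<delta>) \<xi>))
          + (2 * (ennreal ((norm (ft (w (r k)) \<xi>))\<^sup>2) * indicator (- ball 0 \<delta>) \<xi>)
            + 2 * (ennreal ((norm (ft (w (r l)) \<xi>))\<^sup>2) * indicator (- ball 0 \<delta>) \<xi>)) \<partial>lborel)"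
      proof (rule nn_integral_mono)
        fix \<xi>
        show "ennreal ((norm (ft (w (r k)) \<xi> - ft (w (r l)) \<xi>))\<^sup>2)
            \<le> (2 * (ennreal ((norm (ft (w (r k)) \<xi> - U \<xi>))\<^sup>2) * indicator (ball 0 \<delta>) \<xi>)
            + 2 * (ennreal ((norm (ft (w (r l)) \<xi> - U \<xi>))\<^sup>2) * indicator (ball 0 \<delta>) \<xi>))
          + (2 * (ennreal ((norm (ft (w (r k)) \<xi>))\<^sup>2) * indicator (- ball 0 \<delta>) \<xi>)
            + 2 * (ennreal ((norm (ft (w (r l)) \<xi>))\<^sup>2) * indicator (- ball 0 \<delta>) \<xi>))"
          using sq[of "ft (w (r k)) \<xi>" "ft (w (r l)) \<xi>" "U \<xi>"] sq[of "ft (w (r k)) \<xi>" "ft (w (r l)) \<xi>" 0]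
          by (cases "\<xi> \<in> ball 0 \<delta>") auto
      qed
      also have "\<dots> = (2 * I k + 2 * I l) + (2 * J k + 2 * J l)"
        unfolding I_def J_def by (simp add: nn_integral_add nn_integral_cmult)
      also have "\<dots> \<le> (2 * ennreal (P * e / 8) + 2 * ennreal (P * e / 8)) + (2 * ennreal (P * e / 8)
          + 2 * ennreal (P * e / 8))"
        by (intro add_mono mult_left_mono J K kl) auto
      also have "\<dots> = ennreal (P * e)"
      proof -
        have h: "2 * ennreal (P * e / 8) = ennreal (P * e / 4)"
          using P e ennreal_mult'[of 2 "P * e / 8"] by simp
        show ?thesis unfolding h using P e by (simp flip: ennreal_plus)
      qed
      finally show ?thesis using P e by (simp add: ennreal_le_iff)
    qed
    then show ?thesis by blast
  qed
  have "\<exists>v. v \<in> borel_measurable borel \<and> integrable lborel (\<lambda>x. (v x)\<^sup>2) \<and>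
    (\<lambda>k. \<integral>x. (w (r k) x - v x)\<^sup>2 \<partial>lborel) \<longlonglongrightarrow> 0"
    by (rule L2_complete_bounded_support[OF wm w2 supp R Cauchy])
  with r(1) show ?thesis by blast
qed

section \<open>From weak nonlocal gradients to symbols\<close>

lemma lebesgue_borel_representative:
  fixes u :: "'a::euclidean_space \<Rightarrow> real"
  assumes "u \<in> borel_measurable lebesgue"
  obtains w where "w \<in> borel_measurable borel" "AE x in lebesgue. u x = w x"
  using completion_ex_borel_measurable_real[OF assms] AE_completion[of _ lborel] that
  by (auto simp: measurable_lborel1)

lemma kernel_eq_radial_weight:
  fixes \<rho> :: "real^'n \<Rightarrow> ennreal"
  assumes "radial_repr \<rho> \<rho>r" "z \<noteq> 0"
  shows "enn2real (\<rho> z) = (norm z)\<^sup>2 * radial_weight (f_kernel TYPE('n) \<rho>r) z"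
proof -
  have "norm z powi (int CARD('n) - 2) = norm z ^ CARD('n) / (norm z)\<^sup>2"
    using assms(2) by (subst power_int_diff) (auto simp: power_int_of_nat)
  then show ?thesis
    using assms by (simp add: radial_weight_def f_kernel_def radial_repr_def)
qed

lemma f_kernel_growth:
  assumes "t > 0"
  shows "t * f_kernel TYPE('n::finite) \<rho>r t = t ^ (CARD('n) - 1) * enn2real (\<rho>r t)"
proof -
  have "t powi (int CARD('n) - 2) = t ^ CARD('n) / t\<^sup>2"
    using assms by (subst power_int_diff) (auto simp: power_int_of_nat)
  moreover have "t ^ CARD('n) = t * t ^ (CARD('n) - 1)"
    by (rule power_eq_if[THEN trans]) simp
  ultimately show ?thesis
    using assms by (simp add: f_kernel_def power2_eq_square)
qed

lemma f_kernel_nonneg: "0 < t \<Longrightarrow> 0 \<le> f_kernel TYPE('n::finite) \<rho>r t"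
  by (simp add: f_kernel_def)

lemma kernel_integrable:
  fixes \<rho> :: "real^'n \<Rightarrow> ennreal"
  assumes supp: "compact (supp \<rho>)" and rad: "radial_repr \<rho> \<rho>r" and L1: "L1_loc \<rho>"
    and anti: "antimono_on {0<..} (f_kernel TYPE('n) \<rho>r)"
  shows "integrable lborel (\<lambda>z::real^'n. (norm z)\<^sup>2 * radial_weight (f_kernel TYPE('n) \<rho>r) z)"
proof (rule integrableI_bounded)
  have [measurable]: "radial_weight (f_kernel TYPE('n) \<rho>r) \<in> borel_measurable (borel :: (real^'n) measure)"
    using anti by (rule radial_weight_measurable)
  show "(\<lambda>z::real^'n. (norm z)\<^sup>2 * radial_weight (f_kernel TYPE('n) \<rho>r) z) \<in> borel_measurable lborel"
    by measurable
  have le: "ennreal (norm ((norm z)\<^sup>2 * radial_weight (f_kernel TYPE('n) \<rho>r) z)) \<le> \<rho> z * indicator (supp \<rho>) z" for z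
  proof -
    have e: "(norm z)\<^sup>2 * radial_weight (f_kernel TYPE('n) \<rho>r) z = (if z = 0 then 0 else enn2real (\<rho> z))"
      using kernel_eq_radial_weight[OF rad, of z] by auto
    have "z \<in> supp \<rho>" if "\<rho> z \<noteq> 0"
      using that closure_subset[of "{x. \<rho> x \<noteq> 0}"] by (auto simp: supp_def)
    moreover have "ennreal (enn2real (\<rho> z)) \<le> \<rho> z"
      by (cases "\<rho> z" rule: ennreal_cases) auto
    ultimately show ?thesis
      unfolding e by (cases "\<rho> z = 0") auto
  qed
  have "(\<integral>\<^sup>+z. ennreal (norm ((norm z)\<^sup>2 * radial_weight (f_kernel TYPE('n) \<rho>r) z)) \<partial>(lborel :: (real^'n) measure)) =
      (\<integral>\<^sup>+z. ennreal (norm ((norm z)\<^sup>2 * radial_weight (f_kernel TYPE('n) \<rho>r) z)) \<partial>(lebesgue :: (real^'n) measure))"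
    by (rule nn_integral_completion[symmetric])
  also have "\<dots> \<le> (\<integral>\<^sup>+z\<in>supp \<rho>. \<rho> z \<partial>lebesgue)"
    by (intro nn_integral_mono le)
  also have "\<dots> < \<infinity>" using L1 supp by (auto simp: L1_loc_def)
  finally show "(\<integral>\<^sup>+z. ennreal (norm ((norm z)\<^sup>2 * radial_weight (f_kernel TYPE('n) \<rho>r) z)) \<partial>(lborel :: (real^'n) measure)) < \<infinity>" .
qed

lemma radial_profile_f_kernel:
  fixes \<rho> :: "real^'n \<Rightarrow> ennreal"
  assumes "compact (supp \<rho>)" "radial_repr \<rho> \<rho>r" "L1_loc \<rho>"
    and "antimono_on {0<..} (f_kernel TYPE('n) \<rho>r)"
  shows "radial_profile TYPE(real^'n) (f_kernel TYPE('n) \<rho>r)"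
  using assms by unfold_locales (auto intro: kernel_integrable f_kernel_nonneg)

text \<open>The identity holds for the integrands at every \<open>y\<close>: at \<open>y = x\<close>, the only place where the kernel is
  not given by the weight, both sides vanish.\<close>

lemma nonlocal_div_eq_scalar_div:
  fixes \<rho> :: "real^'n \<Rightarrow> ennreal"
  assumes rad: "radial_repr \<rho> \<rho>r" and anti: "antimono_on {0<..} (f_kernel TYPE('n) \<rho>r)"
    and [measurable]: "\<phi> \<in> borel_measurable borel"
  shows "nonlocal_div \<rho> (\<lambda>x. \<phi> x *\<^sub>R v) x = scalar_div (f_kernel TYPE('n) \<rho>r) \<phi> v x"
proof -
  let ?W = "radial_weight (f_kernel TYPE('n) \<rho>r) :: real^'n \<Rightarrow> real"
  have [measurable]: "?W \<in> borel_measurable borel"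
    using anti by (rule radial_weight_measurable)
  have pw: "(((\<phi> x *\<^sub>R v - \<phi> y *\<^sub>R v) /\<^sub>R norm (x - y)) \<bullet> ((x - y) /\<^sub>R norm (x - y))) * enn2real (\<rho> (x - y)) =
      (\<phi> x - \<phi> (x - (x - y))) * (v \<bullet> (x - y)) * ?W (x - y)" for y
  proof (cases "x = y")
    case False
    then have e: "enn2real (\<rho> (x - y)) = (norm (x - y))\<^sup>2 * ?W (x - y)"
      by (intro kernel_eq_radial_weight[OF rad]) simp
    have n: "norm (x - y) \<noteq> 0" using False by simp
    have "((\<phi> x *\<^sub>R v - \<phi> y *\<^sub>R v) /\<^sub>R norm (x - y)) \<bullet> ((x - y) /\<^sub>R norm (x - y)) =
        (\<phi> x - \<phi> y) * (v \<bullet> (x - y)) * (1 / (norm (x - y))\<^sup>2)"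
      unfolding scaleR_diff_left[symmetric] inner_scaleR_left inner_scaleR_right
      by (simp only: power2_eq_square inverse_eq_divide mult_ac times_divide_eq_left times_divide_eq_right divide_divide_eq_left mult_1_left mult_1_right)
    then show ?thesis
      unfolding e using n by simp
  qed simp
  have "nonlocal_div \<rho> (\<lambda>x. \<phi> x *\<^sub>R v) x = (\<integral>y. (\<phi> x - \<phi> (x - (x - y))) * (v \<bullet> (x - y)) * ?W (x - y) \<partial>lebesgue)"
    unfolding nonlocal_div_def pw ..
  also have "\<dots> = (LBINT y. (\<phi> x - \<phi> (x - (x - y))) * (v \<bullet> (x - y)) * ?W (x - y))"
    by (rule integral_completion) measurable
  also have "\<dots> = scalar_div (f_kernel TYPE('n) \<rho>r) \<phi> v x"
    unfolding scalar_div_def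
    by (rule lborel_reflect_integral[of "\<lambda>z. (\<phi> x - \<phi> (x - z)) * (v \<bullet> z) * ?W z" x]) measurable
  finally show ?thesis .
qed

lemma test_field_of_test_fun:
  fixes v :: "real^'n"
  assumes "test_fun \<phi>" and zero: "\<And>x. norm x \<ge> R \<Longrightarrow> \<phi> x = 0"
  shows "(\<lambda>x. \<phi> x *\<^sub>R v) \<in> test_fields"
proof -
  have "supp (\<lambda>x. \<phi> x *\<^sub>R v) \<subseteq> cball 0 R"
    unfolding supp_def using zero by (intro closure_minimal) (auto simp: not_le[symmetric], meson linear)
  then have "compact (supp (\<lambda>x. \<phi> x *\<^sub>R v))"
    unfolding supp_def by (meson bounded_cball bounded_subset closed_closure compact_eq_bounded_closed)
  then show ?thesis using test_fun_C_k[OF assms(1)] by (auto simp: test_fields_def)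
qed

text \<open>Passing to Borel representatives reduces everything to Borel measure. The bound then is the sum of
  \<open>symbol_ft_bound_direction\<close> over an orthonormal basis.\<close>

proposition H_rho_0_fourier_representative:
  fixes \<rho> :: "real^'n \<Rightarrow> ennreal"
  assumes supp: "compact (supp \<rho>)" and rad: "radial_repr \<rho> \<rho>r" and L1: "L1_loc \<rho>"
    and anti: "antimono_on {0<..} (f_kernel TYPE('n) \<rho>r)"
    and \<Omega>: "\<Omega> \<subseteq> ball 0 R" and u: "u \<in> H_rho_0 \<rho> \<Omega>"
  shows "\<exists>w. w \<in> borel_measurable borel \<and> (AE x in lebesgue. u x = w x) \<and>
    integrable lborel (\<lambda>x. (w x)\<^sup>2) \<and> (\<forall>x. x \<notin> ball 0 R \<longrightarrow> w x = 0) \<and>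
    (LBINT x. (w x)\<^sup>2) = (L2_norm lebesgue u)\<^sup>2 \<and>
    (\<integral>\<^sup>+\<xi>. ennreal ((norm (kernel_symbol (f_kernel TYPE('n) \<rho>r) \<xi>))\<^sup>2 * (norm (ft w \<xi>))\<^sup>2) \<partial>lborel)
      \<le> ennreal ((2 * pi) ^ DIM(real^'n) * (distr_L2_norm (weak_nonlocal_grad \<rho> u))\<^sup>2)"
proof -
  let ?f = "f_kernel TYPE('n) \<rho>r"
  have uH: "u \<in> L2 lebesgue" "\<exists>g\<in>L2 lebesgue. represents g (weak_nonlocal_grad \<rho> u)"
    and u0: "AE x in lebesgue. x \<in> - \<Omega> \<longrightarrow> u x = 0"
    using u by (auto simp: H_rho_0_def H_rho_def)
  have um [measurable]: "u \<in> borel_measurable lebesgue" and u2: "integrable lebesgue (\<lambda>x. (u x)\<^sup>2)"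
    using uH(1) by (auto simp: L2_def)
  obtain w0 where w0 [measurable]: "w0 \<in> borel_measurable borel" and uw0: "AE x in lebesgue. u x = w0 x"
    using lebesgue_borel_representative[OF um] by blast
  \<comment> \<open>Cutting off to the ball changes \<open>w0\<close> only on a null set, as \<open>u\<close> vanishes almost everywhere off \<open>\<Omega>\<close>.\<close>
  define w where "w x = (if x \<in> ball 0 R then w0 x else 0)" for x
  have wm [measurable]: "w \<in> borel_measurable borel"
    unfolding w_def[abs_def] by (intro measurable_If_set) auto
  have uw: "AE x in lebesgue. u x = w x"
    using uw0 u0 by eventually_elim (use \<Omega> in \<open>auto simp: w_def\<close>)
  have wl [measurable]: "w \<in> borel_measurable lebesgue"
    using wm by (intro measurable_completion) simp
  have uw2: "AE x in lebesgue. (u x)\<^sup>2 = (w x)\<^sup>2" using uw by eventually_elim simp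
  have "integrable lebesgue (\<lambda>x. (w x)\<^sup>2)"
    by (rule integrable_cong_AE_imp[OF u2]) (use uw2 in \<open>auto elim: eventually_mono\<close>)
  then have w2: "integrable lborel (\<lambda>x. (w x)\<^sup>2)" by (subst (asm) integrable_completion) auto
  have "(\<integral>x. (u x)\<^sup>2 \<partial>lebesgue) = (\<integral>x. (w x)\<^sup>2 \<partial>lebesgue)"
    by (rule integral_cong_AE) (use uw2 in auto)
  also have "\<dots> = (LBINT x. (w x)\<^sup>2)" by (rule integral_completion) measurable
  finally have norm: "(LBINT x. (w x)\<^sup>2) = (L2_norm lebesgue u)\<^sup>2"
    by (simp add: L2_norm_def)
  have supp_w: "w x = 0" if "x \<notin> ball 0 R" for x using that by (simp add: w_def)
  have w1: "integrable lborel w"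
    by (rule square_integrable_bounded_support_integrable[OF wm w2 supp_w])
  \<comment> \<open>The representative that \<open>distr_L2_norm\<close> picks.\<close>
  define g where "g = (SOME g. g \<in> L2 lebesgue \<and> represents g (weak_nonlocal_grad \<rho> u))"
  from uH(2) have "\<exists>g. g \<in> L2 lebesgue \<and> represents g (weak_nonlocal_grad \<rho> u)" by blast
  from someI_ex[OF this, folded g_def]
  have gL: "g \<in> L2 lebesgue" and gr: "represents g (weak_nonlocal_grad \<rho> u)" by simp_all
  have gm [measurable]: "g \<in> borel_measurable lebesgue" and g2: "integrable lebesgue (\<lambda>x. (norm (g x))\<^sup>2)"
    using gL by (simp_all only: L2_def mem_Collect_eq)
  have rep: "\<And>\<Phi>. \<Phi> \<in> test_fields \<Longrightarrow> weak_nonlocal_grad \<rho> u \<Phi> = (\<integral>x. g x \<bullet> \<Phi> x \<partial>lebesgue)"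
    using gr by (simp add: represents_def)
  have gnorm: "(\<integral>x. (norm (g x))\<^sup>2 \<partial>lebesgue) = (distr_L2_norm (weak_nonlocal_grad \<rho> u))\<^sup>2"
    unfolding distr_L2_norm_def g_def[symmetric] by (simp add: L2_norm_def)
  interpret radial_profile ?f "TYPE(real^'n)"
    by (rule radial_profile_f_kernel[OF supp rad L1 anti])
  define P where "P = (2 * pi) ^ DIM(real^'n)"
  have P: "P > 0" by (simp add: P_def)
  have g2v: "integrable lebesgue (\<lambda>x. (g x \<bullet> v)\<^sup>2)" for v
  proof (rule Bochner_Integration.integrable_bound)
    show "integrable lebesgue (\<lambda>x. (norm (g x))\<^sup>2 * (norm v)\<^sup>2)" using g2 by simp
    have "(g x \<bullet> v)\<^sup>2 \<le> (norm (g x))\<^sup>2 * (norm v)\<^sup>2" for x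
      using Cauchy_Schwarz_ineq[of "g x" v] by (simp add: power2_norm_eq_inner)
    then show "AE x in lebesgue. norm ((g x \<bullet> v)\<^sup>2) \<le> norm ((norm (g x))\<^sup>2 * (norm v)\<^sup>2)"
      by (intro AE_I2) simp
  qed measurable
  have dir: "(\<integral>\<^sup>+\<xi>. ennreal ((kernel_symbol ?f \<xi> \<bullet> v)\<^sup>2 * (norm (ft w \<xi>))\<^sup>2) \<partial>lborel)
      \<le> ennreal (P * (\<integral>x. (g x \<bullet> v)\<^sup>2 \<partial>lebesgue))"
    for v :: "real^'n"
  proof -
    have gvm [measurable]: "(\<lambda>x. g x \<bullet> v) \<in> borel_measurable lebesgue" by measurable
    obtain h where h [measurable]: "h \<in> borel_measurable borel" and gh: "AE x in lebesgue. g x \<bullet> v = h x"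
      using lebesgue_borel_representative[OF gvm] by blast
    have hl [measurable]: "h \<in> borel_measurable lebesgue"
      using h by (intro measurable_completion) simp
    have gh2: "AE x in lebesgue. (g x \<bullet> v)\<^sup>2 = (h x)\<^sup>2" using gh by eventually_elim simp
    have "integrable lebesgue (\<lambda>x. (h x)\<^sup>2)"
      by (rule integrable_cong_AE_imp[OF g2v[of v]]) (use gh2 in \<open>auto elim: eventually_mono\<close>)
    then have h2: "integrable lborel (\<lambda>x. (h x)\<^sup>2)" by (subst (asm) integrable_completion) auto
    have "(\<integral>x. (g x \<bullet> v)\<^sup>2 \<partial>lebesgue) = (\<integral>x. (h x)\<^sup>2 \<partial>lebesgue)"
      by (rule integral_cong_AE) (use gh2 in auto)
    also have "\<dots> = (LBINT x. (h x)\<^sup>2)" by (rule integral_completion) measurable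
    finally have hn: "(\<integral>x. (g x \<bullet> v)\<^sup>2 \<partial>lebesgue) = (LBINT x. (h x)\<^sup>2)" .
    show ?thesis
      unfolding hn P_def
    proof (rule symbol_ft_bound_direction[OF w1 h h2])
      fix \<phi> :: "real^'n \<Rightarrow> real" and S
      assume \<phi>: "test_fun \<phi>" and zero: "\<And>x. norm x \<ge> S \<Longrightarrow> \<phi> x = 0"
      have [measurable]: "\<phi> \<in> borel_measurable borel" using \<phi> by (rule test_fun_measurable)
      have \<phi>l [measurable]: "\<phi> \<in> borel_measurable lebesgue" by (rule measurable_completion) measurable
      have sm [measurable]: "scalar_div ?f \<phi> v \<in> borel_measurable borel" by (rule scalar_div_measurable) measurable
      have sl [measurable]: "scalar_div ?f \<phi> v \<in> borel_measurable lebesgue" using sm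
          by (intro measurable_completion) simp
      have "(LBINT x. w x * scalar_div ?f \<phi> v x) = (\<integral>x. w x * scalar_div ?f \<phi> v x \<partial>lebesgue)"
        by (rule integral_completion[symmetric]) measurable
      also have "\<dots> = (\<integral>x. u x * scalar_div ?f \<phi> v x \<partial>lebesgue)"
        by (rule integral_cong_AE) (use uw in \<open>auto elim: eventually_mono\<close>)
      also have "- \<dots> = weak_nonlocal_grad \<rho> u (\<lambda>x. \<phi> x *\<^sub>R v)"
        by (simp add: weak_nonlocal_grad_def nonlocal_div_eq_scalar_div[OF rad anti])
      also have "\<dots> = (\<integral>x. g x \<bullet> (\<phi> x *\<^sub>R v) \<partial>lebesgue)"
        by (rule rep[OF test_field_of_test_fun[OF \<phi> zero]])
      also have "\<dots> = (\<integral>x. h x * \<phi> x \<partial>lebesgue)"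
        by (rule integral_cong_AE) (use gh in \<open>auto elim: eventually_mono\<close>)
      also have "\<dots> = (LBINT x. h x * \<phi> x)"
        by (rule integral_completion) measurable
      finally show "- (LBINT x. w x * scalar_div ?f \<phi> v x) = (LBINT x. h x * \<phi> x)" .
    qed
  qed
  have "(\<integral>\<^sup>+\<xi>. ennreal ((norm (kernel_symbol ?f \<xi>))\<^sup>2 * (norm (ft w \<xi>))\<^sup>2) \<partial>lborel) =
      (\<integral>\<^sup>+\<xi>. (\<Sum>b\<in>Basis. ennreal ((kernel_symbol ?f \<xi> \<bullet> b)\<^sup>2 * (norm (ft w \<xi>))\<^sup>2)) \<partial>lborel)"
    by (intro nn_integral_cong) (simp add: norm_sq_eq_sum_Basis[of "kernel_symbol _ _"] sum_distrib_right sum_ennreal)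
  also have "\<dots> = (\<Sum>b\<in>Basis. \<integral>\<^sup>+\<xi>. ennreal ((kernel_symbol ?f \<xi> \<bullet> b)\<^sup>2 * (norm (ft w \<xi>))\<^sup>2) \<partial>lborel)"
    by (rule nn_integral_sum) measurable
  also have "\<dots> \<le> (\<Sum>b\<in>Basis. ennreal (P * (\<integral>x. (g x \<bullet> b)\<^sup>2 \<partial>lebesgue)))"
    by (intro sum_mono dir)
  also have "\<dots> = ennreal (P * (\<Sum>b\<in>Basis. (\<integral>x. (g x \<bullet> b)\<^sup>2 \<partial>lebesgue)))"
    using P by (simp add: sum_distrib_left)
  also have "(\<Sum>b\<in>Basis. (\<integral>x. (g x \<bullet> b)\<^sup>2 \<partial>lebesgue)) = (\<integral>x. (norm (g x))\<^sup>2 \<partial>lebesgue)"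
    unfolding norm_sq_eq_sum_Basis using g2v by (intro Bochner_Integration.integral_sum[symmetric])
  finally have "(\<integral>\<^sup>+\<xi>. ennreal ((norm (kernel_symbol ?f \<xi>))\<^sup>2 * (norm (ft w \<xi>))\<^sup>2) \<partial>lborel)
      \<le> ennreal ((2 * pi) ^ DIM(real^'n) * (distr_L2_norm (weak_nonlocal_grad \<rho> u))\<^sup>2)"
    unfolding gnorm P_def .
  with wm uw w2 supp_w norm show ?thesis by blast
qed

section \<open>The theorem\<close>

text \<open>In applications \<open>s\<close> is \<open>1/|\<xi>|\<close> or a fixed radius, so that the symbol inherits the size of
  \<open>t f t = t\<^bsup>n-1\<^esup> \<rho>r t\<close> near \<open>0\<close>.\<close>

lemma (in radial_profile) norm_kernel_symbol_growth_bound: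
  fixes \<xi> :: "'a"
  assumes doubling: "\<And>t. t \<in> {0<..<\<epsilon>} \<Longrightarrow> f t \<le> \<mu> * f (t / 2)" and \<mu>: "\<mu> < 1"
    and growth: "\<And>t. 0 < t \<Longrightarrow> t < t0 \<Longrightarrow> c \<le> t * f t"
    and s: "0 < s" "s < \<epsilon>" "s < t0" and \<xi>s: "norm \<xi> * s \<le> 1" and \<xi>: "\<xi> \<noteq> 0"
  shows "2 * symbol_const TYPE('a) * (1 - \<mu>) * c * (norm \<xi> * s) \<le> norm (kernel_symbol f \<xi>)"
proof -
  have "c \<le> s / 2 * f (s / 2)" using s by (intro growth) auto
  then have "2 * symbol_const TYPE('a) * (1 - \<mu>) * (norm \<xi> * s) * c
      \<le> 2 * symbol_const TYPE('a) * (1 - \<mu>) * (norm \<xi> * s) * (s / 2 * f (s / 2))"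
    using \<mu> s symbol_const_pos[where 'a='a] by (intro mult_left_mono) auto
  also have "\<dots> = symbol_const TYPE('a) * (1 - \<mu>) * (norm \<xi> * s\<^sup>2 * f (s / 2))"
    by (simp add: power2_eq_square)
  also have "\<dots> \<le> norm (kernel_symbol f \<xi>)"
    using s by (intro norm_kernel_symbol_lower_bound[OF _ \<xi>s \<xi> doubling]) auto
  finally show ?thesis by (simp add: mult_ac)
qed

lemma L2_norm_lebesgue_on_le:
  assumes "S \<in> sets lebesgue" and "u \<in> L2 lebesgue"
  shows "L2_norm (lebesgue_on S) u \<le> L2_norm lebesgue u"
proof -
  have i: "integrable lebesgue (\<lambda>x. (norm (u x))\<^sup>2)" using assms(2) by (auto simp only: L2_def mem_Collect_eq)
  have "(\<integral>x. (norm (u x))\<^sup>2 \<partial>lebesgue_on S) = (\<integral>x. indicator S x *\<^sub>R (norm (u x))\<^sup>2 \<partial>lebesgue)"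
    using assms(1) by (subst integral_restrict_space) auto
  also have "\<dots> \<le> (\<integral>x. (norm (u x))\<^sup>2 \<partial>lebesgue)"
    using integrable_mult_indicator[OF assms(1) i] i
    by (intro integral_mono) (auto split: split_indicator)
  finally show ?thesis by (simp add: L2_norm_def)
qed

theorem theorem4p5:
  fixes \<Omega> :: "(real^'n) set" and \<rho> :: "real^'n \<Rightarrow> ennreal"
    and \<rho>r :: "real \<Rightarrow> ennreal" and \<epsilon> :: real
  assumes "open \<Omega>" and "bounded \<Omega>"
    and "compact (supp \<rho>)"
    and "\<epsilon> > 0"
    and "radial_repr \<rho> \<rho>r"
    and "\<forall>x. x \<noteq> 0 \<longrightarrow> \<rho> x < \<infinity>"
    and "L1_loc \<rho>"
    and "(\<integral>\<^sup>+x. ennreal (min 1 (inverse (norm x))) * \<rho> x \<partial>lebesgue) < \<infinity>"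
    and "(INF x\<in>ball 0 \<epsilon>. \<rho> x) > 0"
    and "antimono_on {0<..} (f_kernel TYPE('n) \<rho>r)"
    and "\<exists>\<mu>. 0 < \<mu> \<and> \<mu> < 1 \<and>
           (\<forall>t\<in>{0<..<\<epsilon>}. \<mu> * f_kernel TYPE('n) \<rho>r (t / 2) \<ge> f_kernel TYPE('n) \<rho>r t)"
  shows "(Liminf (at_right 0) (\<lambda>t. ereal (t ^ (CARD('n) - 1) * enn2real (\<rho>r t))) > 0 \<longrightarrow>
            (\<exists>C>0. \<forall>u\<in>H_rho_0 \<rho> \<Omega>.
               L2_norm (lebesgue_on \<Omega>) u \<le> C * distr_L2_norm (weak_nonlocal_grad \<rho> u)))
       \<and> (filterlim (\<lambda>t. t ^ (CARD('n) - 1) * enn2real (\<rho>r t)) at_top (at_right 0) \<longrightarrow>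
            compactly_embedded (H_rho_0 \<rho> \<Omega>) (H_rho_norm \<rho>) (L2 lebesgue) (L2_norm lebesgue))"
proof -
  define f where "f = f_kernel TYPE('n) \<rho>r"
  define L where "L = (kernel_symbol f :: real^'n \<Rightarrow> real^'n)"
  interpret radial_profile f "TYPE(real^'n)"
    unfolding f_def by (rule radial_profile_f_kernel[OF assms(3,5,7,10)])
  obtain \<mu> where \<mu>: "\<mu> < 1" and doubling: "\<And>t. t \<in> {0<..<\<epsilon>} \<Longrightarrow> f t \<le> \<mu> * f (t / 2)"
    using assms(11) unfolding f_def by blast
  have Lm: "L \<in> borel_measurable borel" unfolding L_def by (rule kernel_symbol_measurable)
  define c0 where "c0 = 2 * symbol_const TYPE(real^'n) * (1 - \<mu>)"
  have c0: "c0 > 0" using \<mu> symbol_const_pos[where 'a="real^'n"] by (simp add: c0_def)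
  have bound: "c0 * c * (norm \<xi> * s) \<le> norm (L \<xi>)"
    if "\<And>t. 0 < t \<Longrightarrow> t < t0 \<Longrightarrow> c \<le> t * f t" "0 < s" "s < \<epsilon>" "s < t0" "norm \<xi> * s \<le> 1" "\<xi> \<noteq> 0" for c t0 s \<xi>
    unfolding c0_def L_def by (rule norm_kernel_symbol_growth_bound[OF doubling \<mu> that])
  obtain R where R: "R > 0" "\<Omega> \<subseteq> ball 0 R"
    using bounded_subset_ballD[OF assms(2), of 0] by blast
  define rep where "rep u w \<longleftrightarrow> w \<in> borel_measurable borel \<and> (AE x in lebesgue. u x = w x) \<and>
      integrable lborel (\<lambda>x. (w x)\<^sup>2) \<and> (\<forall>x. x \<notin> ball 0 R \<longrightarrow> w x = 0) \<and>
      (LBINT x. (w x)\<^sup>2) = (L2_norm lebesgue u)\<^sup>2 \<and>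
      (\<integral>\<^sup>+\<xi>. ennreal ((norm (L \<xi>))\<^sup>2 * (norm (ft w \<xi>))\<^sup>2) \<partial>lborel)
        \<le> ennreal ((2 * pi) ^ DIM(real^'n) * (distr_L2_norm (weak_nonlocal_grad \<rho> u))\<^sup>2)"
    for u w :: "real^'n \<Rightarrow> real"
  have repr: "\<exists>w. rep u w" if "u \<in> H_rho_0 \<rho> \<Omega>" for u
    unfolding rep_def L_def f_def
    by (rule H_rho_0_fourier_representative[OF assms(3,5,7,10) R(2) that])
  note repD = rep_def[THEN iffD1]
  have growth: "t * f t = t ^ (CARD('n) - 1) * enn2real (\<rho>r t)" if "t > 0" for t
    unfolding f_def by (rule f_kernel_growth[OF that])
  have norm_nonneg: "0 \<le> distr_L2_norm T" for T :: "(real^'n \<Rightarrow> real^'n) \<Rightarrow> real"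
    by (simp add: distr_L2_norm_def L2_norm_def)
  have L2_nonneg: "0 \<le> L2_norm lebesgue u" for u :: "real^'n \<Rightarrow> real"
    by (simp add: L2_norm_def)
  show ?thesis
  proof (intro conjI impI)
    assume "Liminf (at_right 0) (\<lambda>t. ereal (t ^ (CARD('n) - 1) * enn2real (\<rho>r t))) > 0"
    then obtain c where c: "0 < ereal c" "ereal c < Liminf (at_right 0) (\<lambda>t. ereal (t ^ (CARD('n) - 1) * enn2real (\<rho>r t)))"
      using ereal_dense2 by blast
    from less_LiminfD[OF c(2)] obtain t0 where t0: "t0 > 0"
      "\<And>t. 0 < t \<Longrightarrow> t < t0 \<Longrightarrow> c < t ^ (CARD('n) - 1) * enn2real (\<rho>r t)"
      by (auto simp: eventually_at_right_field)
    have g: "c \<le> t * f t" if "0 < t" "t < t0" for t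
      using t0(2)[OF that] growth[OF that(1)] by simp
    define s1 where "s1 = min t0 \<epsilon> / 2"
    have s1: "0 < s1" "s1 < \<epsilon>" "s1 < t0" using t0 \<open>\<epsilon> > 0\<close> by (auto simp: s1_def)
    have below: "\<exists>\<kappa>>0. \<forall>\<xi>. \<delta> \<le> norm \<xi> \<longrightarrow> \<kappa> \<le> norm (L \<xi>)" if \<delta>: "0 < \<delta>" for \<delta>
    proof (intro exI conjI allI impI)
      show "c0 * c * min 1 (\<delta> * s1) > 0" using c0 c(1) \<delta> s1 by simp
      fix \<xi> :: "real^'n" assume \<xi>: "\<delta> \<le> norm \<xi>"
      \<comment> \<open>The largest admissible radius: \<open>1/|\<xi>|\<close> for high frequencies, the fixed \<open>s1\<close> for low ones.\<close>
      define s where "s = min (1 / norm \<xi>) s1"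
      have n: "norm \<xi> > 0" using \<xi> \<delta> by linarith
      have s: "0 < s" "s < \<epsilon>" "s < t0" using n s1 by (auto simp: s_def)
      have ns: "norm \<xi> * s = min 1 (norm \<xi> * s1)" using n by (simp add: s_def min_mult_distrib_left)
      have "norm \<xi> * s \<le> 1" unfolding ns by simp
      moreover have "\<delta> * s1 \<le> norm \<xi> * s1" using \<xi> s1 by (intro mult_right_mono) auto
      then have "min 1 (\<delta> * s1) \<le> norm \<xi> * s" unfolding ns by auto
      then have "c0 * c * min 1 (\<delta> * s1) \<le> c0 * c * (norm \<xi> * s)"
        using c0 c(1) by (intro mult_left_mono) auto
      ultimately show "c0 * c * min 1 (\<delta> * s1) \<le> norm (L \<xi>)"
        using bound[OF g s] n by fastforce
    qed
    obtain C where C: "C > 0" "\<And>w D. w \<in> borel_measurable borel \<Longrightarrow> integrable lborel (\<lambda>x. (w x)\<^sup>2) \<Longrightarrow>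
        (\<And>x. x \<notin> ball 0 R \<Longrightarrow> w x = 0) \<Longrightarrow> 0 \<le> D \<Longrightarrow>
        (\<integral>\<^sup>+\<xi>. ennreal ((norm (L \<xi>))\<^sup>2 * (norm (ft w \<xi>))\<^sup>2) \<partial>lborel) \<le> ennreal ((2 * pi) ^ DIM(real^'n) * D) \<Longrightarrow>
        (LBINT x. (w x)\<^sup>2) \<le> C * D"
      using fourier_poincare[OF Lm R(1) below] by blast
    show "\<exists>C>0. \<forall>u\<in>H_rho_0 \<rho> \<Omega>. L2_norm (lebesgue_on \<Omega>) u \<le> C * distr_L2_norm (weak_nonlocal_grad \<rho> u)"
    proof (intro exI conjI ballI)
      show "sqrt C > 0" using C(1) by simp
      fix u assume u: "u \<in> H_rho_0 \<rho> \<Omega>"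
      let ?D = "distr_L2_norm (weak_nonlocal_grad \<rho> u)"
      obtain w where "rep u w" using repr[OF u] by blast
      note w = repD[OF this]
      have "L2_norm (lebesgue_on \<Omega>) u \<le> L2_norm lebesgue u"
        using u \<open>open \<Omega>\<close> by (intro L2_norm_lebesgue_on_le) (auto simp: H_rho_0_def H_rho_def)
      also have "L2_norm lebesgue u \<le> sqrt C * ?D"
      proof (rule power2_le_imp_le)
        have "(L2_norm lebesgue u)\<^sup>2 \<le> C * ?D\<^sup>2"
          using C(2)[of w "?D\<^sup>2"] w by simp
        also have "\<dots> = (sqrt C * ?D)\<^sup>2" using C(1) by (simp add: power_mult_distrib)
        finally show "(L2_norm lebesgue u)\<^sup>2 \<le> (sqrt C * ?D)\<^sup>2" .
        show "0 \<le> sqrt C * ?D" using C(1) norm_nonneg by simp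
      qed
      finally show "L2_norm (lebesgue_on \<Omega>) u \<le> sqrt C * ?D" .
    qed
  next
    assume lim: "filterlim (\<lambda>t. t ^ (CARD('n) - 1) * enn2real (\<rho>r t)) at_top (at_right 0)"
    have blowup: "\<exists>\<delta>>0. \<forall>\<xi>. \<delta> \<le> norm \<xi> \<longrightarrow> c \<le> norm (L \<xi>)" if c: "0 < c" for c
    proof -
      have "eventually (\<lambda>t. c / c0 \<le> t ^ (CARD('n) - 1) * enn2real (\<rho>r t)) (at_right 0)"
        using lim by (simp add: filterlim_at_top)
      then obtain t0 where t0: "t0 > 0" "\<And>t. 0 < t \<Longrightarrow> t < t0 \<Longrightarrow> c / c0 \<le> t ^ (CARD('n) - 1) * enn2real (\<rho>r t)"
        by (auto simp: eventually_at_right_field)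
      have g: "c / c0 \<le> t * f t" if "0 < t" "t < t0" for t
        using t0(2)[OF that] growth[OF that(1)] by simp
      define s1 where "s1 = min t0 \<epsilon> / 2"
      have s1: "0 < s1" "s1 < \<epsilon>" "s1 < t0" using t0 \<open>\<epsilon> > 0\<close> by (auto simp: s1_def)
      have "c \<le> norm (L \<xi>)" if \<xi>: "1 / s1 \<le> norm \<xi>" for \<xi>
      proof -
        have n: "norm \<xi> > 0" 
        proof -
          have "0 < 1 / s1" using s1(1) by simp
          then show ?thesis using \<xi> by linarith
        qed
        have "1 / norm \<xi> \<le> s1" using \<xi> n s1(1) by (simp add: field_simps)
        then have s: "0 < 1 / norm \<xi>" "1 / norm \<xi> < \<epsilon>" "1 / norm \<xi> < t0" using n s1 by auto
        \<comment> \<open>Here the radius \<open>1/|\<xi>|\<close> is admissible, so \<open>|\<xi>| s = 1\<close>.\<close>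
        have "c0 * (c / c0) * (norm \<xi> * (1 / norm \<xi>)) \<le> norm (L \<xi>)"
          using n by (intro bound[OF g s]) auto
        then show ?thesis using n c0 by simp
      qed
      then show ?thesis using s1(1) by (intro exI[of _ "1 / s1"]) simp
    qed
    show "compactly_embedded (H_rho_0 \<rho> \<Omega>) (H_rho_norm \<rho>) (L2 lebesgue) (L2_norm lebesgue)"
      unfolding compactly_embedded_def
    proof (intro conjI allI impI)
      show "H_rho_0 \<rho> \<Omega> \<subseteq> L2 lebesgue" by (auto simp: H_rho_0_def H_rho_def)
      have "L2_norm lebesgue u \<le> 1 * H_rho_norm \<rho> u" for u
        unfolding H_rho_norm_def using L2_nonneg by (simp add: real_le_rsqrt)
      then show "\<exists>C. \<forall>u\<in>H_rho_0 \<rho> \<Omega>. L2_norm lebesgue u \<le> C * H_rho_norm \<rho> u" by blast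
      fix u :: "nat \<Rightarrow> real^'n \<Rightarrow> real"
      assume "(\<forall>k. u k \<in> H_rho_0 \<rho> \<Omega>) \<and> (\<exists>B. \<forall>k. H_rho_norm \<rho> (u k) \<le> B)"
      then obtain B where u: "\<And>k. u k \<in> H_rho_0 \<rho> \<Omega>" and B: "\<And>k. H_rho_norm \<rho> (u k) \<le> B" by blast
      let ?D = "\<lambda>k. distr_L2_norm (weak_nonlocal_grad \<rho> (u k))"
      have sq: "(L2_norm lebesgue (u k))\<^sup>2 + (?D k)\<^sup>2 \<le> B\<^sup>2" for k
      proof -
        have "(H_rho_norm \<rho> (u k))\<^sup>2 \<le> B\<^sup>2"
          by (intro power_mono B) (simp add: H_rho_norm_def)
        then show ?thesis by (simp add: H_rho_norm_def)
      qed
      obtain w where "\<And>k. rep (u k) (w k)" using repr[OF u] by metis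
      note wk = repD[OF this]
      have w: "\<And>k. w k \<in> borel_measurable borel" "\<And>k. AE x in lebesgue. u k x = w k x"
        "\<And>k. integrable lborel (\<lambda>x. (w k x)\<^sup>2)" "\<And>k x. x \<notin> ball 0 R \<Longrightarrow> w k x = 0"
        "\<And>k. (LBINT x. (w k x)\<^sup>2) = (L2_norm lebesgue (u k))\<^sup>2"
        "\<And>k. (\<integral>\<^sup>+\<xi>. ennreal ((norm (L \<xi>))\<^sup>2 * (norm (ft (w k) \<xi>))\<^sup>2) \<partial>lborel)
            \<le> ennreal ((2 * pi) ^ DIM(real^'n) * (?D k)\<^sup>2)"
        using wk by blast+
      have N: "(LBINT x. (w k x)\<^sup>2) \<le> B\<^sup>2" for k
        unfolding w(5) using sq[of k] zero_le_power2[of "?D k"] by linarith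
      have D: "(\<integral>\<^sup>+\<xi>. ennreal ((norm (L \<xi>))\<^sup>2 * (norm (ft (w k) \<xi>))\<^sup>2) \<partial>lborel)
          \<le> ennreal ((2 * pi) ^ DIM(real^'n) * B\<^sup>2)" for k
      proof -
        have "(?D k)\<^sup>2 \<le> B\<^sup>2" using sq[of k] zero_le_power2[of "L2_norm lebesgue (u k)"] by linarith
        then show ?thesis by (intro order_trans[OF w(6)] ennreal_leI mult_left_mono) auto
      qed
      have "\<exists>r v. strict_mono r \<and> v \<in> borel_measurable borel \<and> integrable lborel (\<lambda>x. (v x)\<^sup>2) \<and>
          (\<lambda>k. \<integral>x. (w (r k) x - v x)\<^sup>2 \<partial>lborel) \<longlonglongrightarrow> 0"
        by (rule fourier_compactness[OF Lm R(1) blowup w(1) w(3) w(4) N D])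
      then obtain r v where r: "strict_mono r" and vm [measurable]: "v \<in> borel_measurable borel"
        and v2: "integrable lborel (\<lambda>x. (v x)\<^sup>2)" and conv: "(\<lambda>k. \<integral>x. (w (r k) x - v x)\<^sup>2 \<partial>lborel) \<longlonglongrightarrow> 0"
        by blast
      have vl [measurable]: "v \<in> borel_measurable lebesgue" using vm by (intro measurable_completion) simp
      have "v \<in> L2 lebesgue"
        using v2 vl by (simp add: L2_def integrable_completion)
      moreover have "L2_norm lebesgue (\<lambda>x. u k x - v x) = sqrt (LBINT x. (w k x - v x)\<^sup>2)" for k
      proof -
        note [measurable] = w(1)
        have [measurable]: "u k \<in> borel_measurable lebesgue"
          using u[of k] by (auto simp: H_rho_0_def H_rho_def L2_def)
        have [measurable]: "w k \<in> borel_measurable lebesgue" using w(1)[of k] by (intro measurable_completion) simp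
        have "(\<integral>x. (norm (u k x - v x))\<^sup>2 \<partial>lebesgue) = (\<integral>x. (w k x - v x)\<^sup>2 \<partial>lebesgue)"
          by (rule integral_cong_AE) (use w(2)[of k] in \<open>auto elim: eventually_mono\<close>)
        also have "\<dots> = (LBINT x. (w k x - v x)\<^sup>2)"
          by (rule integral_completion) measurable
        finally show ?thesis by (simp add: L2_norm_def)
      qed
      moreover have "(\<lambda>k. sqrt (LBINT x. (w (r k) x - v x)\<^sup>2)) \<longlonglongrightarrow> sqrt 0"
        by (intro tendsto_real_sqrt conv)
      ultimately show "\<exists>r v. strict_mono r \<and> v \<in> L2 lebesgue \<and> (\<lambda>k. L2_norm lebesgue (\<lambda>x. u (r k) x - v x)) \<longlonglongrightarrow> 0"
        using r by (intro exI[of _ r] exI[of _ v]) simp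
    qed
  qed
qed

end
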